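(* Let $V$ be an irreducible uniformly bounded weight module for $(\mathcal{S}_N\ltimes A_N)\otimes B$ such that $t^{\mathbf{s}}$ acts non-trivially on $V$ for some $\mathbf{0}\neq\mathbf{s}\in\mathbb{Z}^N$ and $t^{\mathbf{0}}$ acts non-trivially on $V$ (hence by a nonzero scalar $c$, as $t^{\mathbf 0}$ is central). Let $\lambda\in P(V)$ be any weight and put $\Lambda=(\lambda(d_i))_{i=1}^N\in\mathbb{C}^N$. Then: (1) $V=\bigoplus_{\mathbf{r}\in\mathbb{Z}^N}V_{\Lambda+\mathbf{r}}$, where $V_{\Lambda+\mathbf{r}}=\{v\in V\mid D(u,\mathbf{0})v=(u,\Lambda+\mathbf{r})v\ \ \forall u\in\mathbb{C}^N\}$; the elements $t^{\mathbf{r}}$ act injectively on $V$ for every $\mathbf{r}\in\mathbb{Z}^N$; and $P(V)=\lambda+\sum_{i=1}^N\mathbb{Z}\delta_i$. (2) There exist an algebra homomorphism $\psi:B\to\mathbb{C}$ with $\psi(1)=1$, a linear map $\phi:B\to\mathbb{C}$ with $\phi(1)=1$, and a bilinear function $f:\mathbb{C}^N\times B\to\mathbb{C}$ with $f(u,1)=(u,\Lambda)$ such that, for all $b\in B$, \begin{align*} t^{\mathbf{r}}b&=\psi(b)t^{\mathbf{r}}\ \text{ on } V,\ \text{ for } \mathbf{r}\neq\mathbf{0},\\ t^{\mathbf{0}}b&=\phi(b)t^{\mathbf{0}}\ \text{ on } V,\\ D(u,\mathbf{r})b&=\psi(b)D(u,\mathbf{r})\ \text{ on } V,\ \text{ for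 } \mathbf{r}\neq\mathbf{0},\ u\in\mathbb{C}^N,\ (u,\mathbf{r})=0,\\ D(u,\mathbf{0})b\cdot v&=(f(u,b)+(u,\mathbf{r})\psi(b))v,\ \text{ for } u\in\mathbb{C}^N,\ v\in V_{\Lambda+\mathbf{r}},\ \mathbf{r}\in\mathbb{Z}^N. \end{align*} (3) With these $\psi,\phi$, the action of $A_N\otimes B$ on $V$ is quasi-associative: there are nonzero complex numbers $\kappa,\mu$ with $\kappa^2=c\mu$ such that, as operators on $V$, for all $b,b'\in B$, $$t^{\mathbf{m}}b\cdot t^{\mathbf{n}}b'=\begin{cases}\kappa\, t^{\mathbf{m}+\mathbf{n}}(bb')=\psi(bb')\kappa\, t^{\mathbf{m}+\mathbf{n}},&\mathbf{m},\mathbf{n},\mathbf{m}+\mathbf{n}\in\mathbb{Z}^N\setminus\{\mathbf{0}\},\\ \psi(bb')\mu\, t^{\mathbf{0}},&\mathbf{m},\mathbf{n}\in\mathbb{Z}^N\setminus\{\mathbf{0}\},\ \mathbf{m}+\mathbf{n}=\mathbf{0},\\ \psi(b)\phi(b')c\, t^{\mathbf{m}},&\mathbf{m}\neq\mathbf{0},\ \mathbf{n}=\mathbf{0},\\ \phi(b)\phi(b')c\, t^{\mathbf{0}},&\mathbf{m}=\mathbf{n}=\mathbf{0}.\end{cases}$$ (4) For every $0\neq v\in V$, $V=\mathcal{U}((\mathcal{S}_N\ltimes A_N)\otimes B)\cdot v=\mathcal{U}(\mathcal{S}_N\ltimes A_N)\cdot v$. Therefore $V$ is an irreducible weight module for $\mathcal{S}_N\ltimes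 A_N$ with finite-dimensional weight spaces; in particular $V$ is an irreducible object of the category $\mathcal{J}$ for the Lie algebra $\mathcal{S}_N$.
   Context: All vector spaces, algebras and tensor products are over $\mathbb{C}$; $B$ is a finitely generated commutative associative unital algebra; $N\ge 2$ is an integer. $A_N=\mathbb{C}[t_1^{\pm1},\dots,t_N^{\pm1}]$, $t^{\mathbf{m}}=t_1^{m_1}\cdots t_N^{m_N}$ for $\mathbf{m}\in\mathbb{Z}^N$, $d_i=t_i\frac{d}{dt_i}$, and $(x,y)=(x|y)=\sum_i x_iy_i$ on $\mathbb{C}^N$. For $u\in\mathbb{C}^N$, $\mathbf{r}\in\mathbb{Z}^N$ put $D(u,\mathbf{r})=\sum_i u_it^{\mathbf{r}}d_i$. The special algebra is $\mathcal{S}_N=\mathrm{span}\{D(u,\mathbf{r})\mid (u,\mathbf{r})=0\}$ with $[D(u,\mathbf{r}),D(v,\mathbf{s})]=D((u,\mathbf{s})v-(v,\mathbf{r})u,\mathbf{r}+\mathbf{s})$. In $\mathcal{S}_N\ltimes A_N$, $A_N$ is an abelian ideal and $[D(u,\mathbf{r}),t^{\mathbf{s}}]=(u,\mathbf{s})t^{\mathbf{r}+\mathbf{s}}$. For a Lie algebra $\mathfrak{g}$, $\mathfrak{g}\otimes B$ has bracket $[x\otimes b_1,y\otimes b_2]=[x,y]\otimes b_1b_2$. Write $xb$ for $x\otimes b$ and identify $x$ with $x\otimes1$; so $\mathfrak{g}\subseteq\mathfrak{g}\otimes B$. $\mathfrak{h}=\mathrm{span}\{d_1,\dots,d_N\}$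 is the Cartan subalgebra; $\delta_i\in\mathfrak{h}^*$ is given by $\delta_i(d_j)=\delta_{ij}$. A weight module is a module with $V=\bigoplus_{\lambda\in\mathfrak{h}^*}V_\lambda$, $V_\lambda=\{v\mid hv=\lambda(h)v\ \forall h\in\mathfrak{h}\}$; $P(V)=\{\lambda\mid V_\lambda\ne0\}$. It is uniformly bounded if there is a positive integer $M$ with $\dim V_\lambda\le M$ for all $\lambda$. $\mathcal{U}(\cdot)$ denotes the universal enveloping algebra. Category $\mathcal{J}$ for $\mathcal{S}_N$ (jet modules): $\mathfrak h$-weight modules over $\mathcal{S}_N$ with finite-dimensional weight spaces that admit an action of the commutative associative unital algebra $A_N$ compatible with the $\mathcal{S}_N$-action, i.e. $x(gv)=x(g)v+g(xv)$ for $x\in\mathcal{S}_N$, $g\in A_N$; irreducible means having no proper nonzero subspace stable under both actions. *)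

theory Defs
  imports
    "HOL-Analysis.Analysis"
    "HOL-Library.Poly_Mapping"
    "HOL-Library.Function_Algebras"
begin

section \<open>Complex vector spaces, algebras and Lie algebras\<close>

class complex_vector = ab_group_add +
  fixes scaleC :: "complex \<Rightarrow> 'a \<Rightarrow> 'a" (infixr "*\<^sub>C" 75)
  assumes scaleC_add_right: "a *\<^sub>C (x + y) = a *\<^sub>C x + a *\<^sub>C y"
    and scaleC_add_left: "(a + b) *\<^sub>C x = a *\<^sub>C x + b *\<^sub>C x"
    and scaleC_scaleC: "a *\<^sub>C b *\<^sub>C x = (a * b) *\<^sub>C x"
    and scaleC_one: "1 *\<^sub>C x = x"

global_interpretation cvs: vector_space "scaleC :: complex \<Rightarrow> 'a \<Rightarrow> 'a::complex_vector"
  by unfold_locales (simp_all add: scaleC_add_right scaleC_add_left scaleC_scaleC scaleC_one)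

global_interpretation cvs: vector_space_pair
  "scaleC :: complex \<Rightarrow> 'a \<Rightarrow> 'a::complex_vector" "scaleC :: complex \<Rightarrow> 'b \<Rightarrow> 'b::complex_vector"
  by unfold_locales

abbreviation clinear :: "('a::complex_vector \<Rightarrow> 'b::complex_vector) \<Rightarrow> bool"
  where "clinear \<equiv> Vector_Spaces.linear scaleC scaleC"

lemma clinearI:
  assumes "\<And>x y. f (x + y) = f x + f y" "\<And>a x. f (a *\<^sub>C x) = a *\<^sub>C f x"
  shows "clinear f"
  using assms by unfold_locales auto

definition cbilinear ::
    "('a::complex_vector \<Rightarrow> 'b::complex_vector \<Rightarrow> 'c::complex_vector) \<Rightarrow> bool"
  where "cbilinear f \<longleftrightarrow> (\<forall>x. clinear (f x)) \<and> (\<forall>y. clinear (\<lambda>x. f x y))"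

text \<open>The library's dimension function is 0 on infinite-dimensional spaces, so finite
  dimensionality has to be recorded separately.\<close>

definition finite_dim :: "'a::complex_vector set \<Rightarrow> bool"
  where "finite_dim W \<longleftrightarrow> (\<exists>S. finite S \<and> W \<subseteq> cvs.span S)"

text \<open>The whole space is the (internal) direct sum of the subspaces \<open>W i\<close>, \<open>i \<in> I\<close>: every vector
  is the sum of a unique finitely supported family of components.\<close>

definition internal_direct_sum :: "'i set \<Rightarrow> ('i \<Rightarrow> 'a::complex_vector set) \<Rightarrow> bool"
  where "internal_direct_sum I W \<longleftrightarrow>
    (\<forall>i\<in>I. cvs.subspace (W i)) \<and>
    (\<forall>v. \<exists>!f. (\<forall>i\<in>I. f i \<in> W i) \<and> (\<forall>i. i \<notin> I \<longrightarrow> f i = 0) \<and>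
              finite {i. f i \<noteq> 0} \<and> v = (\<Sum>i\<in>{i. f i \<noteq> 0}. f i))"

class complex_comm_algebra_1 = complex_vector + comm_ring_1 +
  assumes mult_scaleC_left: "(a *\<^sub>C x) * y = a *\<^sub>C (x * y)"

definition algebra_generated :: "'b::complex_comm_algebra_1 set \<Rightarrow> 'b set"
  where "algebra_generated S = \<Inter>{T. cvs.subspace T \<and> 1 \<in> T \<and> (\<forall>x\<in>T. \<forall>y\<in>T. x * y \<in> T) \<and> S \<subseteq> T}"

definition algebra_hom :: "('a::complex_comm_algebra_1 \<Rightarrow> 'b::complex_comm_algebra_1) \<Rightarrow> bool"
  where "algebra_hom f \<longleftrightarrow> clinear f \<and> (\<forall>x y. f (x * y) = f x * f y)"

class complex_lie_algebra = complex_vector +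
  fixes lie_bracket :: "'a \<Rightarrow> 'a \<Rightarrow> 'a"
  assumes lie_bracket_add_left: "lie_bracket (x + y) z = lie_bracket x z + lie_bracket y z"
    and lie_bracket_add_right: "lie_bracket x (y + z) = lie_bracket x y + lie_bracket x z"
    and lie_bracket_scaleC_left: "lie_bracket (a *\<^sub>C x) y = a *\<^sub>C lie_bracket x y"
    and lie_bracket_scaleC_right: "lie_bracket x (a *\<^sub>C y) = a *\<^sub>C lie_bracket x y"
    and lie_bracket_self: "lie_bracket x x = 0"
    and jacobi: "lie_bracket x (lie_bracket y z) + lie_bracket y (lie_bracket z x)
                  + lie_bracket z (lie_bracket x y) = 0"

instantiation complex :: complex_comm_algebra_1
begin
definition scaleC_complex :: "complex \<Rightarrow> complex \<Rightarrow> complex"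
  where [simp]: "scaleC_complex a x = a * x"
instance by standard (simp_all add: algebra_simps)
end

instantiation "fun" :: (type, complex_vector) complex_vector
begin
definition scaleC_fun :: "complex \<Rightarrow> ('a \<Rightarrow> 'b) \<Rightarrow> 'a \<Rightarrow> 'b"
  where "scaleC_fun a f = (\<lambda>x. a *\<^sub>C f x)"
instance
  by standard (simp_all add: scaleC_fun_def fun_eq_iff scaleC_add_right scaleC_add_left
      scaleC_scaleC scaleC_one)
end

instantiation vec :: (complex_vector, finite) complex_vector
begin
definition scaleC_vec :: "complex \<Rightarrow> 'a ^ 'b \<Rightarrow> 'a ^ 'b"
  where "scaleC_vec a x = (\<chi> i. a *\<^sub>C x $ i)"
instance
  by standard (simp_all add: scaleC_vec_def vec_eq_iff scaleC_add_right scaleC_add_left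
      scaleC_scaleC scaleC_one)
end

instantiation poly_mapping :: (type, complex_vector) complex_vector
begin
lift_definition scaleC_poly_mapping :: "complex \<Rightarrow> ('a \<Rightarrow>\<^sub>0 'b) \<Rightarrow> 'a \<Rightarrow>\<^sub>0 'b"
  is "\<lambda>a f x. a *\<^sub>C f x"
  by (erule finite_subset[rotated]) auto
instance
  by standard (transfer; simp add: fun_eq_iff scaleC_add_right scaleC_add_left
      scaleC_scaleC scaleC_one)+
end

lemma lookup_scaleC [simp]: "Poly_Mapping.lookup (a *\<^sub>C p) k = a *\<^sub>C Poly_Mapping.lookup p k"
  by transfer simp

lemma scaleC_single: "a *\<^sub>C Poly_Mapping.single k c = Poly_Mapping.single k (a *\<^sub>C c)"
  by (rule poly_mapping_eqI) (simp add: lookup_single when_def)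


section \<open>Modules\<close>

definition lie_module :: "('g::complex_lie_algebra \<Rightarrow> 'v::complex_vector \<Rightarrow> 'v) \<Rightarrow> bool"
  where "lie_module \<rho> \<longleftrightarrow> cbilinear \<rho> \<and>
    (\<forall>x y v. \<rho> (lie_bracket x y) v = \<rho> x (\<rho> y v) - \<rho> y (\<rho> x v))"

definition irreducible_under :: "('v::complex_vector \<Rightarrow> 'v) set \<Rightarrow> bool"
  where "irreducible_under T \<longleftrightarrow> (\<exists>v::'v. v \<noteq> 0) \<and>
    (\<forall>W. cvs.subspace W \<and> (\<forall>F\<in>T. F ` W \<subseteq> W) \<longrightarrow> W = {0} \<or> W = UNIV)"

definition irreducible_module :: "('g::complex_lie_algebra \<Rightarrow> 'v::complex_vector \<Rightarrow> 'v) \<Rightarrow> bool"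
  where "irreducible_module \<rho> \<longleftrightarrow> lie_module \<rho> \<and> irreducible_under (range \<rho>)"

text \<open>\<open>\<U>(\<gg>)\<cdot>v\<close>: the enveloping algebra is spanned by the products \<open>x\<^sub>1\<cdots>x\<^sub>k\<close> (\<open>k \<ge> 0\<close>) of elements
  of \<open>\<gg>\<close>, and such a product acts by \<open>v \<mapsto> x\<^sub>1(\<cdots>(x\<^sub>k v))\<close>.\<close>

definition enveloping_orbit ::
    "('g::complex_lie_algebra \<Rightarrow> 'v::complex_vector \<Rightarrow> 'v) \<Rightarrow> 'v \<Rightarrow> 'v set"
  where "enveloping_orbit \<rho> v = cvs.span {foldr \<rho> xs v | xs. True}"


section \<open>Tensor products and current algebras\<close>

definition tensor_relations ::
    "(('g::complex_vector \<times> 'b::complex_vector) \<Rightarrow>\<^sub>0 complex) set"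
  where "tensor_relations = cvs.span
    ({Poly_Mapping.single (x + y, b) 1 - Poly_Mapping.single (x, b) 1 - Poly_Mapping.single (y, b) 1
        | x y b. True} \<union>
     {Poly_Mapping.single (x, b + b') 1 - Poly_Mapping.single (x, b) 1 - Poly_Mapping.single (x, b') 1
        | x b b'. True} \<union>
     {Poly_Mapping.single (a *\<^sub>C x, b) 1 - a *\<^sub>C Poly_Mapping.single (x, b) 1 | a x b. True} \<union>
     {Poly_Mapping.single (x, a *\<^sub>C b) 1 - a *\<^sub>C Poly_Mapping.single (x, b) 1 | a x b. True})"

definition tensor_eq ::
    "(('g::complex_vector \<times> 'b::complex_vector) \<Rightarrow>\<^sub>0 complex) \<Rightarrow> (('g \<times> 'b) \<Rightarrow>\<^sub>0 complex) \<Rightarrow> bool"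
  where "tensor_eq p q \<longleftrightarrow> p - q \<in> tensor_relations"

lemma subspace_tensor_relations: "cvs.subspace tensor_relations"
  unfolding tensor_relations_def by (rule cvs.subspace_span)

lemma tensor_relations_closed:
  "0 \<in> tensor_relations"
  "p \<in> tensor_relations \<Longrightarrow> q \<in> tensor_relations \<Longrightarrow> p + q \<in> tensor_relations"
  "p \<in> tensor_relations \<Longrightarrow> q \<in> tensor_relations \<Longrightarrow> p - q \<in> tensor_relations"
  "p \<in> tensor_relations \<Longrightarrow> - p \<in> tensor_relations"
  "p \<in> tensor_relations \<Longrightarrow> a *\<^sub>C p \<in> tensor_relations"
  by (rule cvs.subspace_0 cvs.subspace_add cvs.subspace_diff cvs.subspace_neg cvs.subspace_scale;
      (rule subspace_tensor_relations)?; assumption?)+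

quotient_type (overloaded) ('g, 'b) tensor =
    "('g::complex_vector \<times> 'b::complex_vector) \<Rightarrow>\<^sub>0 complex" / tensor_eq
proof (rule equivpI)
  show "reflp (tensor_eq :: ('g \<times> 'b \<Rightarrow>\<^sub>0 complex) \<Rightarrow> _)"
    by (rule reflpI) (simp add: tensor_eq_def tensor_relations_closed)
  show "symp (tensor_eq :: ('g \<times> 'b \<Rightarrow>\<^sub>0 complex) \<Rightarrow> _)"
  proof (rule sympI)
    fix p q :: "('g \<times> 'b) \<Rightarrow>\<^sub>0 complex"
    assume "tensor_eq p q"
    then have "- (p - q) \<in> tensor_relations"
      unfolding tensor_eq_def by (rule tensor_relations_closed(4))
    then show "tensor_eq q p" by (simp add: tensor_eq_def)
  qed
  show "transp (tensor_eq :: ('g \<times> 'b \<Rightarrow>\<^sub>0 complex) \<Rightarrow> _)"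
  proof (rule transpI)
    fix p q r :: "('g \<times> 'b) \<Rightarrow>\<^sub>0 complex"
    assume "tensor_eq p q" "tensor_eq q r"
    then have "(p - q) + (q - r) \<in> tensor_relations"
      unfolding tensor_eq_def by (rule tensor_relations_closed(2))
    then show "tensor_eq p r" by (simp add: tensor_eq_def)
  qed
qed

instantiation tensor :: (complex_vector, complex_vector) complex_vector
begin

lift_definition zero_tensor :: "('a, 'b) tensor" is 0 .

lift_definition plus_tensor :: "('a, 'b) tensor \<Rightarrow> ('a, 'b) tensor \<Rightarrow> ('a, 'b) tensor" is "(+)"
  unfolding tensor_eq_def by (simp only: add_diff_add tensor_relations_closed(2))

lift_definition uminus_tensor :: "('a, 'b) tensor \<Rightarrow> ('a, 'b) tensor" is uminus
  unfolding tensor_eq_def by (simp only: minus_diff_minus tensor_relations_closed(4))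

lift_definition minus_tensor :: "('a, 'b) tensor \<Rightarrow> ('a, 'b) tensor \<Rightarrow> ('a, 'b) tensor" is "(-)"
proof -
  fix p p' q q' :: "('a \<times> 'b) \<Rightarrow>\<^sub>0 complex"
  assume "tensor_eq p p'" "tensor_eq q q'"
  then have "(p - p') - (q - q') \<in> tensor_relations"
    unfolding tensor_eq_def by (rule tensor_relations_closed(3))
  then show "tensor_eq (p - q) (p' - q')" by (simp add: tensor_eq_def algebra_simps)
qed

lift_definition scaleC_tensor :: "complex \<Rightarrow> ('a, 'b) tensor \<Rightarrow> ('a, 'b) tensor" is scaleC
  unfolding tensor_eq_def by (simp only: cvs.scale_right_diff_distrib[symmetric] tensor_relations_closed(5))

instance
proof
  fix x y z :: "('a, 'b) tensor" and a b :: complex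
  have eqI: "p = q \<Longrightarrow> tensor_eq p q" for p q :: "('a \<times> 'b) \<Rightarrow>\<^sub>0 complex"
    by (simp add: tensor_eq_def tensor_relations_closed)
  show "x + y + z = x + (y + z)" by transfer (simp add: eqI add.assoc)
  show "x + y = y + x" by transfer (simp add: eqI add.commute)
  show "0 + x = x" by transfer (simp add: eqI)
  show "- x + x = 0" by transfer (simp add: eqI)
  show "x - y = x + - y" by transfer (simp add: eqI)
  show "a *\<^sub>C (x + y) = a *\<^sub>C x + a *\<^sub>C y" by transfer (simp add: eqI scaleC_add_right)
  show "(a + b) *\<^sub>C x = a *\<^sub>C x + b *\<^sub>C x" by transfer (simp add: eqI scaleC_add_left)
  show "a *\<^sub>C b *\<^sub>C x = (a * b) *\<^sub>C x" by transfer (simp add: eqI scaleC_scaleC)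
  show "1 *\<^sub>C x = x" by transfer (simp add: eqI scaleC_one)
qed

end

lift_definition tens :: "'g::complex_vector \<Rightarrow> 'b::complex_vector \<Rightarrow> ('g, 'b) tensor"
    (infixl "\<otimes>\<^sub>C" 70)
  is "\<lambda>x b. Poly_Mapping.single (x, b) 1" .

lemma cbilinear_tens: "cbilinear ((\<otimes>\<^sub>C) :: 'g::complex_vector \<Rightarrow> 'b::complex_vector \<Rightarrow> _)"
proof -
  have 1: "tensor_eq (Poly_Mapping.single (x + y, b) 1)
      (Poly_Mapping.single (x, b) 1 + Poly_Mapping.single (y, b) 1)" for x y :: 'g and b :: 'b
    unfolding tensor_eq_def tensor_relations_def diff_diff_add[symmetric]
    by (rule cvs.span_base) blast
  have 2: "tensor_eq (Poly_Mapping.single (x, b + b') 1)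
      (Poly_Mapping.single (x, b) 1 + Poly_Mapping.single (x, b') 1)" for x :: 'g and b b' :: 'b
    unfolding tensor_eq_def tensor_relations_def diff_diff_add[symmetric]
    by (rule cvs.span_base) blast
  have 3: "tensor_eq (Poly_Mapping.single (a *\<^sub>C x, b) 1) (a *\<^sub>C Poly_Mapping.single (x, b) 1)"
    for a and x :: 'g and b :: 'b
    unfolding tensor_eq_def tensor_relations_def by (rule cvs.span_base) blast
  have 4: "tensor_eq (Poly_Mapping.single (x, a *\<^sub>C b) 1) (a *\<^sub>C Poly_Mapping.single (x, b) 1)"
    for a and x :: 'g and b :: 'b
    unfolding tensor_eq_def tensor_relations_def by (rule cvs.span_base) blast
  show ?thesis
    unfolding cbilinear_def
  proof (intro conjI allI clinearI)
    fix x y :: 'g and b b' :: 'b and a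
    show "x \<otimes>\<^sub>C (b + b') = x \<otimes>\<^sub>C b + x \<otimes>\<^sub>C b'" by transfer (rule 2)
    show "x \<otimes>\<^sub>C (a *\<^sub>C b) = a *\<^sub>C (x \<otimes>\<^sub>C b)" by transfer (rule 4)
    show "(x + y) \<otimes>\<^sub>C b = x \<otimes>\<^sub>C b + y \<otimes>\<^sub>C b" by transfer (rule 1)
    show "(a *\<^sub>C x) \<otimes>\<^sub>C b = a *\<^sub>C (x \<otimes>\<^sub>C b)" by transfer (rule 3)
  qed
qed

text \<open>Linear extension of a map on the basis of a free vector space.\<close>

definition lin_ext :: "('k \<Rightarrow> 'w::complex_vector) \<Rightarrow> ('k \<Rightarrow>\<^sub>0 complex) \<Rightarrow> 'w"
  where "lin_ext F p = (\<Sum>k\<in>Poly_Mapping.keys p. Poly_Mapping.lookup p k *\<^sub>C F k)"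

lemma lin_ext_superset:
  assumes "finite S" "Poly_Mapping.keys p \<subseteq> S"
  shows "lin_ext F p = (\<Sum>k\<in>S. Poly_Mapping.lookup p k *\<^sub>C F k)"
  unfolding lin_ext_def
  by (rule sum.mono_neutral_left) (use assms in \<open>auto simp: in_keys_iff\<close>)

lemma lin_ext_linear: "clinear (lin_ext (F :: 'k \<Rightarrow> 'w::complex_vector))"
proof (rule clinearI)
  fix p q :: "'k \<Rightarrow>\<^sub>0 complex" and a
  let ?S = "Poly_Mapping.keys p \<union> Poly_Mapping.keys q"
  have "lin_ext F (p + q) = (\<Sum>k\<in>?S. Poly_Mapping.lookup (p + q) k *\<^sub>C F k)"
    by (rule lin_ext_superset) (use Poly_Mapping.keys_add[of p q] in auto)
  moreover have "lin_ext F p = (\<Sum>k\<in>?S. Poly_Mapping.lookup p k *\<^sub>C F k)"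
    "lin_ext F q = (\<Sum>k\<in>?S. Poly_Mapping.lookup q k *\<^sub>C F k)"
    by (rule lin_ext_superset; auto)+
  ultimately show "lin_ext F (p + q) = lin_ext F p + lin_ext F q"
    by (simp add: lookup_add scaleC_add_left sum.distrib)
  have "lin_ext F (a *\<^sub>C p) = (\<Sum>k\<in>Poly_Mapping.keys p. Poly_Mapping.lookup (a *\<^sub>C p) k *\<^sub>C F k)"
    by (rule lin_ext_superset) (auto simp: in_keys_iff)
  then show "lin_ext F (a *\<^sub>C p) = a *\<^sub>C lin_ext F p"
    by (simp add: lin_ext_def cvs.scale_sum_right scaleC_scaleC)
qed

lemma lin_ext_single [simp]: "lin_ext F (Poly_Mapping.single k c) = c *\<^sub>C F k"
proof -
  have "lin_ext F (Poly_Mapping.single k c)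
      = (\<Sum>j\<in>{k}. Poly_Mapping.lookup (Poly_Mapping.single k c) j *\<^sub>C F j)"
    by (rule lin_ext_superset) auto
  then show ?thesis by simp
qed

lemmas lin_ext_simps =
  cvs.linear_add[OF lin_ext_linear] cvs.linear_diff[OF lin_ext_linear]
  cvs.linear_scale[OF lin_ext_linear] cvs.linear_0[OF lin_ext_linear]

lemma free_span: "cvs.span {Poly_Mapping.single k (1::complex) | k. True} = UNIV"
proof -
  have "p \<in> cvs.span {Poly_Mapping.single k (1::complex) | k. True}" for p :: "'a \<Rightarrow>\<^sub>0 complex"
  proof -
    have "p = (\<Sum>k\<in>Poly_Mapping.keys p. Poly_Mapping.lookup p k *\<^sub>C Poly_Mapping.single k 1)"
      by (rule poly_mapping_eqI)
        (auto simp: lookup_sum lookup_single when_def in_keys_iff if_distrib cong: if_cong)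
    also have "\<dots> \<in> cvs.span {Poly_Mapping.single k (1::complex) | k. True}"
      by (intro cvs.span_sum cvs.span_scale cvs.span_base) blast
    finally show ?thesis .
  qed
  then show ?thesis by blast
qed

lemma tensor_span: "cvs.span {x \<otimes>\<^sub>C b | x b. True} = (UNIV :: ('g::complex_vector, 'b::complex_vector) tensor set)"
proof -
  have lin: "clinear (abs_tensor :: _ \<Rightarrow> ('g, 'b) tensor)"
    by (rule clinearI) (simp_all add: plus_tensor.abs_eq scaleC_tensor.abs_eq)
  have "z \<in> cvs.span {x \<otimes>\<^sub>C b | x b. True}" for z :: "('g, 'b) tensor"
  proof -
    obtain p where z: "z = abs_tensor p" by (metis Quotient_abs_rep Quotient_tensor)
    have "p \<in> cvs.span {Poly_Mapping.single k (1::complex) | k. True}"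
      using free_span by blast
    then have "z \<in> cvs.span (abs_tensor ` {Poly_Mapping.single k (1::complex) | k. True})"
      unfolding z cvs.linear_span_image[OF lin] by blast
    also have "abs_tensor ` {Poly_Mapping.single k (1::complex) | k. True} = {x \<otimes>\<^sub>C b | x b. True}"
      by (force simp: tens.abs_eq image_iff)
    finally show ?thesis .
  qed
  then show ?thesis by blast
qed

lemma tensor_induct [case_names tens add scale]:
  fixes z :: "('g::complex_vector, 'b::complex_vector) tensor"
  assumes "\<And>x b. P (x \<otimes>\<^sub>C b)" "\<And>y z. P y \<Longrightarrow> P z \<Longrightarrow> P (y + z)" "\<And>a z. P z \<Longrightarrow> P (a *\<^sub>C z)"
  shows "P z"
proof -
  have 0: "P 0" using assms(3)[of _ 0, OF assms(1)] by simp
  have "z \<in> cvs.span {x \<otimes>\<^sub>C b | x b. True}" using tensor_span by blast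
  then show ?thesis
    by (induction rule: cvs.span_induct_alt) (use 0 assms in auto)
qed

text \<open>The bracket \<open>[x \<otimes> b, y \<otimes> b'] = [x, y] \<otimes> bb'\<close>, extended bilinearly.\<close>

definition free_bracket ::
    "(('g::complex_lie_algebra \<times> 'b::complex_comm_algebra_1) \<Rightarrow>\<^sub>0 complex) \<Rightarrow>
     (('g \<times> 'b) \<Rightarrow>\<^sub>0 complex) \<Rightarrow> (('g \<times> 'b) \<Rightarrow>\<^sub>0 complex)"
  where "free_bracket p q = lin_ext (\<lambda>k. lin_ext (\<lambda>l.
           Poly_Mapping.single (lie_bracket (fst k) (fst l), snd k * snd l) 1) q) p"

lemma mult_scaleC_right: "(x::'b::complex_comm_algebra_1) * (a *\<^sub>C y) = a *\<^sub>C (x * y)"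
  by (metis mult.commute mult_scaleC_left)

lemma lin_ext_in:
  assumes "cvs.subspace R" "\<And>k. F k \<in> R"
  shows "lin_ext F p \<in> R"
  unfolding lin_ext_def by (intro cvs.subspace_sum[OF assms(1)] cvs.subspace_scale[OF assms(1)] assms(2))

lemma lin_ext_fun_add: "lin_ext F p + lin_ext G p = lin_ext (\<lambda>k. F k + G k) p"
  by (simp add: lin_ext_def sum.distrib scaleC_add_right)

lemma lin_ext_fun_diff: "lin_ext F p - lin_ext G p = lin_ext (\<lambda>k. F k - G k) p"
  by (simp add: lin_ext_def sum_subtractf cvs.scale_right_diff_distrib)

lemma lin_ext_fun_scale: "a *\<^sub>C lin_ext F p = lin_ext (\<lambda>k. a *\<^sub>C F k) p"
  by (simp add: lin_ext_def cvs.scale_sum_right scaleC_scaleC mult.commute)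

lemma tensor_relations_generators:
  "Poly_Mapping.single (x + y, b) 1 - Poly_Mapping.single (x, b) 1 - Poly_Mapping.single (y, b) 1
     \<in> tensor_relations"
  "Poly_Mapping.single (x, b + b') 1 - Poly_Mapping.single (x, b) 1 - Poly_Mapping.single (x, b') 1
     \<in> tensor_relations"
  "Poly_Mapping.single (a *\<^sub>C x, b) 1 - a *\<^sub>C Poly_Mapping.single (x, b) 1 \<in> tensor_relations"
  "Poly_Mapping.single (x, a *\<^sub>C b) 1 - a *\<^sub>C Poly_Mapping.single (x, b) 1 \<in> tensor_relations"
  unfolding tensor_relations_def by (rule cvs.span_base, blast)+

lemma tensor_relations_induct [consumes 1]:
  assumes "p \<in> tensor_relations" and R: "cvs.subspace {p. P p}"
    and "\<And>x y b. P (Poly_Mapping.single (x + y, b) 1 - Poly_Mapping.single (x, b) 1 - Poly_Mapping.single (y, b) 1)"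
    and "\<And>x b b'. P (Poly_Mapping.single (x, b + b') 1 - Poly_Mapping.single (x, b) 1 - Poly_Mapping.single (x, b') 1)"
    and "\<And>a x b. P (Poly_Mapping.single (a *\<^sub>C x, b) 1 - a *\<^sub>C Poly_Mapping.single (x, b) 1)"
    and "\<And>a x b. P (Poly_Mapping.single (x, a *\<^sub>C b) 1 - a *\<^sub>C Poly_Mapping.single (x, b) 1)"
  shows "P p"
proof -
  have "tensor_relations \<subseteq> {p. P p}"
    unfolding tensor_relations_def using assms(3-) by (intro cvs.span_minimal R) blast
  with assms(1) show ?thesis by blast
qed

lemma free_bracket_linear: "clinear (\<lambda>p. free_bracket p q)" "clinear (free_bracket p)"
proof -
  show "clinear (\<lambda>p. free_bracket p q)"
    unfolding free_bracket_def by (rule lin_ext_linear)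
  show "clinear (free_bracket p)"
    unfolding free_bracket_def
    by (rule clinearI)
      (simp_all add: lin_ext_simps lin_ext_fun_add lin_ext_fun_scale)
qed

lemma free_bracket_relations:
  assumes "p \<in> tensor_relations"
  shows "free_bracket p q \<in> tensor_relations" "free_bracket q p \<in> tensor_relations"
proof -
  note R = subspace_tensor_relations
  have sub: "cvs.subspace {p. f p \<in> tensor_relations}" if "clinear f" for f
    using cvs.linear_subspace_vimage[OF that R] by (simp add: vimage_def)
  note g = tensor_relations_generators
  from assms show "free_bracket p q \<in> tensor_relations"
  proof (induction rule: tensor_relations_induct)
    case 1
    show ?case by (rule sub[OF free_bracket_linear(1)])
  qed (unfold free_bracket_def,
      auto simp: lin_ext_simps lin_ext_fun_diff lin_ext_fun_scale scaleC_one
        lie_bracket_add_left lie_bracket_scaleC_left distrib_right mult_scaleC_left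
        intro!: lin_ext_in[OF R] g)
  from assms show "free_bracket q p \<in> tensor_relations"
  proof (induction rule: tensor_relations_induct)
    case 1
    show ?case by (rule sub[OF free_bracket_linear(2)])
  qed (unfold free_bracket_def,
      auto simp: lin_ext_simps scaleC_one
        lie_bracket_add_right lie_bracket_scaleC_right distrib_left mult_scaleC_right
        intro!: lin_ext_in[OF R] g)
qed

instantiation tensor :: (complex_lie_algebra, complex_comm_algebra_1) complex_lie_algebra
begin

lift_definition lie_bracket_tensor :: "('a, 'b) tensor \<Rightarrow> ('a, 'b) tensor \<Rightarrow> ('a, 'b) tensor"
  is free_bracket
proof -
  fix p p' q q' :: "('a \<times> 'b) \<Rightarrow>\<^sub>0 complex"
  assume "tensor_eq p p'" "tensor_eq q q'"
  then have "free_bracket (p - p') q + free_bracket p' (q - q') \<in> tensor_relations"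
    unfolding tensor_eq_def by (intro tensor_relations_closed(2) free_bracket_relations)
  then show "tensor_eq (free_bracket p q) (free_bracket p' q')"
    by (simp add: tensor_eq_def cvs.linear_diff[OF free_bracket_linear(1)]
        cvs.linear_diff[OF free_bracket_linear(2)])
qed

lemma lie_bracket_tens [simp]:
  "lie_bracket (x \<otimes>\<^sub>C b) (y \<otimes>\<^sub>C b') = lie_bracket x y \<otimes>\<^sub>C (b * b')"
  for x y :: 'a and b b' :: 'b
  by transfer (simp add: free_bracket_def scaleC_one tensor_eq_def tensor_relations_closed)

instance
proof
  fix x y z :: "('a, 'b) tensor" and a :: complex
  have eqI: "p = q \<Longrightarrow> tensor_eq p q" for p q :: "('a \<times> 'b) \<Rightarrow>\<^sub>0 complex"
    by (simp add: tensor_eq_def tensor_relations_closed)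
  have addl: "lie_bracket (x + y) z = lie_bracket x z + lie_bracket y z" for x y z :: "('a, 'b) tensor"
    by transfer (rule eqI, rule cvs.linear_add[OF free_bracket_linear(1)])
  have addr: "lie_bracket x (y + z) = lie_bracket x y + lie_bracket x z" for x y z :: "('a, 'b) tensor"
    by transfer (rule eqI, rule cvs.linear_add[OF free_bracket_linear(2)])
  have scl: "lie_bracket (a *\<^sub>C x) y = a *\<^sub>C lie_bracket x y" for a and x y :: "('a, 'b) tensor"
    by transfer (rule eqI, rule cvs.linear_scale[OF free_bracket_linear(1)])
  have scr: "lie_bracket x (a *\<^sub>C y) = a *\<^sub>C lie_bracket x y" for a and x y :: "('a, 'b) tensor"
    by transfer (rule eqI, rule cvs.linear_scale[OF free_bracket_linear(2)])
  show "lie_bracket (x + y) z = lie_bracket x z + lie_bracket y z" by (rule addl)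
  show "lie_bracket x (y + z) = lie_bracket x y + lie_bracket x z" by (rule addr)
  show "lie_bracket (a *\<^sub>C x) y = a *\<^sub>C lie_bracket x y" by (rule scl)
  show "lie_bracket x (a *\<^sub>C y) = a *\<^sub>C lie_bracket x y" by (rule scr)
  note bi = cbilinear_tens[unfolded cbilinear_def]
  have tadd: "x \<otimes>\<^sub>C b + y \<otimes>\<^sub>C b = (x + y) \<otimes>\<^sub>C b" for x y :: 'a and b :: 'b
    using cvs.linear_add bi by metis
  have tzero: "0 \<otimes>\<^sub>C b = 0" for b :: 'b
    using cvs.linear_0 bi by metis
  have anti0: "lie_bracket x y = - lie_bracket y x" for x y :: 'a
  proof -
    have "lie_bracket x x + lie_bracket x y + (lie_bracket y x + lie_bracket y y) = 0"
      using lie_bracket_self[of "x + y"]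
      unfolding lie_bracket_add_left lie_bracket_add_right by (simp only: ac_simps)
    then have "lie_bracket x y + lie_bracket y x = 0"
      by (simp add: lie_bracket_self)
    then show ?thesis by (simp only: eq_neg_iff_add_eq_0)
  qed
  have anti: "lie_bracket x y + lie_bracket y x = 0" for x y :: "('a, 'b) tensor"
  proof (induction x rule: tensor_induct)
    case (tens x b)
    show ?case
    proof (induction y rule: tensor_induct)
      case (tens y b')
      show ?case by (simp add: mult.commute[of b'] tadd anti0[of y x] tzero)
    next
      case (add y z)
      have "lie_bracket (x \<otimes>\<^sub>C b) (y + z) + lie_bracket (y + z) (x \<otimes>\<^sub>C b)
        = (lie_bracket (x \<otimes>\<^sub>C b) y + lie_bracket y (x \<otimes>\<^sub>C b))
          + (lie_bracket (x \<otimes>\<^sub>C b) z + lie_bracket z (x \<otimes>\<^sub>C b))"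
        by (simp only: addl addr ac_simps)
      with add show ?case by simp
    next
      case (scale a y)
      then show ?case by (simp add: scl scr flip: scaleC_add_right)
    qed
  next
    case (add x z)
    have "lie_bracket (x + z) y + lie_bracket y (x + z)
      = (lie_bracket x y + lie_bracket y x) + (lie_bracket z y + lie_bracket y z)"
      by (simp only: addl addr ac_simps)
    with add show ?case by simp
  next
    case (scale a y)
    then show ?case by (simp add: scl scr flip: scaleC_add_right)
  qed
  show "lie_bracket x x = 0"
  proof -
    have "(2::complex) *\<^sub>C lie_bracket x x = 0"
      using anti[of x x] by (metis scaleC_add_left scaleC_one one_add_one)
    then show ?thesis by simp
  qed
  define J where "J x y z = lie_bracket x (lie_bracket y z) + lie_bracket y (lie_bracket z x)
      + lie_bracket z (lie_bracket x y)" for x y z :: "('a, 'b) tensor"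
  have Jadd: "J (x + x') y z = J x y z + J x' y z" "J x (y + x') z = J x y z + J x x' z"
     "J x y (z + x') = J x y z + J x y x'" for x x' y z
    by (simp_all add: J_def addl addr)
  have Jsc: "J (a *\<^sub>C x) y z = a *\<^sub>C J x y z" "J x (a *\<^sub>C y) z = a *\<^sub>C J x y z"
     "J x y (a *\<^sub>C z) = a *\<^sub>C J x y z" for a x y z
    by (simp_all add: J_def scl scr scaleC_add_right)
  have Jt: "J (x \<otimes>\<^sub>C b) (y \<otimes>\<^sub>C b') (z \<otimes>\<^sub>C b'') = 0" for x y z :: 'a and b b' b'' :: 'b
  proof -
    have "b' * (b'' * b) = b * (b' * b'')" "b'' * (b * b') = b * (b' * b'')"
      by (simp_all add: ac_simps)
    then show ?thesis by (simp only: J_def lie_bracket_tens tadd jacobi tzero)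
  qed
  have Jt2: "J (x \<otimes>\<^sub>C b) (y \<otimes>\<^sub>C b') z = 0" for x y :: 'a and b b' :: 'b and z
    by (induction z rule: tensor_induct) (simp_all add: Jt Jadd Jsc)
  have Jt3: "J (x \<otimes>\<^sub>C b) y z = 0" for x :: 'a and b :: 'b and y z
    by (induction y rule: tensor_induct) (simp_all add: Jt2 Jadd Jsc)
  have "J x y z = 0"
    by (induction x rule: tensor_induct) (simp_all add: Jt3 Jadd Jsc)
  then show "lie_bracket x (lie_bracket y z) + lie_bracket y (lie_bracket z x)
      + lie_bracket z (lie_bracket x y) = 0"
    by (simp add: J_def)
qed

end


section \<open>The special algebra and its extension by Laurent polynomials\<close>

text \<open>\<open>A\<^sub>N\<close> is the group algebra of \<open>\<int>\<^sup>N\<close>: finitely supported functions under convolution.\<close>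

type_synonym 'n laurent = "(int ^ 'n) \<Rightarrow>\<^sub>0 complex"

instance poly_mapping :: (comm_monoid_add, complex_comm_algebra_1) complex_comm_algebra_1
proof
  fix a :: complex and p q :: "'a \<Rightarrow>\<^sub>0 'b"
  have "a *\<^sub>C p = Poly_Mapping.single 0 (a *\<^sub>C 1) * p" for p :: "'a \<Rightarrow>\<^sub>0 'b"
  proof -
    have "a *\<^sub>C p = Poly_Mapping.map ((*) (a *\<^sub>C 1)) p"
      by (rule poly_mapping_eqI) (simp add: Poly_Mapping.map.rep_eq when_def mult_scaleC_left)
    then show ?thesis by (simp add: mult_map_scale_conv_mult)
  qed
  then show "(a *\<^sub>C p) * q = a *\<^sub>C (p * q)" by (simp add: mult.assoc)
qed

definition tpow :: "int ^ 'n \<Rightarrow> 'n::finite laurent"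
  where "tpow r = Poly_Mapping.single r 1"

text \<open>\<open>t\<^sub>i d/dt\<^sub>i\<close>, i.e. \<open>t\<^sup>s \<mapsto> s\<^sub>i t\<^sup>s\<close>.\<close>

definition euler :: "'n \<Rightarrow> 'n::finite laurent \<Rightarrow> 'n laurent"
  where "euler i = Poly_Mapping.mapp (\<lambda>s c. of_int (s $ i) * c)"

text \<open>The bilinear (not Hermitian) form on \<open>\<complex>\<^sup>N\<close>.\<close>

definition dot :: "complex ^ 'n \<Rightarrow> complex ^ 'n \<Rightarrow> complex"
  where "dot x y = (\<Sum>i\<in>UNIV. x $ i * y $ i)"

definition cvec :: "int ^ 'n \<Rightarrow> complex ^ 'n"
  where "cvec r = (\<chi> i. of_int (r $ i))"

definition vec_field :: "complex ^ 'n \<Rightarrow> int ^ 'n \<Rightarrow> 'n::finite laurent \<Rightarrow> 'n laurent"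
  where "vec_field u r f = (\<Sum>i\<in>UNIV. u $ i *\<^sub>C (tpow r * euler i f))"

definition special_ops :: "('n::finite laurent \<Rightarrow> 'n laurent) set"
  where "special_ops = cvs.span {vec_field u r | u r. dot u (cvec r) = 0}"

lemma dot_simps:
  "dot (x + y) z = dot x z + dot y z" "dot x (y + z) = dot x y + dot x z"
  "dot (x - y) z = dot x z - dot y z" "dot (a *\<^sub>C x) z = a * dot x z" "dot x (a *\<^sub>C y) = a * dot x y"
  "dot x 0 = 0" "dot 0 x = 0"
  by (simp_all add: dot_def scaleC_vec_def algebra_simps sum.distrib sum_subtractf
      sum_distrib_left)

lemma dot_commute: "dot x y = dot y x"
  by (simp add: dot_def mult.commute)

lemma dot_axis: "dot (axis i 1) x = x $ i" "dot x (axis i 1) = x $ i"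
proof -
  have "dot (axis i 1) x = (\<Sum>j\<in>UNIV. if j = i then x $ j else 0)"
    unfolding dot_def by (rule sum.cong) (auto simp: axis_def)
  then show "dot (axis i 1) x = x $ i" by simp
  then show "dot x (axis i 1) = x $ i" by (simp add: dot_commute)
qed

lemma cvec_simps: "cvec (r + s) = cvec r + cvec s" "cvec 0 = 0" "cvec (axis i 1) = axis i 1"
  by (simp_all add: cvec_def vec_eq_iff axis_def)

lemma euler_single: "euler i (Poly_Mapping.single s c) = Poly_Mapping.single s (of_int (s $ i) * c)"
  by (rule poly_mapping_eqI) (simp add: euler_def lookup_mapp lookup_single when_def in_keys_iff)

lemma clinear_euler: "clinear (euler i)"
proof (rule clinearI)
  have look: "Poly_Mapping.lookup (euler i f) k = of_int (k $ i) * Poly_Mapping.lookup f k"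
    for f :: "'a laurent" and k
    by (simp add: euler_def lookup_mapp when_def in_keys_iff)
  fix f g :: "'a laurent" and a
  show "euler i (f + g) = euler i f + euler i g" "euler i (a *\<^sub>C f) = a *\<^sub>C euler i f"
    by (rule poly_mapping_eqI; simp add: look lookup_add distrib_left)+
qed

lemma vec_field_single:
  "vec_field u r (Poly_Mapping.single s c) = Poly_Mapping.single (r + s) (dot u (cvec s) * c)"
  by (rule poly_mapping_eqI)
    (simp add: vec_field_def euler_single tpow_def mult_single lookup_sum lookup_single when_def
      dot_def cvec_def sum_distrib_right mult.assoc)

lemma clinear_vec_field: "clinear (vec_field u r)"
  by (rule clinearI)
    (simp_all add: vec_field_def cvs.linear_add[OF clinear_euler] cvs.linear_scale[OF clinear_euler]
      distrib_left sum.distrib scaleC_add_right mult_scaleC_right cvs.scale_sum_right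
      scaleC_scaleC mult.commute)

lemma clinear_eqI_single:
  fixes F G :: "('k \<Rightarrow>\<^sub>0 complex) \<Rightarrow> 'w::complex_vector"
  assumes "clinear F" "clinear G"
    and "\<And>k. F (Poly_Mapping.single k (1::complex)) = G (Poly_Mapping.single k 1)"
  shows "F = G"
proof
  fix p :: "'k \<Rightarrow>\<^sub>0 complex"
  have "p \<in> cvs.span {Poly_Mapping.single k (1::complex) | k. True}" using free_span by blast
  then show "F p = G p"
    by (rule cvs.linear_eq_on[OF assms(1,2)]) (use assms(3) in auto)
qed

lemma vec_field_commutator:
  "vec_field u r (vec_field v s f) - vec_field v s (vec_field u r f)
     = vec_field (dot u (cvec s) *\<^sub>C v - dot v (cvec r) *\<^sub>C u) (r + s) f"
proof -
  note lin = cvs.linear_add[OF clinear_vec_field] cvs.linear_scale[OF clinear_vec_field]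
  have "(\<lambda>f. vec_field u r (vec_field v s f) - vec_field v s (vec_field u r f))
     = vec_field (dot u (cvec s) *\<^sub>C v - dot v (cvec r) *\<^sub>C u) (r + s)"
  proof (rule clinear_eqI_single)
    show "clinear (\<lambda>f. vec_field u r (vec_field v s f) - vec_field v s (vec_field u r f))"
      by (rule clinearI) (simp_all add: lin algebra_simps cvs.scale_right_diff_distrib)
  next
    fix k :: "int ^ 'a"
    show "vec_field u r (vec_field v s (Poly_Mapping.single k 1))
        - vec_field v s (vec_field u r (Poly_Mapping.single k 1))
      = vec_field (dot u (cvec s) *\<^sub>C v - dot v (cvec r) *\<^sub>C u) (r + s) (Poly_Mapping.single k 1)"
      by (rule poly_mapping_eqI)
        (simp add: vec_field_single dot_simps cvec_simps lookup_minus lookup_single when_def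
          add_ac algebra_simps)
  qed (rule clinear_vec_field)
  then show ?thesis by (rule fun_cong)
qed

lemma special_ops_subspace: "cvs.subspace special_ops"
  unfolding special_ops_def by (rule cvs.subspace_span)

lemma special_ops_linear:
  assumes "X \<in> special_ops"
  shows "clinear X"
  using assms unfolding special_ops_def
proof (induction rule: cvs.span_induct_alt)
  case base
  show ?case by (rule clinearI) simp_all
next
  case (step c x y)
  then have x: "clinear x" using clinear_vec_field by blast
  show ?case
    by (rule clinearI)
      (simp_all add: scaleC_fun_def cvs.linear_add[OF x] cvs.linear_scale[OF x]
        cvs.linear_add[OF step.IH] cvs.linear_scale[OF step.IH] scaleC_add_right
        scaleC_scaleC mult.commute)
qed

lemma special_ops_commutator:
  assumes X: "X \<in> special_ops" and Y: "Y \<in> special_ops"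
  shows "(\<lambda>f. X (Y f) - Y (X f)) \<in> special_ops"
proof -
  note sub = special_ops_subspace
  have closed: "(\<lambda>f. a *\<^sub>C F f + G f) \<in> special_ops"
    if "F \<in> special_ops" "G \<in> special_ops" for F G :: "'a laurent \<Rightarrow> 'a laurent" and a
  proof -
    have "a *\<^sub>C F + G \<in> special_ops"
      by (intro cvs.subspace_add[OF sub] cvs.subspace_scale[OF sub] that)
    then show ?thesis by (simp add: scaleC_fun_def plus_fun_def)
  qed
  have zero: "(\<lambda>f. 0) \<in> special_ops"
    using cvs.subspace_0[OF sub] by (simp add: zero_fun_def)
  have base: "(\<lambda>f. vec_field u r (Y f) - Y (vec_field u r f)) \<in> special_ops"
    if ur: "dot u (cvec r) = 0" for u r
    using Y unfolding special_ops_def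
  proof (induction rule: cvs.span_induct_alt)
    case base
    show ?case using zero by (simp add: cvs.linear_0[OF clinear_vec_field] special_ops_def)
  next
    case (step c x y)
    then obtain v s where x: "x = vec_field v s" and vs: "dot v (cvec s) = 0" by blast
    have "dot (dot u (cvec s) *\<^sub>C v - dot v (cvec r) *\<^sub>C u) (cvec (r + s)) = 0"
      using ur vs by (simp add: dot_simps cvec_simps)
    then have "(\<lambda>f. vec_field u r (x f) - x (vec_field u r f)) \<in> special_ops"
      unfolding x vec_field_commutator special_ops_def by (intro cvs.span_base) blast
    from closed[OF this step.IH[folded special_ops_def], of c] show ?case
      unfolding special_ops_def[symmetric]
      by (simp add: scaleC_fun_def cvs.linear_add[OF clinear_vec_field]
          cvs.linear_scale[OF clinear_vec_field] cvs.scale_right_diff_distrib algebra_simps)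
  qed
  from X[unfolded special_ops_def] show ?thesis
  proof (induction rule: cvs.span_induct_alt)
    case base
    show ?case using zero by (simp add: cvs.linear_0[OF special_ops_linear[OF Y]])
  next
    case (step c x y)
    then have "(\<lambda>f. x (Y f) - Y (x f)) \<in> special_ops" using base by blast
    from closed[OF this step.IH, of c] show ?case
      by (simp add: scaleC_fun_def cvs.linear_add[OF special_ops_linear[OF Y]]
          cvs.linear_scale[OF special_ops_linear[OF Y]] cvs.scale_right_diff_distrib algebra_simps)
  qed
qed

typedef (overloaded) ('n::finite) special = "special_ops :: ('n laurent \<Rightarrow> 'n laurent) set"
  morphisms special_apply Abs_special
  using cvs.subspace_0[OF special_ops_subspace] by blast

setup_lifting type_definition_special

instantiation special :: (finite) complex_lie_algebra
begin

lift_definition zero_special :: "'a special" is 0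
  by (rule cvs.subspace_0[OF special_ops_subspace])
lift_definition plus_special :: "'a special \<Rightarrow> 'a special \<Rightarrow> 'a special" is "(+)"
  by (rule cvs.subspace_add[OF special_ops_subspace])
lift_definition minus_special :: "'a special \<Rightarrow> 'a special \<Rightarrow> 'a special" is "(-)"
  by (rule cvs.subspace_diff[OF special_ops_subspace])
lift_definition uminus_special :: "'a special \<Rightarrow> 'a special" is uminus
  by (rule cvs.subspace_neg[OF special_ops_subspace])
lift_definition scaleC_special :: "complex \<Rightarrow> 'a special \<Rightarrow> 'a special" is scaleC
  by (rule cvs.subspace_scale[OF special_ops_subspace])
lift_definition lie_bracket_special :: "'a special \<Rightarrow> 'a special \<Rightarrow> 'a special"
  is "\<lambda>X Y f. X (Y f) - Y (X f)"
  by (rule special_ops_commutator)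

instance
proof
  fix x y z :: "'a special" and a b :: complex
  show "x + y + z = x + (y + z)" by transfer (rule add.assoc)
  show "x + y = y + x" by transfer (rule add.commute)
  show "0 + x = x" by transfer (rule add_0)
  show "- x + x = 0" by transfer (rule left_minus)
  show "x - y = x + - y" by transfer (rule diff_conv_add_uminus)
  show "a *\<^sub>C (x + y) = a *\<^sub>C x + a *\<^sub>C y" by transfer (rule scaleC_add_right)
  show "(a + b) *\<^sub>C x = a *\<^sub>C x + b *\<^sub>C x" by transfer (rule scaleC_add_left)
  show "a *\<^sub>C b *\<^sub>C x = (a * b) *\<^sub>C x" by transfer (rule scaleC_scaleC)
  show "1 *\<^sub>C x = x" by transfer (rule scaleC_one)
  note lin = special_ops_linear[THEN cvs.linear_add] special_ops_linear[THEN cvs.linear_diff]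
    special_ops_linear[THEN cvs.linear_scale]
  show "lie_bracket (x + y) z = lie_bracket x z + lie_bracket y z"
    by transfer (simp add: fun_eq_iff lin)
  show "lie_bracket x (y + z) = lie_bracket x y + lie_bracket x z"
    by transfer (simp add: fun_eq_iff lin)
  show "lie_bracket (a *\<^sub>C x) y = a *\<^sub>C lie_bracket x y"
    by transfer (simp add: fun_eq_iff lin scaleC_fun_def cvs.scale_right_diff_distrib)
  show "lie_bracket x (a *\<^sub>C y) = a *\<^sub>C lie_bracket x y"
    by transfer (simp add: fun_eq_iff lin scaleC_fun_def cvs.scale_right_diff_distrib)
  show "lie_bracket x x = 0"
    by transfer (simp add: fun_eq_iff)
  show "lie_bracket x (lie_bracket y z) + lie_bracket y (lie_bracket z x)
      + lie_bracket z (lie_bracket x y) = 0"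
    by transfer (simp add: fun_eq_iff lin)
qed

end

text \<open>\<open>D(u, r)\<close> lies in the special algebra only if \<open>(u, r) = 0\<close>; the value 0 otherwise is junk.\<close>

lift_definition D :: "complex ^ 'n \<Rightarrow> int ^ 'n \<Rightarrow> 'n::finite special"
  is "\<lambda>u r. if dot u (cvec r) = 0 then vec_field u r else 0"
  by (auto simp: special_ops_def intro!: cvs.span_base cvs.span_zero)

lemma D_bracket:
  assumes "dot u (cvec r) = 0" "dot v (cvec s) = 0"
  shows "lie_bracket (D u r) (D v s) = D (dot u (cvec s) *\<^sub>C v - dot v (cvec r) *\<^sub>C u) (r + s)"
proof -
  have "dot (dot u (cvec s) *\<^sub>C v - dot v (cvec r) *\<^sub>C u) (cvec (r + s)) = 0"
    using assms by (simp add: dot_simps cvec_simps)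
  with assms show ?thesis by transfer (simp add: vec_field_commutator)
qed

lemma special_apply_D:
  assumes "dot u (cvec r) = 0"
  shows "special_apply (D u r) (tpow s) = dot u (cvec s) *\<^sub>C tpow (r + s)"
  using assms by (simp add: D.rep_eq vec_field_single tpow_def scaleC_single)

lemma special_apply_simps:
  "special_apply (X + Y) f = special_apply X f + special_apply Y f"
  "special_apply (X - Y) f = special_apply X f - special_apply Y f"
  "special_apply (a *\<^sub>C X) f = a *\<^sub>C special_apply X f"
  "special_apply X (f + g) = special_apply X f + special_apply X g"
  "special_apply X (f - g) = special_apply X f - special_apply X g"
  "special_apply X (a *\<^sub>C f) = a *\<^sub>C special_apply X f"
  "special_apply (lie_bracket X Y) f
     = special_apply X (special_apply Y f) - special_apply Y (special_apply X f)"
  using special_apply[of X, THEN special_ops_linear]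
  by (simp_all add: plus_special.rep_eq minus_special.rep_eq scaleC_special.rep_eq scaleC_fun_def
      lie_bracket_special.rep_eq cvs.linear_add cvs.linear_diff cvs.linear_scale)

text \<open>The semidirect product \<open>\<S>\<^sub>N \<ltimes> A\<^sub>N\<close>.\<close>

datatype ('n::finite) special_ext = Ext (field_part: "'n special") (fun_part: "'n laurent")

instantiation special_ext :: (finite) complex_lie_algebra
begin

definition "0 = Ext 0 0"
definition "x + y = Ext (field_part x + field_part y) (fun_part x + fun_part y)"
definition "x - y = Ext (field_part x - field_part y) (fun_part x - fun_part y)"
definition "- x = Ext (- field_part x) (- fun_part x)"
definition "a *\<^sub>C x = Ext (a *\<^sub>C field_part x) (a *\<^sub>C fun_part x)"
definition "lie_bracket x y = Ext (lie_bracket (field_part x) (field_part y))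
   (special_apply (field_part x) (fun_part y) - special_apply (field_part y) (fun_part x))"

instance
proof
  fix x y z :: "'a special_ext" and a b :: complex
  note defs = zero_special_ext_def plus_special_ext_def minus_special_ext_def
    uminus_special_ext_def scaleC_special_ext_def lie_bracket_special_ext_def
  show "x + y + z = x + (y + z)" by (simp add: defs add.assoc)
  show "x + y = y + x" by (simp add: defs add.commute)
  show "0 + x = x" by (simp add: defs)
  show "- x + x = 0" by (simp add: defs)
  show "x - y = x + - y" by (simp add: defs)
  show "a *\<^sub>C (x + y) = a *\<^sub>C x + a *\<^sub>C y" by (simp add: defs scaleC_add_right)
  show "(a + b) *\<^sub>C x = a *\<^sub>C x + b *\<^sub>C x" by (simp add: defs scaleC_add_left)
  show "a *\<^sub>C b *\<^sub>C x = (a * b) *\<^sub>C x" by (simp add: defs scaleC_scaleC)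
  show "1 *\<^sub>C x = x" by (simp add: defs scaleC_one)
  show "lie_bracket (x + y) z = lie_bracket x z + lie_bracket y z"
    by (simp add: defs special_apply_simps lie_bracket_add_left)
  show "lie_bracket x (y + z) = lie_bracket x y + lie_bracket x z"
    by (simp add: defs special_apply_simps lie_bracket_add_right)
  show "lie_bracket (a *\<^sub>C x) y = a *\<^sub>C lie_bracket x y"
    by (simp add: defs special_apply_simps lie_bracket_scaleC_left cvs.scale_right_diff_distrib)
  show "lie_bracket x (a *\<^sub>C y) = a *\<^sub>C lie_bracket x y"
    by (simp add: defs special_apply_simps lie_bracket_scaleC_right cvs.scale_right_diff_distrib)
  show "lie_bracket x x = 0" by (simp add: defs lie_bracket_self)
  show "lie_bracket x (lie_bracket y z) + lie_bracket y (lie_bracket z x)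
      + lie_bracket z (lie_bracket x y) = 0"
    by (simp add: defs special_apply_simps jacobi)
qed

end

definition from_special :: "'n::finite special \<Rightarrow> 'n special_ext"
  where "from_special X = Ext X 0"

definition from_laurent :: "'n::finite laurent \<Rightarrow> 'n special_ext"
  where "from_laurent f = Ext 0 f"


section \<open>Weight modules\<close>

definition cartan_d :: "'n \<Rightarrow> 'n::finite special"
  where "cartan_d i = D (axis i 1) 0"

definition cartan :: "'n::finite special set"
  where "cartan = cvs.span (range cartan_d)"

text \<open>Functionals on the Cartan subalgebra are represented by their extension by 0 to the whole
  special algebra (so the extension is in general not linear).\<close>

definition cartan_dual :: "('n::finite special \<Rightarrow> complex) set"
  where "cartan_dual = {\<mu>. (\<forall>x\<in>cartan. \<forall>y\<in>cartan. \<mu> (x + y) = \<mu> x + \<mu> y) \<and>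
    (\<forall>a. \<forall>x\<in>cartan. \<mu> (a *\<^sub>C x) = a * \<mu> x) \<and> (\<forall>x. x \<notin> cartan \<longrightarrow> \<mu> x = 0)}"

definition cartan_delta :: "'n \<Rightarrow> 'n::finite special \<Rightarrow> complex"
  where "cartan_delta i =
    (THE \<mu>. \<mu> \<in> cartan_dual \<and> (\<forall>j. \<mu> (cartan_d j) = (if j = i then 1 else 0)))"

lemma cartan_delta:
  "cartan_delta i \<in> cartan_dual" "cartan_delta i (cartan_d j) = (if j = i then 1 else 0)"
proof -
  let ?P = "\<lambda>\<mu>. \<mu> \<in> cartan_dual \<and> (\<forall>j. \<mu> (cartan_d j) = (if j = i then 1 else 0))"
  let ?e = "axis i 1 :: int ^ 'a"
  define c :: "'a special \<Rightarrow> complex"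
    where "c x = (if x \<in> cartan then Poly_Mapping.lookup (special_apply x (tpow ?e)) ?e else 0)" for x
  have mem: "cartan_d j \<in> cartan" for j :: 'a
    unfolding cartan_def by (intro cvs.span_base) simp
  have "c \<in> cartan_dual"
    unfolding cartan_dual_def c_def
    by (auto simp: special_apply_simps lookup_add cartan_def cvs.span_add cvs.span_scale)
  moreover have "c (cartan_d j) = (if j = i then 1 else 0)" for j
    using mem[of j]
    by (simp add: c_def cartan_d_def special_apply_D dot_simps dot_axis cvec_simps)
      (simp add: tpow_def axis_def)
  ultimately have ex: "?P c" by blast
  have uniq: "\<mu> = \<nu>" if "?P \<mu>" "?P \<nu>" for \<mu> \<nu>
  proof
    fix x
    show "\<mu> x = \<nu> x"
    proof (cases "x \<in> cartan")
      case True
      have \<mu>: "\<mu> (a *\<^sub>C y + z) = a * \<mu> y + \<mu> z" and \<nu>: "\<nu> (a *\<^sub>C y + z) = a * \<nu> y + \<nu> z"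
        if "y \<in> cartan" "z \<in> cartan" for a y z
      proof -
        have "a *\<^sub>C y \<in> cartan" using that by (simp add: cartan_def cvs.span_scale)
        with that \<open>?P \<mu>\<close> \<open>?P \<nu>\<close> show "\<mu> (a *\<^sub>C y + z) = a * \<mu> y + \<mu> z"
          "\<nu> (a *\<^sub>C y + z) = a * \<nu> y + \<nu> z"
          by (simp_all add: cartan_dual_def)
      qed
      have "x \<in> cvs.span (range cartan_d)" using True by (simp add: cartan_def)
      then have "x \<in> cartan \<and> \<mu> x = \<nu> x"
      proof (induction rule: cvs.span_induct_alt)
        case base
        have "0 \<in> (cartan :: 'a special set)" by (simp add: cartan_def cvs.span_zero)
        then have "\<mu> (0 *\<^sub>C 0) = 0 * \<mu> 0" "\<nu> (0 *\<^sub>C 0) = 0 * \<nu> 0"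
          using that unfolding cartan_dual_def by blast+
        with \<open>0 \<in> cartan\<close> show ?case by simp
      next
        case (step a y z)
        then have "a *\<^sub>C y + z \<in> cartan" using mem
          by (auto simp: cartan_def intro!: cvs.span_add cvs.span_scale)
        moreover have "\<mu> y = \<nu> y" "y \<in> cartan" using step.hyps that mem by auto
        ultimately show ?case using step.IH by (simp add: \<mu> \<nu>)
      qed
      then show ?thesis ..
    qed (use that in \<open>simp add: cartan_dual_def\<close>)
  qed
  have "?P (cartan_delta i)" unfolding cartan_delta_def by (rule theI[of ?P c, OF ex uniq[OF _ ex]])
  then show "cartan_delta i \<in> cartan_dual" "cartan_delta i (cartan_d j) = (if j = i then 1 else 0)"
    by blast+
qed

text \<open>In the following \<open>\<sigma>\<close> is the action of the special algebra on a module (for a module over a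
  larger Lie algebra: the restricted action); only the action of the Cartan subalgebra matters.\<close>

definition weight_space ::
    "('n::finite special \<Rightarrow> 'v::complex_vector \<Rightarrow> 'v) \<Rightarrow> ('n special \<Rightarrow> complex) \<Rightarrow> 'v set"
  where "weight_space \<sigma> \<mu> = {v. \<forall>h\<in>cartan. \<sigma> h v = \<mu> h *\<^sub>C v}"

definition weights ::
    "('n::finite special \<Rightarrow> 'v::complex_vector \<Rightarrow> 'v) \<Rightarrow> ('n special \<Rightarrow> complex) set"
  where "weights \<sigma> = {\<mu> \<in> cartan_dual. weight_space \<sigma> \<mu> \<noteq> {0}}"

definition has_weight_decomposition :: "('n::finite special \<Rightarrow> 'v::complex_vector \<Rightarrow> 'v) \<Rightarrow> bool"
  where "has_weight_decomposition \<sigma> \<longleftrightarrow> internal_direct_sum cartan_dual (weight_space \<sigma>)"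

definition finite_dim_weight_spaces :: "('n::finite special \<Rightarrow> 'v::complex_vector \<Rightarrow> 'v) \<Rightarrow> bool"
  where "finite_dim_weight_spaces \<sigma> \<longleftrightarrow> (\<forall>\<mu>\<in>cartan_dual. finite_dim (weight_space \<sigma> \<mu>))"

definition uniformly_bounded :: "('n::finite special \<Rightarrow> 'v::complex_vector \<Rightarrow> 'v) \<Rightarrow> bool"
  where "uniformly_bounded \<sigma> \<longleftrightarrow> (\<exists>M>0. \<forall>\<mu>\<in>cartan_dual.
    finite_dim (weight_space \<sigma> \<mu>) \<and> cvs.dim (weight_space \<sigma> \<mu>) \<le> (M::nat))"

definition coord_weight_space ::
    "('n::finite special \<Rightarrow> 'v::complex_vector \<Rightarrow> 'v) \<Rightarrow> complex ^ 'n \<Rightarrow> 'v set"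
  where "coord_weight_space \<sigma> \<Lambda> = {v. \<forall>u. \<sigma> (D u 0) v = dot u \<Lambda> *\<^sub>C v}"


section \<open>Jet modules\<close>

text \<open>Objects of the category \<open>\<J>\<close>, with \<open>\<alpha>\<close> the action of the associative algebra of Laurent
  polynomials.\<close>

definition jet_module ::
    "('n::finite special \<Rightarrow> 'v::complex_vector \<Rightarrow> 'v) \<Rightarrow> ('n laurent \<Rightarrow> 'v \<Rightarrow> 'v) \<Rightarrow> bool"
  where "jet_module \<sigma> \<alpha> \<longleftrightarrow>
    lie_module \<sigma> \<and> has_weight_decomposition \<sigma> \<and> finite_dim_weight_spaces \<sigma> \<and>
    cbilinear \<alpha> \<and> (\<forall>v. \<alpha> 1 v = v) \<and> (\<forall>g h v. \<alpha> (g * h) v = \<alpha> g (\<alpha> h v)) \<and>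
    (\<forall>x g v. \<sigma> x (\<alpha> g v) = \<alpha> (special_apply x g) v + \<alpha> g (\<sigma> x v))"

definition irreducible_jet_module ::
    "('n::finite special \<Rightarrow> 'v::complex_vector \<Rightarrow> 'v) \<Rightarrow> ('n laurent \<Rightarrow> 'v \<Rightarrow> 'v) \<Rightarrow> bool"
  where "irreducible_jet_module \<sigma> \<alpha> \<longleftrightarrow>
    jet_module \<sigma> \<alpha> \<and> irreducible_under (range \<sigma> \<union> range \<alpha>)"


section \<open>Modules over the current algebra\<close>

text \<open>For a module \<open>\<rho>\<close> over \<open>(\<S>\<^sub>N \<ltimes> A\<^sub>N) \<otimes> B\<close>: the operators \<open>t\<^sup>r b\<close> and \<open>D(u, r) b\<close>, and the
  restrictions of \<open>\<rho>\<close> to \<open>\<S>\<^sub>N \<ltimes> A\<^sub>N\<close> and to \<open>\<S>\<^sub>N\<close> (embedded via \<open>x \<mapsto> x \<otimes> 1\<close>).\<close>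

definition t_op ::
    "(('n::finite special_ext, 'b::complex_comm_algebra_1) tensor \<Rightarrow> 'v::complex_vector \<Rightarrow> 'v)
     \<Rightarrow> int ^ 'n \<Rightarrow> 'b \<Rightarrow> 'v \<Rightarrow> 'v"
  where "t_op \<rho> r b = \<rho> (from_laurent (tpow r) \<otimes>\<^sub>C b)"

definition D_op ::
    "(('n::finite special_ext, 'b::complex_comm_algebra_1) tensor \<Rightarrow> 'v::complex_vector \<Rightarrow> 'v)
     \<Rightarrow> complex ^ 'n \<Rightarrow> int ^ 'n \<Rightarrow> 'b \<Rightarrow> 'v \<Rightarrow> 'v"
  where "D_op \<rho> u r b = \<rho> (from_special (D u r) \<otimes>\<^sub>C b)"

definition restrict_ext ::
    "(('n::finite special_ext, 'b::complex_comm_algebra_1) tensor \<Rightarrow> 'v::complex_vector \<Rightarrow> 'v)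
     \<Rightarrow> 'n special_ext \<Rightarrow> 'v \<Rightarrow> 'v"
  where "restrict_ext \<rho> x = \<rho> (x \<otimes>\<^sub>C 1)"

definition restrict_special ::
    "(('n::finite special_ext, 'b::complex_comm_algebra_1) tensor \<Rightarrow> 'v::complex_vector \<Rightarrow> 'v)
     \<Rightarrow> 'n special \<Rightarrow> 'v \<Rightarrow> 'v"
  where "restrict_special \<rho> X = \<rho> (from_special X \<otimes>\<^sub>C 1)"

end

theory Submission
  imports Defs "HOL-Computational_Algebra.Fundamental_Theorem_Algebra"
begin

text \<open>The argument is about commutative algebras of operators. Call a commutative algebra \<open>H\<close> of
  endomorphisms of \<open>V\<close> invariant if it contains all operators \<open>t\<^sup>r b\<close> and is stable under commutators with
  all \<open>D(u, r) b\<close>, so that these act on \<open>H\<close> by derivations. The smallest invariant algebra is generated by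
  the \<open>t\<^sup>r b\<close>.

  For \<open>x \<in> H\<close> the generalised null space of \<open>x\<close> is a submodule. An element of degree 0 has an
  eigenvalue on a finite-dimensional weight space, so by irreducibility it differs from a scalar by a nilpotent
  operator, whose order is at most the bound on the dimensions (\<open>degree_0_nilpotent\<close>). If \<open>t\<^sup>m\<close> were not
  injective for some \<open>m \<noteq> 0\<close>, then \<open>t\<^sup>m t\<^sup>-\<^sup>m\<close> would be nilpotent. Derivations preserve nilpotency in characteristic
  0, and differentiating twice gives a uniform order of nilpotency on the span of the \<open>t\<^sup>n b\<close>, \<open>n \<noteq> 0\<close>
  (\<open>uniformly_nilpotent\<close>). By polarisation these operators have a common null vector
  (\<open>common_null_vector\<close>); their common null space is a submodule, so they all vanish, which is excluded
  (\<open>t_injective\<close>). With all \<open>t\<^sup>m\<close> injective, the common null space of the homogeneous nilpotent elements of any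
  invariant algebra is a nonzero submodule. Hence these elements vanish, and the elements of degree 0 are
  scalars (\<open>homog_nilpotent_zero\<close>, \<open>degree_0_scalar\<close>).

  It follows that \<open>t\<^sup>r b\<close> is a multiple of \<open>t\<^sup>r\<close> and that \<open>t\<^sup>m t\<^sup>n = k(m, n) t\<^sup>m\<^sup>+\<^sup>n\<close> with nonzero scalars \<open>k(m, n)\<close>.
  Commutators with \<open>D(u, s)\<close> show that the multiple is a character \<open>\<psi>(b)\<close> not depending on \<open>r \<noteq> 0\<close>. They
  also show that \<open>(u, m) / k(m, s)\<close> is additive in \<open>m\<close>, which forces \<open>k(m, n)\<close> to be a constant \<open>\<kappa>\<close> for nonzero
  \<open>m, n, m + n\<close>, and a constant \<open>\<mu>\<close> for \<open>m + n = 0\<close>, \<open>m \<noteq> 0\<close>; associativity gives \<open>\<kappa>\<^sup>2 = c \<mu>\<close> (\<open>ex_kappa_mu\<close>).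

  For \<open>\<psi>(b) = 0\<close> the operators \<open>D(w, s) b\<close> commute with all \<open>t\<^sup>r b'\<close>, and so form finite-dimensional spaces in each
  degree. If they do not vanish for \<open>s \<noteq> 0\<close>, there is a \<open>b\<^sub>0\<close> with \<open>\<psi>(b\<^sub>0) = 0\<close> for which the \<open>D(v, q) b\<^sub>0\<close> enlarge the algebra
  of the \<open>t\<^sup>r b\<close> to an invariant commutative algebra; its degree 0 elements \<open>D(u, 0) b\<^sub>0\<close> are scalars, which leads to a
  contradiction (\<open>d_kernel\<close>). Therefore \<open>D(u, r) b = \<psi>(b) D(u, r)\<close> for \<open>r \<noteq> 0\<close>, and \<open>D(u, 0) b\<close> is central for
  \<open>\<psi>(b) = 0\<close>, hence a scalar. So every operator of the current algebra is a combination of the identity and the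
  operators of the Lie algebra itself, which gives irreducibility over the latter
  (\<open>irreducible_restricted\<close>). Dividing \<open>t\<^sup>r\<close> by \<open>\<kappa>\<close> for \<open>r \<noteq> 0\<close> gives the associative action (\<open>jet_operators\<close>).\<close>

section \<open>Finite-dimensional linear algebra over the complex numbers\<close>

lemma finite_dim_basis:
  assumes "finite_dim W"
  obtains S where "finite S" "S \<subseteq> W" "cvs.independent S" "W \<subseteq> cvs.span S" "card S = cvs.dim W"
proof -
  obtain S where S: "S \<subseteq> W" "cvs.independent S" "W \<subseteq> cvs.span S" "card S = cvs.dim W"
    using cvs.basis_exists[of W] by blast
  obtain R where R: "finite R" "W \<subseteq> cvs.span R" using assms unfolding finite_dim_def by blast
  have "finite S" using cvs.independent_span_bound[OF R(1) S(2)] S(1) R(2) by blast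
  then show ?thesis using S that by blast
qed

lemma finite_dim_subset: "finite_dim W \<Longrightarrow> U \<subseteq> W \<Longrightarrow> finite_dim U"
  unfolding finite_dim_def by blast

lemma independent_card_le_dim:
  assumes "finite_dim W" "S \<subseteq> W" "cvs.independent S"
  shows "finite S" "card S \<le> cvs.dim W"
proof -
  obtain R where R: "finite R" "W \<subseteq> cvs.span R" "card R = cvs.dim W"
    using finite_dim_basis[OF assms(1)] by metis
  then show "finite S" "card S \<le> cvs.dim W"
    using cvs.independent_span_bound[OF R(1) assms(3)] assms(2) by auto
qed

lemma subspace_eq_of_dim_le:
  assumes "finite_dim W" "cvs.subspace U" "U \<subseteq> W" "cvs.dim W \<le> cvs.dim U"
  shows "U = W"
proof (rule ccontr)
  assume "U \<noteq> W"
  then obtain x where x: "x \<in> W" "x \<notin> U" using assms(3) by blast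
  obtain S where S: "finite S" "S \<subseteq> U" "cvs.independent S" "card S = cvs.dim U"
    using finite_dim_basis[OF finite_dim_subset[OF assms(1,3)]] by metis
  have "cvs.span S \<subseteq> U" using S(2) assms(2) by (rule cvs.span_minimal)
  then have x': "x \<notin> cvs.span S" using x(2) by blast
  then have "cvs.independent (insert x S)" using S(3) by (simp add: cvs.independent_insert)
  moreover have "insert x S \<subseteq> W" using x S(2) assms(3) by blast
  ultimately have "card (insert x S) \<le> cvs.dim W" using independent_card_le_dim assms(1) by blast
  moreover have "x \<notin> S" using x(2) S(2) by blast
  ultimately show False using S(1,4) assms(4) by simp
qed

text \<open>A sequence in a space of dimension at most \<open>m\<close> becomes dependent on its predecessors
  after at most \<open>m\<close> steps.\<close>

lemma sequence_dependent:
  fixes x :: "nat \<Rightarrow> 'a::complex_vector"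
  assumes "finite_dim W" "cvs.dim W \<le> m" "\<And>k. k \<le> m \<Longrightarrow> x k \<in> W"
  shows "\<exists>k\<le>m. x k \<in> cvs.span (x ` {..<k})"
proof (rule ccontr)
  assume "\<not> ?thesis"
  then have ni: "x k \<notin> cvs.span (x ` {..<k})" if "k \<le> m" for k using that by blast
  have "k \<le> Suc m \<Longrightarrow> cvs.independent (x ` {..<k}) \<and> card (x ` {..<k}) = k" for k
  proof (induction k)
    case 0
    then show ?case by (simp add: cvs.independent_empty)
  next
    case (Suc k)
    then have IH: "cvs.independent (x ` {..<k})" "card (x ` {..<k}) = k" and k: "k \<le> m" by auto
    have "x k \<notin> x ` {..<k}" using ni[OF k] cvs.span_base[of "x k" "x ` {..<k}"] by blast
    then show ?case using IH ni[OF k] by (simp add: lessThan_Suc cvs.independent_insert)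
  qed
  then have *: "cvs.independent (x ` {..<Suc m})" "card (x ` {..<Suc m}) = Suc m" by blast+
  have "x ` {..<Suc m} \<subseteq> W" using assms(3) by auto
  from independent_card_le_dim(2)[OF assms(1) this *(1)] *(2) assms(2) show False by simp
qed

text \<open>\<open>poly_app f v p\<close> is \<open>p(f) v\<close>, the polynomial \<open>p\<close> in the map \<open>f\<close> applied to \<open>v\<close>.\<close>

definition poly_app :: "('a::complex_vector \<Rightarrow> 'a) \<Rightarrow> 'a \<Rightarrow> complex poly \<Rightarrow> 'a"
  where "poly_app f v p = (\<Sum>i\<le>degree p. coeff p i *\<^sub>C (f ^^ i) v)"

lemma poly_app_superset:
  assumes "degree p \<le> n"
  shows "poly_app f v p = (\<Sum>i\<le>n. coeff p i *\<^sub>C (f ^^ i) v)"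
  unfolding poly_app_def
  by (rule sum.mono_neutral_left) (use assms in \<open>auto simp: coeff_eq_0\<close>)

lemma poly_app_diff: "poly_app f v (p - q) = poly_app f v p - poly_app f v q"
proof -
  let ?n = "max (degree p) (degree q)"
  have "degree (p - q) \<le> ?n" by (simp add: degree_diff_le)
  then show ?thesis
    by (simp add: poly_app_superset[of _ ?n] cvs.scale_left_diff_distrib sum_subtractf)
qed

lemma poly_app_smult: "poly_app f v (smult a p) = a *\<^sub>C poly_app f v p"
  by (simp add: poly_app_superset[of "smult a p" "degree p"] poly_app_def cvs.scale_sum_right
      scaleC_scaleC)

lemma poly_app_shift:
  assumes "clinear f"
  shows "poly_app f v (pCons 0 p) = f (poly_app f v p)"
proof -
  have "poly_app f v (pCons 0 p) = (\<Sum>i\<le>Suc (degree p). coeff (pCons 0 p) i *\<^sub>C (f ^^ i) v)"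
    by (rule poly_app_superset) (simp add: degree_pCons_le)
  also have "\<dots> = (\<Sum>i\<le>degree p. coeff p i *\<^sub>C (f ^^ Suc i) v)"
    by (simp only: sum.atMost_Suc_shift coeff_pCons_0 coeff_pCons_Suc) simp
  also have "\<dots> = f (poly_app f v p)"
    by (simp add: poly_app_def cvs.linear_sum[OF assms] cvs.linear_scale[OF assms])
  finally show ?thesis .
qed

lemma poly_app_in:
  assumes "cvs.subspace W" "f ` W \<subseteq> W" "v \<in> W"
  shows "poly_app f v p \<in> W"
proof -
  have "(f ^^ i) v \<in> W" for i using assms(2,3) by (induction i) auto
  then show ?thesis
    unfolding poly_app_def by (intro cvs.subspace_sum cvs.subspace_scale assms(1))
qed

lemma eigenvector_exists:
  fixes f :: "'a::complex_vector \<Rightarrow> 'a"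
  assumes f: "clinear f" and W: "cvs.subspace W" "finite_dim W" "f ` W \<subseteq> W" and v: "v \<in> W" "v \<noteq> 0"
  shows "\<exists>w\<in>W. w \<noteq> 0 \<and> (\<exists>a. f w = a *\<^sub>C w)"
proof -
  have vW: "(f ^^ i) v \<in> W" for i using W(3) v(1) by (induction i) auto
  obtain k where k: "(f ^^ k) v \<in> cvs.span ((\<lambda>i. (f ^^ i) v) ` {..<k})"
    using sequence_dependent[OF W(2) order_refl, of "\<lambda>i. (f ^^ i) v"] vW by blast
  have "\<exists>q. degree q < Suc k \<and> coeff q k = 0 \<and> w = poly_app f v q"
    if "w \<in> cvs.span ((\<lambda>i. (f ^^ i) v) ` {..<k})" for w
    using that
  proof (induction rule: cvs.span_induct_alt)
    case base
    show ?case by (rule exI[of _ 0]) (simp add: poly_app_def)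
  next
    case (step c x y)
    then obtain i q where i: "i < k" "x = (f ^^ i) v" and q: "degree q < Suc k" "coeff q k = 0"
      "y = poly_app f v q" by auto
    have mon: "poly_app f v (monom (- c) i) = - c *\<^sub>C x"
    proof -
      have "poly_app f v (monom (- c) i) = (\<Sum>j\<le>i. coeff (monom (- c) i) j *\<^sub>C (f ^^ j) v)"
        by (rule poly_app_superset) (rule degree_monom_le)
      also have "\<dots> = (\<Sum>j\<le>i. if j = i then - c *\<^sub>C (f ^^ j) v else 0)"
        by (rule sum.cong) auto
      finally show ?thesis using i(2) by simp
    qed
    have "degree (q - monom (- c) i) \<le> k"
      using q(1) i(1) degree_monom_le[of "- c" i] by (intro degree_diff_le) auto
    moreover have "c *\<^sub>C x + y = poly_app f v (q - monom (- c) i)"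
      by (simp add: poly_app_diff mon q(3))
    ultimately show ?case using q(2) i(1) by (intro exI[of _ "q - monom (- c) i"]) auto
  qed
  from this[OF k] obtain q where q: "degree q < Suc k" "coeff q k = 0" "(f ^^ k) v = poly_app f v q"
    by blast
  have mon: "poly_app f v (monom 1 k) = (f ^^ k) v"
  proof -
    have "poly_app f v (monom 1 k) = (\<Sum>j\<le>k. coeff (monom 1 k) j *\<^sub>C (f ^^ j) v)"
      by (rule poly_app_superset) (rule degree_monom_le)
    also have "\<dots> = (\<Sum>j\<le>k. if j = k then (f ^^ j) v else 0)"
      by (rule sum.cong) auto
    finally show ?thesis by simp
  qed
  have "monom 1 k - q \<noteq> 0"
  proof
    assume "monom 1 k - q = 0"
    then have "coeff (monom 1 k - q) k = 0" by simp
    then show False using q(2) by simp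
  qed
  moreover have "poly_app f v (monom 1 k - q) = 0" by (simp add: poly_app_diff mon q(3))
  ultimately obtain p where p: "p \<noteq> 0" "poly_app f v p = 0" by blast
  then show ?thesis
  proof (induction "degree p" arbitrary: p rule: less_induct)
    case less
    show ?case
    proof (cases "degree p = 0")
      case True
      then obtain a where a: "p = [:a:]" by (auto elim: degree_eq_zeroE)
      then have "a \<noteq> 0" "a *\<^sub>C v = 0" using less.prems by (auto simp: poly_app_def)
      then show ?thesis using v(2) by simp
    next
      case False
      then have "\<not> constant (poly p)" by (simp add: constant_degree)
      then obtain a where "poly p a = 0" using fundamental_theorem_of_algebra by blast
      then obtain r where r: "p = [:- a, 1:] * r" by (metis poly_eq_0_iff_dvd dvdE)
      have r0: "r \<noteq> 0" using r less.prems by auto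
      have pr: "p = pCons 0 r - smult a r" by (simp add: r)
      have eq: "f (poly_app f v r) = a *\<^sub>C poly_app f v r"
        using less.prems(2) by (simp add: pr poly_app_diff poly_app_smult poly_app_shift[OF f])
      show ?thesis
      proof (cases "poly_app f v r = 0")
        case True
        have "degree p = Suc (degree r)" unfolding r using r0 by (subst degree_mult_eq) auto
        then show ?thesis using less.hyps[of r] r0 True by simp
      next
        case False
        then show ?thesis using eq poly_app_in[OF W(1,3) v(1)] by blast
      qed
    qed
  qed
qed

text \<open>In a nonzero stable subspace of least dimension every member of a commuting family acts as a
  scalar, because its eigenspaces there are stable.\<close>

lemma common_eigenvector:
  fixes F :: "('a::complex_vector \<Rightarrow> 'a) set"
  assumes W: "cvs.subspace W" "finite_dim W" "W \<noteq> {0}"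
    and lin: "\<And>f. f \<in> F \<Longrightarrow> clinear f" and stable: "\<And>f. f \<in> F \<Longrightarrow> f ` W \<subseteq> W"
    and commute: "\<And>f g w. f \<in> F \<Longrightarrow> g \<in> F \<Longrightarrow> w \<in> W \<Longrightarrow> f (g w) = g (f w)"
  shows "\<exists>v\<in>W. v \<noteq> 0 \<and> (\<forall>f\<in>F. \<exists>a. f v = a *\<^sub>C v)"
proof -
  define P where "P U \<longleftrightarrow> cvs.subspace U \<and> U \<subseteq> W \<and> U \<noteq> {0} \<and> (\<forall>f\<in>F. f ` U \<subseteq> U)" for U
  have "P W" unfolding P_def using W(1,3) stable by simp
  from ex_has_least_nat[of P, OF this, of cvs.dim] obtain U where PU: "P U"
    and least: "\<forall>U'. P U' \<longrightarrow> cvs.dim U \<le> cvs.dim U'" by (elim exE conjE)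
  note U = PU[unfolded P_def]
  have Ufd: "finite_dim U" using U W(2) finite_dim_subset by blast
  have "0 \<in> U" using U by (simp add: cvs.subspace_0)
  then obtain u where u: "u \<in> U" "u \<noteq> 0" using U by blast
  have "\<exists>a. f u = a *\<^sub>C u" if f: "f \<in> F" for f
  proof -
    obtain w a where w: "w \<in> U" "w \<noteq> 0" "f w = a *\<^sub>C w"
      using eigenvector_exists[OF lin[OF f] _ Ufd _ u] U f by blast
    let ?E = "{x \<in> U. f x = a *\<^sub>C x}"
    have "cvs.subspace ?E"
      using U by (auto simp: cvs.subspace_def cvs.linear_add[OF lin[OF f]]
          cvs.linear_scale[OF lin[OF f]] cvs.linear_0[OF lin[OF f]] scaleC_add_right scaleC_scaleC mult.commute)
    moreover have "g ` ?E \<subseteq> ?E" if g: "g \<in> F" for g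
    proof safe
      fix x assume x: "x \<in> U" "f x = a *\<^sub>C x"
      show "g x \<in> U" using U g x by blast
      have "f (g x) = g (f x)" using commute[OF f g] x U by blast
      then show "f (g x) = a *\<^sub>C g x" using x by (simp add: cvs.linear_scale[OF lin[OF g]])
    qed
    moreover have "?E \<noteq> {0}" using w by blast
    ultimately have "P ?E" using U unfolding P_def by blast
    then have "cvs.dim U \<le> cvs.dim ?E" using least by simp
    then have "?E = U" using \<open>cvs.subspace ?E\<close> by (intro subspace_eq_of_dim_le[OF Ufd]) auto
    then show ?thesis using u by blast
  qed
  then show ?thesis using u U by blast
qed

text \<open>A linear map has no infinite sequence of eigenvectors with distinct eigenvalues in a
  finite-dimensional subspace: \<open>\<Prod>\<^sub>l\<^sub><\<^sub>k (f - e\<^sub>l)\<close> annihilates the eigenvectors before the \<open>k\<close>-th one,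
  but not the \<open>k\<close>-th one.\<close>

lemma eigenvalues_bounded:
  fixes f :: "'a::complex_vector \<Rightarrow> 'a"
  assumes f: "clinear f" and W: "finite_dim W" and e: "inj e"
    and y: "\<And>k::nat. y k \<in> W \<and> y k \<noteq> 0 \<and> f (y k) = e k *\<^sub>C y k"
  shows False
proof -
  obtain k where k: "y k \<in> cvs.span (y ` {..<k})"
    using sequence_dependent[OF W order_refl, of y] y by blast
  define P where "P = rec_nat (\<lambda>x. x) (\<lambda>j p x. f (p x) - e j *\<^sub>C p x)"
  have P0: "P 0 x = x" and PS: "P (Suc j) x = f (P j x) - e j *\<^sub>C P j x" for j x
    by (simp_all add: P_def)
  have lin: "clinear (P j)" for j
  proof (induction j)
    case 0
    show ?case by (rule clinearI) (simp_all add: P0)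
  next
    case (Suc j)
    show ?case
      by (rule clinearI) (simp_all add: PS cvs.linear_add[OF Suc] cvs.linear_scale[OF Suc]
          cvs.linear_add[OF f] cvs.linear_scale[OF f] scaleC_add_right scaleC_scaleC
          cvs.scale_right_diff_distrib mult.commute)
  qed
  have Py: "P j (y i) = (\<Prod>l<j. e i - e l) *\<^sub>C y i" for i j
    by (induction j)
      (simp_all add: P0 PS scaleC_one cvs.linear_scale[OF f] y scaleC_scaleC cvs.scale_left_diff_distrib algebra_simps)
  have "P k x = 0" if "x \<in> cvs.span (y ` {..<k})" for x
    using that by (rule cvs.linear_eq_0_on_span[OF lin, rotated]) (auto simp: Py prod_zero_iff)
  then have "(\<Prod>l<k. e k - e l) *\<^sub>C y k = 0" using k by (simp flip: Py)
  then have "(\<Prod>l<k. e k - e l) = 0" using y[of k] by simp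
  then show False using e by (auto simp: prod_zero_iff dest: injD)
qed

text \<open>Finite-dimensionality from a linear map with finite-dimensional image and kernel.\<close>

lemma finite_dim_image_kernel:
  assumes f: "clinear f" and G: "cvs.subspace G"
    and im: "finite_dim (f ` G)" and ker: "finite_dim {x \<in> G. f x = 0}"
  shows "finite_dim G"
proof -
  obtain S where S: "finite S" "S \<subseteq> f ` G" "f ` G \<subseteq> cvs.span S"
    using finite_dim_basis[OF im] by metis
  then obtain R where R: "finite R" "R \<subseteq> G" "S = f ` R" by (metis finite_subset_image)
  obtain K where K: "finite K" "{x \<in> G. f x = 0} \<subseteq> cvs.span K"
    using ker unfolding finite_dim_def by blast
  have "x \<in> cvs.span (R \<union> K)" if x: "x \<in> G" for x
  proof -
    have "f x \<in> f ` cvs.span R"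
      using S(3) x by (auto simp: R(3) cvs.linear_span_image[OF f])
    then obtain z where z: "z \<in> cvs.span R" "f x = f z" by blast
    have "z \<in> G" using z(1) cvs.span_minimal[OF R(2) G] by blast
    then have "x - z \<in> {x \<in> G. f x = 0}"
      using x z(2) G by (simp add: cvs.linear_diff[OF f] cvs.subspace_diff)
    then have "x - z \<in> cvs.span (R \<union> K)" "z \<in> cvs.span (R \<union> K)"
      using K(2) z(1) cvs.span_mono[of K "R \<union> K"] cvs.span_mono[of R "R \<union> K"] by blast+
    then have "(x - z) + z \<in> cvs.span (R \<union> K)" by (rule cvs.span_add)
    then show ?thesis by simp
  qed
  then show ?thesis unfolding finite_dim_def using R(1) K(1) by blast
qed

text \<open>A vector-valued polynomial function vanishing on the complex numbers has zero coefficients.\<close>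

lemma vector_polynomial_zero:
  fixes c :: "nat \<Rightarrow> 'a::complex_vector"
  assumes "\<And>a. (\<Sum>j<n. a ^ j *\<^sub>C c j) = 0" "i < n"
  shows "c i = 0"
  using assms
proof (induction n arbitrary: c i)
  case (Suc n)
  \<comment> \<open>if \<open>p\<close> is the given polynomial, then \<open>p(2a) - 2\<^sup>n p(a)\<close> has no term of degree \<open>n\<close>\<close>
  have z: "(\<Sum>j<n. a ^ j *\<^sub>C ((2 ^ j - 2 ^ n) *\<^sub>C c j)) = 0" for a
  proof -
    have "(\<Sum>j<n. a ^ j *\<^sub>C ((2 ^ j - 2 ^ n) *\<^sub>C c j))
        = (\<Sum>j<Suc n. (2 * a) ^ j *\<^sub>C c j) - 2 ^ n *\<^sub>C (\<Sum>j<Suc n. a ^ j *\<^sub>C c j)"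
      by (simp add: cvs.scale_sum_right scaleC_scaleC scaleC_add_right power_mult_distrib
          flip: sum_subtractf)
        (simp add: algebra_simps cvs.scale_left_diff_distrib)
    then show ?thesis by (simp only: Suc.prems(1) cvs.scale_zero_right diff_zero)
  qed
  have c: "c j = 0" if "j < n" for j
  proof -
    have "(2::complex) ^ j \<noteq> 2 ^ n"
    proof
      assume "(2::complex) ^ j = 2 ^ n"
      then have "(of_nat (2 ^ j)::complex) = of_nat (2 ^ n)" by simp
      then have "(2::nat) ^ j = 2 ^ n" by (simp only: of_nat_eq_iff)
      then show False using that by simp
    qed
    then show ?thesis using Suc.IH[OF z that] by simp
  qed
  then have "c n = 0" using Suc.prems(1)[of 1] by (simp add: scaleC_one)
  then show ?case using c Suc.prems(2) by (cases "i = n") auto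
qed simp

section \<open>The ring of endomorphisms and nilpotency\<close>

text \<open>The ring of linear endomorphisms. It is not required to be nontrivial, so it is an instance of
  the classes of rings and of multiplicative monoids rather than of unital rings.\<close>

typedef (overloaded) 'v endo = "{f :: 'v::complex_vector \<Rightarrow> 'v. clinear f}"
  morphisms app Endo
proof -
  have "clinear (\<lambda>x::'v. x)" by (rule clinearI) simp_all
  then show ?thesis by blast
qed

setup_lifting type_definition_endo

lemma app_linear: "clinear (app x)"
  using app[of x] by simp

lemmas app_simps =
  cvs.linear_add[OF app_linear] cvs.linear_diff[OF app_linear] cvs.linear_neg[OF app_linear]
  cvs.linear_scale[OF app_linear] cvs.linear_0[OF app_linear]

instantiation endo :: (complex_vector) "{ring, monoid_mult, complex_vector}"
begin

lift_definition zero_endo :: "'a endo" is "\<lambda>v. 0" by (rule clinearI) simp_all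
lift_definition one_endo :: "'a endo" is "\<lambda>v. v" by (rule clinearI) simp_all
lift_definition plus_endo :: "'a endo \<Rightarrow> 'a endo \<Rightarrow> 'a endo" is "\<lambda>f g v. f v + g v"
  by (rule clinearI) (simp_all add: cvs.linear_add cvs.linear_scale scaleC_add_right)
lift_definition minus_endo :: "'a endo \<Rightarrow> 'a endo \<Rightarrow> 'a endo" is "\<lambda>f g v. f v - g v"
  by (rule clinearI) (simp_all add: cvs.linear_add cvs.linear_scale cvs.scale_right_diff_distrib)
lift_definition uminus_endo :: "'a endo \<Rightarrow> 'a endo" is "\<lambda>f v. - f v"
  by (rule clinearI) (simp_all add: cvs.linear_add cvs.linear_scale)
lift_definition times_endo :: "'a endo \<Rightarrow> 'a endo \<Rightarrow> 'a endo" is "\<lambda>f g v. f (g v)"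
  by (rule clinearI) (simp_all add: cvs.linear_add cvs.linear_scale)
lift_definition scaleC_endo :: "complex \<Rightarrow> 'a endo \<Rightarrow> 'a endo" is "\<lambda>a f v. a *\<^sub>C f v"
  by (rule clinearI) (simp_all add: cvs.linear_add cvs.linear_scale scaleC_add_right scaleC_scaleC
      mult.commute)

instance
proof
  fix x y z :: "'a endo" and a b :: complex
  show "x + y + z = x + (y + z)" by transfer (simp add: add.assoc)
  show "x + y = y + x" by transfer (simp add: add.commute)
  show "0 + x = x" by transfer simp
  show "- x + x = 0" by transfer simp
  show "x - y = x + - y" by transfer simp
  show "x * y * z = x * (y * z)" by transfer simp
  show "1 * x = x" "x * 1 = x" by (transfer, simp)+
  show "(x + y) * z = x * z + y * z" by transfer simp
  show "x * (y + z) = x * y + x * z" by transfer (simp add: cvs.linear_add)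
  show "a *\<^sub>C (x + y) = a *\<^sub>C x + a *\<^sub>C y" by transfer (simp add: scaleC_add_right)
  show "(a + b) *\<^sub>C x = a *\<^sub>C x + b *\<^sub>C x" by transfer (simp add: scaleC_add_left)
  show "a *\<^sub>C b *\<^sub>C x = (a * b) *\<^sub>C x" by transfer (simp add: scaleC_scaleC)
  show "1 *\<^sub>C x = x" by transfer (simp add: scaleC_one)
qed

end

lemma app_endo_simps [simp]:
  "app 0 v = 0" "app 1 v = v" "app (x + y) v = app x v + app y v" "app (x - y) v = app x v - app y v"
  "app (- x) v = - app x v" "app (x * y) v = app x (app y v)" "app (a *\<^sub>C x) v = a *\<^sub>C app x v"
  by (transfer, simp)+

lemma endo_eqI: "(\<And>v. app x v = app y v) \<Longrightarrow> x = y"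
  by transfer auto

lemma endo_scaleC_mult [simp]:
  "(a *\<^sub>C x) * y = a *\<^sub>C (x * y)" "x * (a *\<^sub>C y) = a *\<^sub>C (x * y)" for x y :: "'v::complex_vector endo"
  by (rule endo_eqI, simp add: app_simps)+

lemma endo_scaleC_power: "(a *\<^sub>C x) ^ n = a ^ n *\<^sub>C x ^ n" for x :: "'v::complex_vector endo"
  by (induction n) (simp_all add: scaleC_one scaleC_scaleC mult_ac)

lemma app_Endo: "clinear f \<Longrightarrow> app (Endo f) = f"
  by (simp add: Endo_inverse)

lemma power_commutes_left:
  fixes x y :: "'v::complex_vector endo"
  assumes "x * y = y * x" shows "x ^ n * y = y * x ^ n"
  using assms by (metis power_commuting_commutes)

lemma power_mult_commuting:
  fixes x y :: "'v::complex_vector endo"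
  assumes "x * y = y * x" shows "(x * y) ^ n = x ^ n * y ^ n"
proof (induction n)
  case (Suc n)
  have "(x * y) ^ Suc n = x * y * (x ^ n * y ^ n)" by (simp add: Suc)
  also have "\<dots> = x * (y * x ^ n) * y ^ n" by (simp add: mult.assoc)
  also have "\<dots> = x * (x ^ n * y) * y ^ n" by (simp add: power_commutes_left[OF assms])
  finally show ?case by (simp add: mult.assoc)
qed simp

lemma nilpotent_mult:
  fixes x y :: "'v::complex_vector endo"
  assumes "x * y = y * x" "x ^ n = 0" shows "(x * y) ^ n = 0" "(y * x) ^ n = 0"
  using assms power_mult_commuting[of x y n] by simp_all

lemma power_annihilates_mult:
  fixes x y z :: "'v::complex_vector endo"
  assumes "x * y = y * x" "x ^ n * z = 0" shows "x ^ n * (y * z) = 0"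
proof -
  have "x ^ n * (y * z) = y * (x ^ n * z)"
    by (simp only: mult.assoc[symmetric] power_commutes_left[OF assms(1)])
  then show ?thesis by (simp add: assms(2))
qed

lemma commute_mult:
  fixes x y z :: "'v::complex_vector endo"
  assumes "x * y = y * x" "x * z = z * x" shows "x * (y * z) = y * z * x"
  using assms by (metis mult.assoc)

text \<open>The factor \<open>z\<close> makes the induction on \<open>a + b\<close> work.\<close>

lemma nilpotent_add_aux:
  fixes x y z :: "'v::complex_vector endo"
  assumes "x * y = y * x" "x ^ a * z = 0" "y ^ b * z = 0" "x * z = z * x" "y * z = z * y"
  shows "(x + y) ^ (a + b) * z = 0"
  using assms(2-)
proof (induction "a + b" arbitrary: a b z)
  case 0
  then show ?case by simp
next
  case (Suc n)
  have xz: "(x + y) ^ n * (x * z) = 0"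
  proof (cases a)
    case 0
    then show ?thesis using Suc.prems by simp
  next
    case (Suc a')
    have "n = a' + b" using Suc Suc.hyps(2) by simp
    moreover have "x ^ a' * (x * z) = 0"
      using Suc.prems(1) Suc by (simp add: mult.assoc[symmetric] power_commutes)
    moreover have "y ^ b * (x * z) = 0"
      by (rule power_annihilates_mult[OF assms(1)[symmetric] Suc.prems(2)])
    moreover have "x * (x * z) = x * z * x" "y * (x * z) = x * z * y"
      by (rule commute_mult; (simp add: assms(1) Suc.prems(3,4))?)+
    ultimately show ?thesis using Suc.hyps(1) by blast
  qed
  have yz: "(x + y) ^ n * (y * z) = 0"
  proof (cases b)
    case 0
    then show ?thesis using Suc.prems by simp
  next
    case (Suc b')
    have "n = a + b'" using Suc Suc.hyps(2) by simp
    moreover have "y ^ b' * (y * z) = 0"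
      using Suc.prems(2) Suc by (simp add: mult.assoc[symmetric] power_commutes)
    moreover have "x ^ a * (y * z) = 0"
      by (rule power_annihilates_mult[OF assms(1) Suc.prems(1)])
    moreover have "x * (y * z) = y * z * x" "y * (y * z) = y * z * y"
      by (rule commute_mult; (simp add: assms(1) Suc.prems(3,4))?)+
    ultimately show ?thesis using Suc.hyps(1) by blast
  qed
  have "(x + y) ^ Suc n * z = (x + y) ^ n * (x * z) + (x + y) ^ n * (y * z)"
    by (simp only: power_Suc2 mult.assoc distrib_left distrib_right)
  then show ?case using xz yz by (simp add: Suc.hyps(2)[symmetric])
qed

lemma nilpotent_add:
  fixes x y :: "'v::complex_vector endo"
  assumes "x * y = y * x" "x ^ a = 0" "y ^ b = 0"
  shows "(x + y) ^ (a + b) = 0"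
  using nilpotent_add_aux[of x y a 1 b] assms by simp

lemma nilpotent_diff:
  fixes x y :: "'v::complex_vector endo"
  assumes "x * y = y * x" "x ^ a = 0" "y ^ b = 0"
  shows "(x - y) ^ (a + b) = 0"
proof -
  have "(- y) ^ b = 0" using endo_scaleC_power[of "-1" y b] assms(3) by (simp add: scaleC_one)
  then show ?thesis using nilpotent_add[of x "- y" a b] assms by simp
qed

text \<open>The commutator; \<open>comm y\<close> is the inner derivation given by \<open>y\<close>.\<close>

definition comm :: "'v::complex_vector endo \<Rightarrow> 'v endo \<Rightarrow> 'v endo"
  where "comm y x = y * x - x * y"

lemma comm_simps:
  "comm y (x + z) = comm y x + comm y z" "comm y (x - z) = comm y x - comm y z"
  "comm (y + z) x = comm y x + comm z x"
  "comm y (a *\<^sub>C x) = a *\<^sub>C comm y x" "comm (a *\<^sub>C y) x = a *\<^sub>C comm y x"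
  "comm y (x * z) = comm y x * z + x * comm y z" "comm y 1 = 0" "comm y 0 = 0" "comm 0 y = 0"
  by (simp_all add: comm_def algebra_simps scaleC_add_right cvs.scale_right_diff_distrib)

lemma comm_swap: "comm y x = - comm x y"
  by (simp add: comm_def)

lemma clinear_comm: "clinear (comm y)"
  by (rule clinearI) (simp_all add: comm_simps)

lemma comm_eq_0_iff: "comm y x = 0 \<longleftrightarrow> y * x = x * y"
  by (simp add: comm_def)

lemma comm_power:
  assumes "x * comm y x = comm y x * x"
  shows "comm y (x ^ n) = of_nat n *\<^sub>C (x ^ (n - 1) * comm y x)"
proof (induction n)
  case (Suc n)
  have "comm y (x ^ Suc n) = comm y x * x ^ n + of_nat n *\<^sub>C (x * x ^ (n - 1) * comm y x)"
    by (simp add: comm_simps Suc mult.assoc)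
  also have "comm y x * x ^ n = x ^ n * comm y x"
    using power_commutes_left[OF assms] by simp
  also have "of_nat n *\<^sub>C (x * x ^ (n - 1) * comm y x) = of_nat n *\<^sub>C (x ^ n * comm y x)"
    by (cases n) simp_all
  finally show ?case by (simp add: scaleC_add_left scaleC_one)
qed (simp add: comm_simps)

text \<open>In characteristic 0 a derivation preserves nilpotency: if \<open>x\<^sup>n = 0\<close>, then by induction on \<open>k\<close>
  \<open>x\<^sup>n\<^sup>-\<^sup>k (dx)\<^sup>2\<^sup>k = 0\<close>; the case \<open>k = n\<close> is the claim.\<close>

lemma nilpotent_comm:
  assumes x: "x ^ n = 0" and c1: "x * comm y x = comm y x * x"
    and c2: "comm y x * comm y (comm y x) = comm y (comm y x) * comm y x"
  shows "comm y x ^ (2 * n) = 0"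
proof -
  let ?d = "comm y x"
  have "x ^ (n - k) * ?d ^ (2 * k) = 0" if "k \<le> n" for k
    using that
  proof (induction k)
    case 0
    then show ?case using x by simp
  next
    case (Suc k)
    define m where "m = n - Suc k"
    have nk: "n - k = Suc m" using Suc.prems by (simp add: m_def)
    have IH: "x ^ Suc m * ?d ^ (2 * k) = 0" using Suc nk by simp
    have "0 = comm y (x ^ Suc m * ?d ^ (2 * k)) * ?d" by (simp only: IH comm_simps mult_zero_left)
    also have "\<dots> = of_nat (Suc m) *\<^sub>C (x ^ m * ?d * ?d ^ (2 * k) * ?d)
        + of_nat (2 * k) *\<^sub>C (x ^ Suc m * (?d ^ (2 * k - 1) * comm y ?d) * ?d)"
      unfolding comm_simps comm_power[OF c1] comm_power[OF c2]
      by (simp only: distrib_right endo_scaleC_mult diff_Suc_1)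
    also have "of_nat (2 * k) *\<^sub>C (x ^ Suc m * (?d ^ (2 * k - 1) * comm y ?d) * ?d) = 0"
    proof (cases k)
      case (Suc k')
      have "x ^ Suc m * (?d ^ (2 * k - 1) * comm y ?d) * ?d
          = x ^ Suc m * (?d ^ (2 * k - 1) * ?d) * comm y ?d"
        by (simp only: mult.assoc c2)
      also have "?d ^ (2 * k - 1) * ?d = ?d ^ (2 * k)" using Suc by (simp add: power_commutes mult.assoc)
      finally show ?thesis using IH by simp
    qed simp
    also have "x ^ m * ?d * ?d ^ (2 * k) * ?d = x ^ m * ?d ^ (2 * Suc k)"
      by (simp add: mult.assoc power_commutes)
    finally have "of_nat (Suc m) *\<^sub>C (x ^ m * ?d ^ (2 * Suc k)) = 0" by simp
    moreover have "(of_nat (Suc m) :: complex) \<noteq> 0" by (simp only: of_nat_eq_0_iff)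
    ultimately show ?case unfolding m_def[symmetric] by (simp only: cvs.scale_eq_0_iff) simp
  qed
  from this[of n] show ?thesis by simp
qed

text \<open>Nilpotency of an endomorphism stabilising a space of dimension at most \<open>m\<close> on a vector of
  that space: the exponent can be taken to be \<open>m\<close>.\<close>

lemma nilpotent_exponent:
  assumes W: "finite_dim W" "cvs.dim W \<le> m" "app x ` W \<subseteq> W" and v: "v \<in> W" "app (x ^ n) v = 0"
  shows "app (x ^ m) v = 0"
proof (rule ccontr)
  assume nz: "app (x ^ m) v \<noteq> 0"
  define p where "p = (LEAST p. app (x ^ p) v = 0)"
  \<comment> \<open>\<open>x\<^sup>p\<^sup>-\<^sup>1 v, x\<^sup>p\<^sup>-\<^sup>2 v, \<dots>\<close> are linearly independent, as \<open>x\<^sup>k\<close> separates the \<open>k\<close>-th of them from its predecessors\<close>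
  have p0: "app (x ^ p) v = 0" unfolding p_def by (rule LeastI[of _ n]) (rule v(2))
  have pl: "app (x ^ q) v \<noteq> 0" if "q < p" for q
    using not_less_Least[of q "\<lambda>p. app (x ^ p) v = 0"] that by (simp add: p_def)
  have zero: "app (x ^ q) v = 0" if "q \<ge> p" for q
  proof -
    have "x ^ q = x ^ (q - p) * x ^ p" using that by (simp flip: power_add)
    then show ?thesis by (simp add: p0 app_simps)
  qed
  have mp: "m < p" using nz zero by (meson not_le)
  have "app (x ^ i) v \<in> W" for i using W(3) v(1) by (induction i) auto
  then obtain k where k: "k \<le> m" "app (x ^ (p - 1 - k)) v \<in> cvs.span ((\<lambda>k. app (x ^ (p - 1 - k)) v) ` {..<k})"
    using sequence_dependent[OF W(1,2), of "\<lambda>k. app (x ^ (p - 1 - k)) v"] by blast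
  have "app (x ^ k) w = 0" if "w \<in> cvs.span ((\<lambda>k. app (x ^ (p - 1 - k)) v) ` {..<k})" for w
    using that
  proof (rule cvs.linear_eq_0_on_span[OF app_linear, rotated])
    fix w assume "w \<in> (\<lambda>k. app (x ^ (p - 1 - k)) v) ` {..<k}"
    then obtain j where j: "j < k" "w = app (x ^ (p - 1 - j)) v" by blast
    have "app (x ^ k) w = app (x ^ (k + (p - 1 - j))) v" by (simp add: j power_add)
    then show "app (x ^ k) w = 0" using j(1) k(1) mp by (simp add: zero)
  qed
  from this[OF k(2)] have "app (x ^ (k + (p - 1 - k))) v = 0" by (simp add: power_add)
  then show False using pl[of "p - 1"] k(1) mp by simp
qed

text \<open>\<open>(x + a y)\<^sup>n\<^sup>+\<^sup>1\<close> is a polynomial in the scalar \<open>a\<close> with linear coefficient \<open>(n + 1) x\<^sup>n y\<close>.\<close>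

lemma power_add_linear_term:
  fixes x y :: "'v::complex_vector endo"
  assumes "x * y = y * x"
  shows "\<exists>c. c (Suc 0) = of_nat (Suc n) *\<^sub>C (x ^ n * y) \<and>
    (\<forall>a. (x + a *\<^sub>C y) ^ Suc n = (\<Sum>j<Suc (Suc n). a ^ j *\<^sub>C c j))"
proof (induction n)
  case 0
  show ?case by (rule exI[of _ "\<lambda>j. if j = 0 then x else y"]) (simp add: scaleC_one)
next
  case (Suc n)
  then obtain c where c1: "c (Suc 0) = of_nat (Suc n) *\<^sub>C (x ^ n * y)"
    and c: "\<And>a. (x + a *\<^sub>C y) ^ Suc n = (\<Sum>j<Suc (Suc n). a ^ j *\<^sub>C c j)" by blast
  have c0: "c 0 = x ^ Suc n"
  proof -
    have "(\<Sum>j<Suc (Suc n). 0 ^ j *\<^sub>C c j) = c 0"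
      by (subst sum.lessThan_Suc_shift) (simp add: scaleC_one)
    then show ?thesis using c[of 0] by simp
  qed
  define c' where "c' j = (if j < Suc (Suc n) then x * c j else 0)
      + (case j of 0 \<Rightarrow> 0 | Suc i \<Rightarrow> y * c i)" for j
  have "(x + a *\<^sub>C y) ^ Suc (Suc n) = (\<Sum>j<Suc (Suc (Suc n)). a ^ j *\<^sub>C c' j)" for a
  proof -
    have "(x + a *\<^sub>C y) ^ Suc (Suc n)
        = x * (\<Sum>j<Suc (Suc n). a ^ j *\<^sub>C c j) + a *\<^sub>C (y * (\<Sum>j<Suc (Suc n). a ^ j *\<^sub>C c j))"
      by (subst power_Suc) (simp only: c distrib_right endo_scaleC_mult)
    also have "x * (\<Sum>j<Suc (Suc n). a ^ j *\<^sub>C c j)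
        = (\<Sum>j<Suc (Suc (Suc n)). a ^ j *\<^sub>C (if j < Suc (Suc n) then x * c j else 0))"
      by (subst (2) sum.lessThan_Suc) (simp add: sum_distrib_left del: sum.lessThan_Suc)
    also have "a *\<^sub>C (y * (\<Sum>j<Suc (Suc n). a ^ j *\<^sub>C c j))
        = (\<Sum>j<Suc (Suc (Suc n)). a ^ j *\<^sub>C (case j of 0 \<Rightarrow> 0 | Suc i \<Rightarrow> y * c i))"
      by (subst (2) sum.lessThan_Suc_shift)
        (simp add: sum_distrib_left cvs.scale_sum_right scaleC_scaleC del: sum.lessThan_Suc)
    finally show ?thesis
      by (simp only: c'_def scaleC_add_right sum.distrib)
  qed
  moreover have "c' (Suc 0) = of_nat (Suc (Suc n)) *\<^sub>C (x ^ Suc n * y)"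
  proof -
    have "y * x ^ Suc n = x ^ Suc n * y" by (rule power_commutes_left[OF assms, symmetric])
    then have "c' (Suc 0) = of_nat (Suc n) *\<^sub>C (x ^ Suc n * y) + x ^ Suc n * y"
      by (simp add: c'_def c1 c0 mult.assoc)
    also have "\<dots> = (of_nat (Suc n) + 1) *\<^sub>C (x ^ Suc n * y)"
      by (simp only: scaleC_add_left scaleC_one)
    finally show ?thesis by (simp only: of_nat_Suc add.commute)
  qed
  ultimately show ?case by blast
qed

text \<open>A commuting linear space of endomorphisms with a uniform bound on the order of nilpotency has a
  common null vector: if \<open>K\<close> is the minimal bound and \<open>x\<^sup>K\<^sup>-\<^sup>1 \<noteq> 0\<close>, then the linear coefficient of
  \<open>(x + a y)\<^sup>K = 0\<close> shows that \<open>x\<^sup>K\<^sup>-\<^sup>1\<close> is annihilated by all \<open>y\<close>.\<close>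

lemma common_null_vector:
  fixes S :: "'v::complex_vector endo set"
  assumes S: "cvs.subspace S" and commute: "\<And>x y. x \<in> S \<Longrightarrow> y \<in> S \<Longrightarrow> x * y = y * x"
    and nil: "\<And>x. x \<in> S \<Longrightarrow> x ^ K = 0" and nontriv: "\<exists>v::'v. v \<noteq> 0"
  shows "\<exists>v\<noteq>0. \<forall>y\<in>S. app y v = 0"
proof -
  obtain u :: 'v where "u \<noteq> 0" using nontriv by blast
  then have one: "(1::'v endo) \<noteq> 0" by (metis app_endo_simps(1,2))
  define k where "k = (LEAST k. \<forall>x\<in>S. x ^ k = 0)"
  have k: "\<forall>x\<in>S. x ^ k = 0"
    unfolding k_def by (rule LeastI[of _ K]) (use nil in blast)
  have "k \<noteq> 0"
  proof
    assume "k = 0"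
    then have "(0::'v endo) ^ 0 = 0" using k cvs.subspace_0[OF S] by metis
    then show False using one by simp
  qed
  then obtain n where n: "k = Suc n" by (cases k) auto
  then have "\<not> (\<forall>x\<in>S. x ^ n = 0)"
    using not_less_Least[of n "\<lambda>k. \<forall>x\<in>S. x ^ k = 0"] by (simp add: k_def)
  then obtain x where x: "x \<in> S" "x ^ n \<noteq> 0" by blast
  then obtain v where v: "app (x ^ n) v \<noteq> 0" by (metis endo_eqI app_endo_simps(1))
  have "app y (app (x ^ n) v) = 0" if y: "y \<in> S" for y
  proof -
    obtain c where c: "c (Suc 0) = of_nat (Suc n) *\<^sub>C (x ^ n * y)"
      "\<And>a. (x + a *\<^sub>C y) ^ Suc n = (\<Sum>j<Suc (Suc n). a ^ j *\<^sub>C c j)"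
      using power_add_linear_term[OF commute[OF x(1) y]] by blast
    have "x + a *\<^sub>C y \<in> S" for a
      using S x(1) y by (simp add: cvs.subspace_add cvs.subspace_scale)
    then have "(\<Sum>j<Suc (Suc n). a ^ j *\<^sub>C c j) = 0" for a using k n c(2) by metis
    then have "c (Suc 0) = 0" by (rule vector_polynomial_zero) simp
    then have "x ^ n * y = 0" using c(1) by (simp only: cvs.scale_eq_0_iff of_nat_eq_0_iff) simp
    then have "y * x ^ n = 0" using power_commutes_left[OF commute[OF x(1) y]] by simp
    then show ?thesis by (metis app_endo_simps(1,6))
  qed
  then show ?thesis using v by blast
qed

text \<open>The unital subalgebra generated by a set of endomorphisms.\<close>

inductive_set alg_hull :: "'v::complex_vector endo set \<Rightarrow> 'v endo set" for G where
  gen: "x \<in> G \<Longrightarrow> x \<in> alg_hull G"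
| one: "1 \<in> alg_hull G"
| add: "x \<in> alg_hull G \<Longrightarrow> y \<in> alg_hull G \<Longrightarrow> x + y \<in> alg_hull G"
| scale: "x \<in> alg_hull G \<Longrightarrow> a *\<^sub>C x \<in> alg_hull G"
| mult: "x \<in> alg_hull G \<Longrightarrow> y \<in> alg_hull G \<Longrightarrow> x * y \<in> alg_hull G"

lemma alg_hull_commute_with:
  assumes "\<And>g. g \<in> G \<Longrightarrow> y * g = g * y" "x \<in> alg_hull G"
  shows "y * x = x * y"
  using assms(2)
proof induction
  case (mult x z)
  then show ?case by (metis mult.assoc)
qed (simp_all add: assms(1) algebra_simps)

lemma alg_hull_commute:
  assumes "\<And>g h. g \<in> G \<Longrightarrow> h \<in> G \<Longrightarrow> g * h = h * g" "x \<in> alg_hull G" "y \<in> alg_hull G"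
  shows "x * y = y * x"
proof (rule alg_hull_commute_with[OF _ assms(3)])
  fix g assume "g \<in> G"
  then have "g * x = x * g" by (rule alg_hull_commute_with[OF assms(1) assms(2)])
  then show "x * g = g * x" by simp
qed

lemma alg_hull_comm:
  assumes "\<And>g. g \<in> G \<Longrightarrow> comm y g \<in> alg_hull G" "x \<in> alg_hull G"
  shows "comm y x \<in> alg_hull G"
  using assms(2)
proof induction
  case one
  have "0 *\<^sub>C (1::'a endo) \<in> alg_hull G" by (intro alg_hull.intros)
  then show ?case by (simp add: comm_simps)
qed (use assms(1) in \<open>auto simp: comm_simps intro: alg_hull.intros\<close>)

section \<open>Independent integer vectors and the bilinear form\<close>

text \<open>Linear independence of two integer vectors, expressed by \<open>2\<times>2\<close> minors.\<close>

definition indep :: "int ^ 'n \<Rightarrow> int ^ 'n \<Rightarrow> bool"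
  where "indep m n \<longleftrightarrow> (\<exists>i j. m $ i * n $ j \<noteq> m $ j * n $ i)"

lemma indep_sym: "indep m n \<Longrightarrow> indep n m"
  unfolding indep_def by (metis mult.commute)

lemma indep_nonzero: assumes "indep m n" shows "m \<noteq> 0" "n \<noteq> 0"
  using assms by (auto simp: indep_def)

lemma indep_add_left [simp]:
  "indep (m + n) n \<longleftrightarrow> indep m n" "indep (n + m) n \<longleftrightarrow> indep m n"
  "indep n (m + n) \<longleftrightarrow> indep n m" "indep n (n + m) \<longleftrightarrow> indep n m"
  "indep (m - n) n \<longleftrightarrow> indep m n" "indep (- m) n \<longleftrightarrow> indep m n" "indep m (- n) \<longleftrightarrow> indep m n"
  by (auto simp: indep_def algebra_simps)

lemma exists_indep:
  assumes "CARD('n::finite) \<ge> 2" "(m :: int ^ 'n) \<noteq> 0"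
  shows "\<exists>n. indep m n"
proof -
  obtain i where i: "m $ i \<noteq> 0" using assms(2) by (auto simp: vec_eq_iff)
  obtain j :: 'n where j: "j \<noteq> i"
  proof -
    have "UNIV \<noteq> {i}" using assms(1) by (metis card_1_singleton_iff One_nat_def not_less_eq_eq numeral_2_eq_2 order_refl)
    then show ?thesis using that by blast
  qed
  have "m $ i * axis j 1 $ j \<noteq> m $ j * axis j 1 $ i" using i j by (simp add: axis_def)
  then show ?thesis unfolding indep_def by blast
qed

lemma indep_parallel:
  assumes "\<not> indep m n" "m \<noteq> 0" "n \<noteq> 0" "indep m w"
  shows "indep n w"
proof (rule ccontr)
  assume "\<not> indep n w"
  then have nw: "n $ i * w $ j = n $ j * w $ i" for i j by (simp add: indep_def)
  have mn: "m $ i * n $ j = m $ j * n $ i" for i j using assms(1) by (simp add: indep_def)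
  obtain k where k: "n $ k \<noteq> 0" using assms(3) by (auto simp: vec_eq_iff)
  have "m $ i * w $ j = m $ j * w $ i" for i j
  proof -
    have "n $ k * (n $ k * (m $ i * w $ j)) = (m $ i * n $ k) * (n $ k * w $ j)" by algebra
    also have "\<dots> = (m $ k * n $ i) * (n $ j * w $ k)" by (simp only: mn[of i k] nw[of k j])
    also have "\<dots> = (m $ k * n $ j) * (n $ i * w $ k)" by algebra
    also have "\<dots> = (m $ j * n $ k) * (n $ k * w $ i)" by (simp only: mn[of k j] nw[of i k])
    also have "\<dots> = n $ k * (n $ k * (m $ j * w $ i))" by algebra
    finally show ?thesis using k by simp
  qed
  then show False using assms(4) by (simp add: indep_def)
qed

lemma cvec_more_simps: "cvec (r - s) = cvec r - cvec s" "cvec (- r) = - cvec r"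
  "cvec (k *s r) = of_int k *\<^sub>C cvec r"
  by (simp_all add: cvec_def vec_eq_iff scaleC_vec_def)

lemma dot_more_simps: "dot x (y - z) = dot x y - dot x z" "dot x (- y) = - dot x y" "dot (- x) y = - dot x y"
  by (simp_all add: dot_def algebra_simps sum_subtractf sum_negf)

lemma exists_int_normal:
  assumes "indep s m"
  shows "\<exists>u :: int ^ 'n::finite. dot (cvec u) (cvec s) = 0 \<and> dot (cvec u) (cvec m) \<noteq> 0"
proof -
  obtain i j where ij: "s $ i * m $ j \<noteq> s $ j * m $ i" using assms by (auto simp: indep_def)
  define u :: "int ^ 'n" where "u = s $ i *s axis j 1 - s $ j *s axis i 1"
  have ax: "cvec (axis k 1) = axis k 1" for k :: 'n by (simp add: cvec_simps)
  have d: "dot (cvec u) (cvec x) = of_int (s $ i * x $ j - s $ j * x $ i)" for x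
    by (simp add: u_def cvec_more_simps dot_simps ax dot_axis) (simp add: cvec_def)
  show ?thesis by (rule exI[of _ u]) (use ij in \<open>simp add: d del: of_int_mult of_int_diff\<close>)
qed

lemma exists_normal:
  assumes "indep s m"
  shows "\<exists>u :: complex ^ 'n::finite. dot u (cvec s) = 0 \<and> dot u (cvec m) = 1"
proof -
  obtain u :: "int ^ 'n" where u: "dot (cvec u) (cvec s) = 0" "dot (cvec u) (cvec m) \<noteq> 0"
    using exists_int_normal[OF assms] by blast
  show ?thesis
    by (rule exI[of _ "(1 / dot (cvec u) (cvec m)) *\<^sub>C cvec u"]) (simp add: dot_simps u)
qed

lemma exists_int_normal2:
  assumes "indep s m" "indep s m'"
  shows "\<exists>u :: int ^ 'n::finite. dot (cvec u) (cvec s) = 0 \<and> dot (cvec u) (cvec m) \<noteq> 0 \<and> dot (cvec u) (cvec m') \<noteq> 0"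
proof -
  obtain u where u: "dot (cvec u) (cvec s) = 0" "dot (cvec u) (cvec m) \<noteq> 0"
    using exists_int_normal[OF assms(1)] by blast
  obtain u' where u': "dot (cvec u') (cvec s) = 0" "dot (cvec u') (cvec m') \<noteq> 0"
    using exists_int_normal[OF assms(2)] by blast
  show ?thesis
  proof (cases "dot (cvec u) (cvec m') = 0 \<and> dot (cvec u') (cvec m) = 0")
    case True
    then show ?thesis using u u'
      by (intro exI[of _ "u + u'"]) (simp add: cvec_simps dot_simps)
  next
    case False
    then show ?thesis using u u' by blast
  qed
qed

lemma exists_dot_one:
  assumes "s \<noteq> 0"
  shows "\<exists>u :: complex ^ 'n::finite. dot u (cvec s) = 1"
proof -
  obtain k where k: "s $ k \<noteq> 0" using assms by (auto simp: vec_eq_iff)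
  show ?thesis
    by (rule exI[of _ "(1 / of_int (s $ k)) *\<^sub>C axis k 1"])
      (use k in \<open>simp add: dot_simps dot_axis, simp add: cvec_def\<close>)
qed

lemma dot_sum_neg:
  assumes "r + s = (0 :: int ^ 'n::finite)" "dot u (cvec r) = 0"
  shows "dot u (cvec s) = 0"
proof -
  have "s = - r" using assms(1) by (simp add: eq_neg_iff_add_eq_0 add.commute)
  then show ?thesis using assms(2) by (simp add: cvec_more_simps dot_more_simps)
qed

section \<open>Operators of an irreducible module over the current algebra\<close>

text \<open>The operators \<open>t r b\<close> and \<open>d u r b\<close> by which the elements \<open>t\<^sup>r b\<close> and \<open>D(u, r) b\<close> of the current
  algebra act on an irreducible module, and the weight spaces \<open>V r\<close> of weight \<open>\<Lambda> + r\<close>, of dimension at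
  most \<open>M\<close>. The operators \<open>d u r b\<close> are meaningful only for \<open>(u, r) = 0\<close>.\<close>

locale current_module =
  fixes t :: "int ^ 'n::finite \<Rightarrow> 'b::complex_comm_algebra_1 \<Rightarrow> 'v::complex_vector endo"
    and d :: "complex ^ 'n \<Rightarrow> int ^ 'n \<Rightarrow> 'b \<Rightarrow> 'v endo"
    and V :: "int ^ 'n \<Rightarrow> 'v set" and \<Lambda> :: "complex ^ 'n" and M :: nat
  assumes card_ge_2: "CARD('n) \<ge> 2"
    and t_linear: "clinear (t r)"
    and d_linear: "clinear (d u r)"
    and d_add: "dot u (cvec r) = 0 \<Longrightarrow> dot v (cvec r) = 0 \<Longrightarrow> d (u + v) r b = d u r b + d v r b"
    and d_scale: "dot u (cvec r) = 0 \<Longrightarrow> d (a *\<^sub>C u) r b = a *\<^sub>C d u r b"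
    and t_commute: "t r b * t s b' = t s b' * t r b"
    and comm_dt: "dot u (cvec r) = 0 \<Longrightarrow>
      comm (d u r b) (t s b') = dot u (cvec s) *\<^sub>C t (r + s) (b * b')"
    and comm_dd: "dot u (cvec r) = 0 \<Longrightarrow> dot v (cvec s) = 0 \<Longrightarrow>
      comm (d u r b) (d v s b') = d (dot u (cvec s) *\<^sub>C v - dot v (cvec r) *\<^sub>C u) (r + s) (b * b')"
    and irreducible: "cvs.subspace W \<Longrightarrow> (\<And>r b v. v \<in> W \<Longrightarrow> app (t r b) v \<in> W) \<Longrightarrow>
      (\<And>u r b v. dot u (cvec r) = 0 \<Longrightarrow> v \<in> W \<Longrightarrow> app (d u r b) v \<in> W) \<Longrightarrow> W = {0} \<or> W = UNIV"
    and V_eq: "V r = {v. \<forall>u. app (d u 0 1) v = dot u (\<Lambda> + cvec r) *\<^sub>C v}"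
    and V_finite_dim: "finite_dim (V r)"
    and V_dim: "cvs.dim (V r) \<le> M"
    and V_0: "V 0 \<noteq> {0}"
    and t_nonzero: "\<exists>s. s \<noteq> 0 \<and> t s 1 \<noteq> 0"
    and t_0_nonzero: "t 0 1 \<noteq> 0"
begin

lemma V_subspace: "cvs.subspace (V r)"
  by (auto simp: V_eq cvs.subspace_def app_simps scaleC_add_right scaleC_scaleC mult.commute)

lemma V_exists: "\<exists>v\<in>V 0. v \<noteq> 0"
  using V_0 cvs.subspace_0[OF V_subspace, of 0] by blast

text \<open>Operators that shift the weights by \<open>r\<close>.\<close>

definition homog :: "int ^ 'n \<Rightarrow> 'v endo \<Rightarrow> bool"
  where "homog r x \<longleftrightarrow> (\<forall>q. \<forall>v\<in>V q. app x v \<in> V (q + r))"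

lemma homogI:
  assumes "\<And>u. comm (d u 0 1) x = dot u (cvec r) *\<^sub>C x"
  shows "homog r x"
  unfolding homog_def V_eq
proof safe
  fix q v u assume v: "\<forall>u. app (d u 0 1) v = dot u (\<Lambda> + cvec q) *\<^sub>C v"
  have "app (d u 0 1) (app x v) = app (comm (d u 0 1) x) v + app x (app (d u 0 1) v)"
    by (simp add: comm_def)
  also have "\<dots> = dot u (\<Lambda> + cvec (q + r)) *\<^sub>C app x v"
    by (simp add: assms v[rule_format] app_simps dot_simps cvec_simps scaleC_add_left)
  finally show "app (d u 0 1) (app x v) = dot u (\<Lambda> + cvec (q + r)) *\<^sub>C app x v" .
qed

lemma homog_t: "homog r (t r b)"
  by (rule homogI) (simp add: comm_dt cvec_simps dot_simps)

lemma homog_d: assumes "dot u (cvec r) = 0" shows "homog r (d u r b)"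
proof (rule homogI)
  fix w
  have "comm (d w 0 1) (d u r b) = d (dot w (cvec r) *\<^sub>C u) r b"
    using comm_dd[of w 0 u r 1 b] assms by (simp add: cvec_simps dot_simps)
  then show "comm (d w 0 1) (d u r b) = dot w (cvec r) *\<^sub>C d u r b"
    using d_scale assms by simp
qed

lemma homog_mult: "homog r x \<Longrightarrow> homog s y \<Longrightarrow> homog (r + s) (x * y)"
  by (simp add: homog_def add.commute[of r s] add.assoc[symmetric])

lemma homog_add: "homog r x \<Longrightarrow> homog r y \<Longrightarrow> homog r (x + y)"
  by (simp add: homog_def cvs.subspace_add[OF V_subspace])

lemma homog_diff: "homog r x \<Longrightarrow> homog r y \<Longrightarrow> homog r (x - y)"
  by (simp add: homog_def cvs.subspace_diff[OF V_subspace])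

lemma homog_scale: "homog r x \<Longrightarrow> homog r (a *\<^sub>C x)"
  by (simp add: homog_def cvs.subspace_scale[OF V_subspace])

lemma homog_one: "homog 0 1"
  by (simp add: homog_def)

lemma homog_comm: "homog r x \<Longrightarrow> homog s y \<Longrightarrow> homog (r + s) (comm x y)"
  unfolding comm_def using homog_mult[of r x s y] homog_mult[of s y r x]
  by (simp add: homog_diff add.commute)

text \<open>The sum of the weight spaces \<open>V r\<close> is a nonzero submodule.\<close>

lemma V_span: "cvs.span (\<Union>r. V r) = UNIV"
proof -
  let ?W = "cvs.span (\<Union>r. V r)"
  have stable: "app x v \<in> ?W" if x: "homog r x" and v: "v \<in> ?W" for x r v
  proof -
    have "app x ` (\<Union>r. V r) \<subseteq> (\<Union>r. V r)" using x by (fastforce simp: homog_def)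
    then have "app x ` ?W \<subseteq> ?W"
      unfolding cvs.linear_span_image[OF app_linear, symmetric] by (rule cvs.span_mono)
    then show ?thesis using v by blast
  qed
  have "?W = {0} \<or> ?W = UNIV"
    by (rule irreducible) (auto intro: stable homog_t homog_d)
  moreover obtain v where "v \<in> V 0" "v \<noteq> 0" using V_exists by blast
  then have "?W \<noteq> {0}" using cvs.span_base[of v "\<Union>r. V r"] by blast
  ultimately show ?thesis by blast
qed

lemma endo_eq_0I:
  assumes "\<And>r v. v \<in> V r \<Longrightarrow> app x v = 0"
  shows "x = 0"
proof (rule endo_eqI)
  fix v
  have "v \<in> cvs.span (\<Union>r. V r)" using V_span by simp
  then have "app x v = 0"
    by (rule cvs.linear_eq_0_on_span[OF app_linear, rotated]) (use assms in auto)
  then show "app x v = app 0 v" by simp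
qed

section \<open>Invariant commutative algebras of operators\<close>

text \<open>Commutative subalgebras that contain the operators \<open>t\<^sup>r b\<close> and are stable under the adjoint action
  of the Lie algebra.\<close>

definition inv_comm :: "'v endo set \<Rightarrow> bool"
  where "inv_comm H \<longleftrightarrow> (\<forall>r b. t r b \<in> H) \<and> 1 \<in> H \<and> (\<forall>x\<in>H. \<forall>y\<in>H. x + y \<in> H \<and> x * y \<in> H \<and> x * y = y * x) \<and>
    (\<forall>a. \<forall>x\<in>H. a *\<^sub>C x \<in> H) \<and> (\<forall>u r b. dot u (cvec r) = 0 \<longrightarrow> (\<forall>x\<in>H. comm (d u r b) x \<in> H))"

lemma inv_commD:
  assumes "inv_comm H"
  shows "t r b \<in> H" "1 \<in> H" "x \<in> H \<Longrightarrow> y \<in> H \<Longrightarrow> x + y \<in> H" "x \<in> H \<Longrightarrow> y \<in> H \<Longrightarrow> x * y \<in> H"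
    "x \<in> H \<Longrightarrow> y \<in> H \<Longrightarrow> x * y = y * x" "x \<in> H \<Longrightarrow> a *\<^sub>C x \<in> H"
    "dot u (cvec r) = 0 \<Longrightarrow> x \<in> H \<Longrightarrow> comm (d u r b) x \<in> H"
  using assms unfolding inv_comm_def by blast+

lemma inv_comm_diff:
  assumes "inv_comm H" "x \<in> H" "y \<in> H" shows "x - y \<in> H"
proof -
  have "x + (-1) *\<^sub>C y \<in> H" using assms by (intro inv_commD(3,6)[OF assms(1)])
  then show ?thesis by (simp add: scaleC_one)
qed

lemma inv_comm_alg_hull:
  assumes t: "\<And>r b. t r b \<in> G" and comm: "\<And>g h. g \<in> G \<Longrightarrow> h \<in> G \<Longrightarrow> g * h = h * g"
    and inv: "\<And>u r b g. dot u (cvec r) = 0 \<Longrightarrow> g \<in> G \<Longrightarrow> comm (d u r b) g \<in> alg_hull G"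
  shows "inv_comm (alg_hull G)"
  unfolding inv_comm_def
proof (intro conjI allI ballI impI)
  fix x y assume "x \<in> alg_hull G" "y \<in> alg_hull G"
  then show "x * y = y * x" using alg_hull_commute[of G x y] comm by blast
next
  fix u :: "complex ^ 'n" and r b x assume "dot u (cvec r) = 0" "x \<in> alg_hull G"
  then show "comm (d u r b) x \<in> alg_hull G" using alg_hull_comm[of G "d u r b" x] inv by blast
qed (auto intro: alg_hull.intros t)

lemma comm_dt_in_hull: "dot u (cvec r) = 0 \<Longrightarrow> comm (d u r b) (t s b') \<in> alg_hull (range (case_prod t) \<union> G)"
  unfolding comm_dt by (intro alg_hull.scale alg_hull.gen) (auto intro: range_eqI[of _ _ "(r + s, b * b')"])

lemma inv_comm_t: "inv_comm (alg_hull (range (case_prod t)))"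
proof (rule inv_comm_alg_hull)
  show "t r b \<in> range (case_prod t)" for r b by (rule range_eqI[of _ _ "(r, b)"]) simp
  show "g * h = h * g" if "g \<in> range (case_prod t)" "h \<in> range (case_prod t)" for g h
    using that by (auto simp: t_commute)
  show "comm (d u r b) g \<in> alg_hull (range (case_prod t))"
    if "dot u (cvec r) = 0" "g \<in> range (case_prod t)" for u :: "complex ^ 'n" and r b g
    using that comm_dt_in_hull[of u r b _ _ "{}"] by auto
qed

text \<open>The generalised null space of an element of such an algebra is a submodule, as the commutators of
  the element with the operators of the module commute with it.\<close>

lemma gen_null_space:
  assumes H: "inv_comm H" and x: "x \<in> H" and v: "v \<noteq> 0" "app (x ^ n) v = 0"
  shows "\<exists>n. app (x ^ n) w = 0"
proof -
  let ?W = "{v. \<exists>n. app (x ^ n) v = 0}"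
  have mono: "app (x ^ m) v = 0" if "app (x ^ n) v = 0" "n \<le> m" for m n v
  proof -
    have "x ^ m = x ^ (m - n) * x ^ n" using that(2) by (simp flip: power_add)
    then show ?thesis using that(1) by (simp add: app_simps)
  qed
  have sub: "cvs.subspace ?W"
    unfolding cvs.subspace_def
  proof safe
    show "\<exists>n. app (x ^ n) 0 = 0" by (simp add: app_simps)
  next
    fix v w m n assume "app (x ^ m) v = 0" "app (x ^ n) w = 0"
    then have "app (x ^ (max m n)) (v + w) = 0" using mono[of _ _ "max m n"] by (simp add: app_simps)
    then show "\<exists>n. app (x ^ n) (v + w) = 0" ..
  next
    fix a v n assume "app (x ^ n) v = 0"
    then show "\<exists>n. app (x ^ n) (a *\<^sub>C v) = 0" by (intro exI[of _ n]) (simp add: app_simps)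
  qed
  have stable: "app g v \<in> ?W" if c: "x * comm g x = comm g x * x" and v: "v \<in> ?W" for g v
  proof -
    obtain n where n: "app (x ^ n) v = 0" using v by blast
    have "x ^ Suc n * g = g * x ^ Suc n - comm g (x ^ Suc n)" by (simp add: comm_def)
    also have "\<dots> = g * (x * x ^ n) - of_nat (Suc n) *\<^sub>C (comm g x * x ^ n)"
      unfolding comm_power[OF c] by (simp add: power_commutes_left[OF c])
    finally have "app (x ^ Suc n) (app g v) = 0"
      using n by (metis (no_types, lifting) app_endo_simps(4,6,7) app_simps(5) cvs.scale_zero_right diff_zero)
    then show ?thesis by blast
  qed
  have "?W = {0} \<or> ?W = UNIV"
  proof (rule irreducible[OF sub])
    fix r b v assume v: "v \<in> ?W"
    have "comm (t r b) x = 0" using inv_commD(5)[OF H inv_commD(1)[OF H] x] by (simp add: comm_eq_0_iff)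
    then show "app (t r b) v \<in> ?W" using stable v by simp
  next
    fix u :: "complex ^ 'n" and r b v assume u: "dot u (cvec r) = 0" and v: "v \<in> ?W"
    show "app (d u r b) v \<in> ?W"
      by (rule stable[OF inv_commD(5)[OF H x inv_commD(7)[OF H u x]] v])
  qed
  moreover have "v \<in> ?W" using v by blast
  ultimately have "?W = UNIV" using v by blast
  then show ?thesis by blast
qed

text \<open>An operator of degree 0 has an eigenvalue \<open>a\<close> on \<open>V 0\<close>. The generalised eigenspace is the whole module,
  and the bound on the dimensions gives a common exponent.\<close>

lemma degree_0_nilpotent:
  assumes H: "inv_comm H" and z: "z \<in> H" "homog 0 z"
  shows "\<exists>a. (z - a *\<^sub>C 1) ^ M = 0"
proof -
  obtain v where v: "v \<in> V 0" "v \<noteq> 0" using V_exists by blast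
  have "app z ` V 0 \<subseteq> V 0" using z(2) by (fastforce simp: homog_def)
  from eigenvector_exists[OF app_linear V_subspace V_finite_dim this v]
  obtain w a where w: "w \<noteq> 0" "app z w = a *\<^sub>C w" by blast
  let ?x = "z - a *\<^sub>C 1"
  have xH: "?x \<in> H" by (intro inv_comm_diff inv_commD(2,6) H z)
  have "app (?x ^ 1) w = 0" using w by simp
  note nil = gen_null_space[OF H xH w(1) this]
  have hom: "homog 0 ?x" by (intro homog_diff homog_scale homog_one z)
  have "?x ^ M = 0"
  proof (rule endo_eq_0I)
    fix r v assume v: "v \<in> V r"
    obtain n where n: "app (?x ^ n) v = 0" using nil by blast
    have "app ?x ` V r \<subseteq> V r" using hom unfolding homog_def by fastforce
    from nilpotent_exponent[OF V_finite_dim V_dim this v n] show "app (?x ^ M) v = 0" .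
  qed
  then show ?thesis by blast
qed

text \<open>The common null space of the homogeneous nilpotent elements is a submodule. It is nonzero: those of
  degree 0 have a common null vector in \<open>V 0\<close>, and \<open>t\<^sup>-\<^sup>r\<close> moves those of degree \<open>r\<close> to degree 0.\<close>

lemma homog_nilpotent_zero:
  assumes H: "inv_comm H" and inj: "\<And>r v. r \<noteq> 0 \<Longrightarrow> app (t r 1) v = 0 \<Longrightarrow> v = 0"
    and x: "x \<in> H" "homog r x" "x ^ k = 0"
  shows "x = 0"
proof -
  define Z where "Z = {x \<in> H. (\<exists>r. homog r x) \<and> (\<exists>k. x ^ k = 0)}"
  let ?W = "{v. \<forall>x\<in>Z. app x v = 0}"
  have "?W = {0} \<or> ?W = UNIV"
  proof (rule irreducible)
    show "cvs.subspace ?W" by (auto simp: cvs.subspace_def app_simps)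
  next
    fix r b v assume v: "v \<in> ?W"
    have "x * t r b = t r b * x" if "x \<in> Z" for x
      using that inv_commD(5)[OF H _ inv_commD(1)[OF H]] by (simp add: Z_def)
    then have "app x (app (t r b) v) = app (t r b) (app x v)" if "x \<in> Z" for x
      using that by (metis app_endo_simps(6))
    then show "app (t r b) v \<in> ?W" using v by (simp add: app_simps)
  next
    fix u :: "complex ^ 'n" and s b v assume u: "dot u (cvec s) = 0" and v: "v \<in> ?W"
    have "app x (app (d u s b) v) = 0" if x: "x \<in> Z" for x
    proof -
      obtain r k where xr: "x \<in> H" "homog r x" "x ^ k = 0" using x unfolding Z_def by blast
      let ?c = "comm (d u s b) x"
      have c1: "?c \<in> H" by (rule inv_commD(7)[OF H u xr(1)])
      have c: "?c \<in> H" "comm (d u s b) ?c \<in> H" by (rule c1, rule inv_commD(7)[OF H u c1])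
      have "homog (s + r) ?c" using homog_comm[OF homog_d[OF u] xr(2)] .
      moreover have "?c ^ (2 * k) = 0"
        by (rule nilpotent_comm[OF xr(3)]) (intro inv_commD(5)[OF H] xr c)+
      ultimately have "?c \<in> Z" using c unfolding Z_def by blast
      then have "app ?c v = 0" "app x v = 0" using v x by auto
      then show ?thesis by (simp add: comm_def app_simps)
    qed
    then show "app (d u s b) v \<in> ?W" by blast
  qed
  moreover have "\<exists>v\<in>?W. v \<noteq> 0"
  proof -
    let ?F = "app ` {x \<in> Z. homog 0 x}"
    have "\<exists>v\<in>V 0. v \<noteq> 0 \<and> (\<forall>f\<in>?F. \<exists>a. f v = a *\<^sub>C v)"
    proof (rule common_eigenvector[OF V_subspace V_finite_dim V_0])
      fix f assume "f \<in> ?F"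
      then show "clinear f" "f ` V 0 \<subseteq> V 0" by (auto simp: app_linear homog_def)
    next
      fix f g w assume "f \<in> ?F" "g \<in> ?F"
      then obtain x y where xy: "f = app x" "g = app y" "x \<in> H" "y \<in> H" unfolding Z_def by blast
      have "app (x * y) w = app (y * x) w" using inv_commD(5)[OF H xy(3,4)] by simp
      then show "f (g w) = g (f w)" using xy by simp
    qed
    then obtain v where v: "v \<noteq> 0" and eig: "\<And>x. x \<in> Z \<Longrightarrow> homog 0 x \<Longrightarrow> \<exists>a. app x v = a *\<^sub>C v"
      by auto
    have z0: "app x v = 0" if x: "x \<in> Z" "homog 0 x" for x
    proof -
      obtain a where a: "app x v = a *\<^sub>C v" using eig[OF x] by blast
      obtain k where k: "x ^ k = 0" using x unfolding Z_def by blast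
      have "app (x ^ k) v = a ^ k *\<^sub>C v" for k
        by (induction k) (simp_all add: a app_simps scaleC_scaleC scaleC_one mult.commute)
      from this[of k] have "a ^ k *\<^sub>C v = 0" using k by simp
      then have "a = 0" using v by simp
      then show ?thesis using a by simp
    qed
    have "app x v = 0" if x: "x \<in> Z" for x
    proof -
      obtain r k where xr: "x \<in> H" "homog r x" "x ^ k = 0" using x unfolding Z_def by blast
      have tH: "t (- r) 1 \<in> H" by (rule inv_commD(1)[OF H])
      have "homog 0 (t (- r) 1 * x)" using homog_mult[OF homog_t[of "- r" 1] xr(2)] by simp
      moreover have "(t (- r) 1 * x) ^ k = 0"
        by (rule nilpotent_mult(2)[OF inv_commD(5)[OF H xr(1) tH] xr(3)])
      ultimately have "t (- r) 1 * x \<in> Z" "homog 0 (t (- r) 1 * x)"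
        using inv_commD(4)[OF H tH xr(1)] unfolding Z_def by blast+
      then have "app (t (- r) 1) (app x v) = 0" using z0 by (metis app_endo_simps(6))
      then show ?thesis using inj[of "- r" "app x v"] z0[OF x] xr(2) by (cases "r = 0") auto
    qed
    then show ?thesis using v by blast
  qed
  ultimately have "?W = UNIV" by blast
  moreover have "x \<in> Z" using x unfolding Z_def by blast
  ultimately have "app x v = 0" for v by blast
  then show ?thesis by (intro endo_eqI) simp
qed

lemma degree_0_scalar:
  assumes H: "inv_comm H" and inj: "\<And>r v. r \<noteq> 0 \<Longrightarrow> app (t r 1) v = 0 \<Longrightarrow> v = 0"
    and z: "z \<in> H" "homog 0 z"
  shows "\<exists>a. z = a *\<^sub>C 1"
proof -
  obtain a where "(z - a *\<^sub>C 1) ^ M = 0" using degree_0_nilpotent[OF H z] by blast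
  moreover have "z - a *\<^sub>C 1 \<in> H" by (intro inv_comm_diff inv_commD(2,6) H z)
  moreover have "homog 0 (z - a *\<^sub>C 1)" by (intro homog_diff homog_scale homog_one z)
  ultimately have "z - a *\<^sub>C 1 = 0"
    by (intro homog_nilpotent_zero[OF H, of "z - a *\<^sub>C 1" 0 M]) (use inj in auto)
  then show ?thesis by auto
qed

section \<open>Injectivity of the monomials\<close>

text \<open>The span of the operators \<open>D(u, r) b\<close>, and the span of the operators \<open>t\<^sup>n b\<close> with \<open>n \<in> A\<close>.\<close>

definition d_span :: "'v endo set"
  where "d_span = cvs.span {d u r b | u r b. dot u (cvec r) = 0}"

lemma comm_d_span:
  assumes H: "inv_comm H" and y: "y \<in> d_span" and x: "x \<in> H"
  shows "comm y x \<in> H"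
  using y unfolding d_span_def
proof (induction rule: cvs.span_induct_alt)
  case base
  have "0 *\<^sub>C x \<in> H" by (rule inv_commD(6)[OF H x])
  then show ?case by (simp add: comm_simps)
next
  case (step c g y)
  then show ?case by (auto simp: comm_simps intro: inv_commD(3,6)[OF H] inv_commD(7)[OF H _ x])
qed

definition t_span :: "(int ^ 'n) set \<Rightarrow> 'v endo set"
  where "t_span A = cvs.span {t n b | n b. n \<in> A}"

lemma t_span_in:
  assumes H: "inv_comm H" and y: "y \<in> t_span A" shows "y \<in> H"
  using y unfolding t_span_def
proof (induction rule: cvs.span_induct_alt)
  case base
  have "0 *\<^sub>C 1 \<in> H" by (intro inv_commD(2,6)[OF H])
  then show ?case by simp
next
  case (step c g y)
  then show ?case using inv_commD(1,3,6)[OF H] by blast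
qed

text \<open>If \<open>n\<close> and \<open>m\<close> are independent, then \<open>t\<^sup>n b = [D(u, n - m) b, t\<^sup>m]\<close> for a vector \<open>u\<close> with
  \<open>(u, n - m) = 0\<close> and \<open>(u, m) = 1\<close>.\<close>

lemma t_span_lift:
  assumes "y \<in> t_span {n. indep n m}"
  shows "\<exists>w\<in>d_span. comm w (t m 1) = y"
  using assms unfolding t_span_def
proof (induction rule: cvs.span_induct_alt)
  case base
  show ?case by (rule bexI[of _ 0]) (simp_all add: comm_simps d_span_def cvs.span_zero)
next
  case (step c g y)
  then obtain w where w: "w \<in> d_span" "comm w (t m 1) = y" by blast
  from step obtain n b where g: "g = t n b" "indep n m" by blast
  then obtain u where u: "dot u (cvec (n - m)) = 0" "dot u (cvec m) = 1"
    using exists_normal[of "n - m" m] by auto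
  have "d u (n - m) b \<in> d_span" unfolding d_span_def using u by (intro cvs.span_base) blast
  then have "c *\<^sub>C d u (n - m) b + w \<in> d_span"
    using w(1) unfolding d_span_def by (intro cvs.span_add cvs.span_scale)
  moreover have "comm (c *\<^sub>C d u (n - m) b + w) (t m 1) = c *\<^sub>C g + y"
    by (simp add: comm_simps w(2) comm_dt[OF u(1)] u(2) g scaleC_one)
  ultimately show ?case by blast
qed

text \<open>If \<open>z = t\<^sup>m t\<^sup>-\<^sup>m\<close> is nilpotent and \<open>y\<close> is a combination of operators \<open>t\<^sup>n b\<close> with \<open>n\<close> independent of \<open>m\<close>,
  then \<open>y\<close> is a commutator with \<open>t\<^sup>m\<close> as well as with \<open>t\<^sup>-\<^sup>m\<close>. Differentiating \<open>z\<close> accordingly shows that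
  \<open>t\<^sup>m y\<close> is nilpotent, and differentiating \<open>t\<^sup>m y\<close> shows that \<open>y\<close> is nilpotent, of an order not
  depending on \<open>y\<close>.\<close>

lemma uniformly_nilpotent:
  assumes nil: "(t m 1 * t (- m) 1) ^ k = 0"
  shows "\<exists>K. \<forall>y \<in> t_span {n. indep n m}. y ^ K = 0"
proof -
  define H where "H = alg_hull (range (case_prod t))"
  have H: "inv_comm H" unfolding H_def by (rule inv_comm_t)
  note Ht = inv_commD(1)[OF H] and Hm = inv_commD(4)[OF H] and cH = inv_commD(5)[OF H]
  let ?p = "t m 1" and ?q = "t (- m) 1"
  have dnil: "comm w x ^ (2 * n) = 0" if "w \<in> d_span" "x \<in> H" "x ^ n = 0" for w x n
    using that by (intro nilpotent_comm cH comm_d_span[OF H])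
  have "y ^ (3 * (2 * (2 * (2 * k + k)) + 2 * (2 * k + k))) = 0"
    if y: "y \<in> t_span {n. indep n m}" for y
  proof -
    have yH: "y \<in> H" using t_span_in[OF H y] .
    have "y \<in> t_span {n. indep n (- m)}" using y by simp
    then obtain w where w: "w \<in> d_span" "comm w ?q = y" using t_span_lift by blast
    obtain w' where w': "w' \<in> d_span" "comm w' ?p = y" using t_span_lift[OF y] by blast
    let ?z = "?p * ?q"
    have X: "comm w ?p \<in> H" using comm_d_span[OF H w(1) Ht] .
    have dz: "comm w ?z = comm w ?p * ?q + ?p * y" by (simp add: comm_simps w(2))
    have dz0: "comm w ?z ^ (2 * k) = 0" by (rule dnil[OF w(1) Hm[OF Ht Ht] nil])
    have dzH: "comm w ?z \<in> H" by (rule comm_d_span[OF H w(1) Hm[OF Ht Ht]])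
    have "?p * comm w ?z = ?z * comm w ?p + ?p * ?p * y"
      unfolding dz using cH[OF X Ht] by (simp add: distrib_left mult.assoc)
    then have ppy: "?p * ?p * y = ?p * comm w ?z - ?z * comm w ?p" by simp
    have "(?p * ?p * y) ^ (2 * k + k) = 0"
      unfolding ppy
    proof (rule nilpotent_diff)
      show "(?p * comm w ?z) ^ (2 * k) = 0" by (rule nilpotent_mult(2)[OF cH[OF dzH Ht] dz0])
      show "(?z * comm w ?p) ^ k = 0" by (rule nilpotent_mult(1)[OF cH[OF Hm[OF Ht Ht] X] nil])
    qed (intro cH Hm Ht X dzH)
    then have "(?p * ?p * y * y) ^ (2 * k + k) = 0"
      by (rule nilpotent_mult(1)[rotated]) (intro cH Hm Ht yH)
    moreover have "?p * ?p * y * y = (?p * y) ^ 2"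
    proof -
      have "?p * ?p * y * y = ?p * (?p * y) * y" by (simp add: mult.assoc)
      also have "\<dots> = ?p * (y * ?p) * y" using cH[OF Ht yH] by simp
      finally show ?thesis by (simp add: power2_eq_square mult.assoc)
    qed
    ultimately have py: "(?p * y) ^ (2 * (2 * k + k)) = 0" by (simp add: power_mult)
    let ?w = "?p * y"
    have wH: "?w \<in> H" by (intro Hm Ht yH)
    have Y': "comm w' y \<in> H" by (rule comm_d_span[OF H w'(1) yH])
    have dw: "comm w' ?w = y * y + ?p * comm w' y" by (simp add: comm_simps w'(2))
    have dw0: "comm w' ?w ^ (2 * (2 * (2 * k + k))) = 0" by (rule dnil[OF w'(1) wH py])
    have dwH: "comm w' ?w \<in> H" by (rule comm_d_span[OF H w'(1) wH])
    have "y * comm w' ?w = y ^ 3 + ?w * comm w' y"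
      unfolding dw using cH[OF yH Ht]
      by (simp add: distrib_left power3_eq_cube mult.assoc[symmetric])
    then have y3: "y ^ 3 = y * comm w' ?w - ?w * comm w' y" by simp
    have "(y ^ 3) ^ (2 * (2 * (2 * k + k)) + 2 * (2 * k + k)) = 0"
      unfolding y3
    proof (rule nilpotent_diff)
      show "(y * comm w' ?w) ^ (2 * (2 * (2 * k + k))) = 0"
        by (rule nilpotent_mult(2)[OF cH[OF dwH yH] dw0])
      show "(?w * comm w' y) ^ (2 * (2 * k + k)) = 0"
        by (rule nilpotent_mult(1)[OF cH[OF wH Y'] py])
    qed (intro cH Hm yH wH Y' dwH)
    then show ?thesis by (simp add: power_mult)
  qed
  then show ?thesis by blast
qed

text \<open>If some \<open>t\<^sup>r\<close> with \<open>r \<noteq> 0\<close> is not injective, then the span of all \<open>t\<^sup>n b\<close> with \<open>n \<noteq> 0\<close> is uniformly nilpotent. It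
  then has a common null vector; its common null space is a submodule, so that all these operators
  vanish.\<close>

lemma t_injective:
  assumes "r \<noteq> 0" "app (t r 1) v = 0"
  shows "v = 0"
proof (rule ccontr)
  assume v: "v \<noteq> 0"
  define H where "H = alg_hull (range (case_prod t))"
  have H: "inv_comm H" unfolding H_def by (rule inv_comm_t)
  note Ht = inv_commD(1)[OF H] and Hm = inv_commD(4)[OF H] and cH = inv_commD(5)[OF H]
  have "t r 1 * t (- r) 1 \<in> H" by (intro Hm Ht)
  moreover have "homog 0 (t r 1 * t (- r) 1)" using homog_mult[OF homog_t[of r 1] homog_t[of "- r" 1]] by simp
  ultimately obtain a where a: "(t r 1 * t (- r) 1 - a *\<^sub>C 1) ^ M = 0"
    using degree_0_nilpotent[OF H] by blast
  have "app ((t r 1 * t (- r) 1 - a *\<^sub>C 1) ^ k) v = (- a) ^ k *\<^sub>C v" for k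
  proof (induction k)
    case (Suc k)
    have "app (t r 1 * t (- r) 1) v = 0"
      unfolding t_commute[of r] using assms(2) by (simp add: app_simps)
    then show ?case
      unfolding power_Suc2 by (simp add: Suc app_simps scaleC_scaleC mult.commute)
  qed (simp add: scaleC_one)
  from this[of M] have "(- a) ^ M *\<^sub>C v = 0" by (simp add: a)
  then have "a = 0" using v by simp
  \<comment> \<open>the eigenvalue is 0 as the product is not injective\<close>
  then have nil: "(t r 1 * t (- r) 1) ^ M = 0" using a by simp
  obtain K where K: "\<And>y. y \<in> t_span {n. indep n r} \<Longrightarrow> y ^ K = 0"
    using uniformly_nilpotent[OF nil] by blast
  \<comment> \<open>the exponents parallel to \<open>r\<close> are covered by a second direction\<close>
  obtain s where s: "indep r s" using exists_indep[OF card_ge_2 assms(1)] by blast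
  have "t s 1 \<in> t_span {n. indep n r}"
    unfolding t_span_def using indep_sym[OF s] by (intro cvs.span_base) blast
  then have "(t s 1 * t (- s) 1) ^ K = 0"
    by (intro nilpotent_mult(1)[OF t_commute] K)
  then obtain K' where K': "\<And>y. y \<in> t_span {n. indep n s} \<Longrightarrow> y ^ K' = 0"
    using uniformly_nilpotent by blast
  have "y ^ (K + K') = 0" if "y \<in> t_span {n. n \<noteq> 0}" for y
  proof -
    have "{t n b |n b. n \<in> {n. n \<noteq> 0}} \<subseteq> {t n b |n b. n \<in> {n. indep n r}} \<union> {t n b |n b. n \<in> {n. indep n s}}"
      using indep_parallel[OF _ assms(1) _ s] indep_sym by blast
    then have "y \<in> cvs.span ({t n b |n b. n \<in> {n. indep n r}} \<union> {t n b |n b. n \<in> {n. indep n s}})"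
      using that cvs.span_mono unfolding t_span_def by blast
    then obtain x z where y: "y = x + z" and x: "x \<in> t_span {n. indep n r}" and z: "z \<in> t_span {n. indep n s}"
      unfolding cvs.span_Un t_span_def by blast
    show ?thesis unfolding y
      by (rule nilpotent_add[OF cH[OF t_span_in[OF H x] t_span_in[OF H z]] K[OF x] K'[OF z]])
  qed
  then have "\<exists>v\<noteq>0. \<forall>y\<in>t_span {n. n \<noteq> 0}. app y v = 0"
  proof (rule common_null_vector[rotated 2])
    show "cvs.subspace (t_span {n. n \<noteq> 0})" unfolding t_span_def by (rule cvs.subspace_span)
    show "x * y = y * x" if "x \<in> t_span {n. n \<noteq> 0}" "y \<in> t_span {n. n \<noteq> 0}" for x y
      by (rule cH[OF t_span_in[OF H that(1)] t_span_in[OF H that(2)]])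
    show "\<exists>v::'v. v \<noteq> 0" using v by blast
  qed
  then obtain w where w: "w \<noteq> 0" "\<And>y. y \<in> t_span {n. n \<noteq> 0} \<Longrightarrow> app y w = 0" by blast
  let ?W = "{v. \<forall>n b. n \<noteq> 0 \<longrightarrow> app (t n b) v = 0}"
  have "?W = {0} \<or> ?W = UNIV"
  proof (rule irreducible)
    show "cvs.subspace ?W" by (auto simp: cvs.subspace_def app_simps)
  next
    fix s b v assume v: "v \<in> ?W"
    have "app (t n b') (app (t s b) v) = app (t s b) (app (t n b') v)" for n b'
      by (metis app_endo_simps(6) t_commute)
    then show "app (t s b) v \<in> ?W" using v by (simp add: app_simps)
  next
    fix u :: "complex ^ 'n" and s b v assume u: "dot u (cvec s) = 0" and v: "v \<in> ?W"
    have "app (t n b') (app (d u s b) v) = 0" if n: "n \<noteq> 0" for n b'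
    proof -
      have "app (comm (d u s b) (t n b')) v = 0"
        unfolding comm_dt[OF u] using v dot_sum_neg[OF _ u, of n] by (cases "s + n = 0") auto
      then show ?thesis using v n by (simp add: comm_def app_simps)
    qed
    then show "app (d u s b) v \<in> ?W" by blast
  qed
  moreover have wW: "w \<in> ?W"
  proof safe
    fix n :: "int ^ 'n" and b assume "n \<noteq> 0"
    then have "t n b \<in> t_span {n. n \<noteq> 0}" unfolding t_span_def by (intro cvs.span_base) blast
    then show "app (t n b) w = 0" by (rule w(2))
  qed
  moreover have "?W \<noteq> {0}"
  proof
    assume eq: "?W = {0}"
    have "w \<in> {0}" by (subst eq[symmetric]) (rule wW)
    then show False using w(1) by simp
  qed
  ultimately have eq: "?W = UNIV" by simp
  have "app (t n b) v = 0" if "n \<noteq> 0" for n b v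
  proof -
    have "v \<in> ?W" by (subst eq) simp
    then show ?thesis using that by simp
  qed
  then have "t n b = 0" if "n \<noteq> 0" for n b using that by (intro endo_eqI) simp
  then show False using t_nonzero by blast
qed

end

section \<open>Scalar action of the algebra of coefficients on monomials\<close>

text \<open>A space of endomorphisms that are determined by their values on a finite set of vectors, these
  values lying in a finite-dimensional space.\<close>

lemma finite_dim_endos:
  assumes "finite S" "cvs.subspace G" "finite_dim W"
    and "\<And>y v. y \<in> G \<Longrightarrow> v \<in> S \<Longrightarrow> app y v \<in> W"
    and "\<And>y. y \<in> G \<Longrightarrow> (\<And>v. v \<in> S \<Longrightarrow> app y v = 0) \<Longrightarrow> y = 0"
  shows "finite_dim G"
  using assms
proof (induction S arbitrary: G rule: finite_induct)
  case empty
  then have "G \<subseteq> cvs.span {}" by auto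
  then show ?case unfolding finite_dim_def by blast
next
  case (insert v S)
  have lin: "clinear (\<lambda>y. app y v)" by (rule clinearI) simp_all
  show ?case
  proof (rule finite_dim_image_kernel[OF lin insert.prems(1)])
    have "(\<lambda>y. app y v) ` G \<subseteq> W" using insert.prems(3) by auto
    then show "finite_dim ((\<lambda>y. app y v) ` G)" by (rule finite_dim_subset[OF insert.prems(2)])
    show "finite_dim {y \<in> G. app y v = 0}"
    proof (rule insert.IH[OF _ insert.prems(2)])
      show "cvs.subspace {y \<in> G. app y v = 0}"
        using insert.prems(1) by (auto simp: cvs.subspace_def)
      show "y = 0" if "y \<in> {y \<in> G. app y v = 0}" "\<And>v. v \<in> S \<Longrightarrow> app y v = 0" for y
        by (rule insert.prems(4)) (use that in auto)
    qed (use insert.prems(3) in auto)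
  qed
qed

lemma additive_int_scale:
  fixes f :: "int ^ 'n \<Rightarrow> complex"
  assumes add: "\<And>m n. f (m + n) = f m + f n"
  shows "f (j *s m) = of_int j * f m"
proof -
  have f0: "f 0 = 0" using add[of 0 0] by simp
  show ?thesis
  proof (induction j rule: int_induct[where k = 0])
    case base
    show ?case by (simp add: f0)
  next
    case (step1 j)
    have "f ((j + 1) *s m) = f (j *s m) + f m"
      unfolding add[symmetric] by (rule arg_cong[of _ _ f]) (simp add: vec_eq_iff algebra_simps)
    then show ?case using step1 by (simp add: algebra_simps)
  next
    case (step2 j)
    have "j *s m = (j - 1) *s m + m" by (simp add: vec_eq_iff algebra_simps)
    then have "f (j *s m) = f ((j - 1) *s m) + f m" using add by metis
    then show ?case using step2 by (simp add: algebra_simps)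
  qed
qed

lemma dot_cvec: "dot (cvec u) (cvec m) = of_int (\<Sum>i\<in>UNIV. u $ i * m $ i)"
  by (simp add: dot_def cvec_def)

context current_module
begin

lemma endo_one_nonzero: "(1 :: 'v endo) \<noteq> 0"
  using t_0_nonzero by (metis mult_1 mult_zero_left)

lemma degree_0_scalar':
  assumes "inv_comm H" "z \<in> H" "homog 0 z"
  shows "\<exists>a. z = a *\<^sub>C 1"
  by (rule degree_0_scalar[OF assms(1) t_injective assms(2,3)])

lemma t_0_scalar: "\<exists>a. t 0 b = a *\<^sub>C 1"
  by (rule degree_0_scalar'[OF inv_comm_t inv_commD(1)[OF inv_comm_t] homog_t])

lemma ex_c: "\<exists>c. t 0 1 = c *\<^sub>C 1 \<and> c \<noteq> 0"
  using t_0_scalar[of 1] t_0_nonzero by auto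

lemma t_injective':
  assumes "app (t r 1) v = 0"
  shows "v = 0"
proof (cases "r = 0")
  case True
  obtain c where "t 0 1 = c *\<^sub>C 1" "c \<noteq> 0" using ex_c by blast
  then show ?thesis using assms True by simp
qed (use t_injective assms in blast)

lemma t_mult_eq_0: assumes "t r 1 * x = 0" shows "x = 0"
proof (rule endo_eqI)
  fix v
  have "app (t r 1) (app x v) = 0" using assms by (metis app_endo_simps(1,6))
  then show "app x v = app 0 v" using t_injective' by simp
qed

lemma t_cancel: assumes "t r 1 * x = t r 1 * y" shows "x = y"
  using t_mult_eq_0[of r "x - y"] assms by (simp add: right_diff_distrib)

lemma t_nonzero': "t r 1 \<noteq> 0"
  using t_mult_eq_0[of r 1] endo_one_nonzero by auto

lemma t_scale_eq_iff: "a *\<^sub>C t r 1 = b *\<^sub>C t r 1 \<longleftrightarrow> a = b"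
  using t_nonzero' by simp

text \<open>The homogeneous elements of degree \<open>r\<close> of an invariant commutative algebra are the multiples of \<open>t\<^sup>r\<close>.\<close>

lemma homog_scalar:
  assumes H: "inv_comm H" and x: "x \<in> H" "homog r x"
  shows "\<exists>a. x = a *\<^sub>C t r 1"
proof -
  note Ht = inv_commD(1)[OF H]
  have "homog 0 (t (- r) 1 * x)" "homog 0 (t (- r) 1 * t r 1)"
    using homog_mult[OF homog_t[of "- r" 1]] x(2) homog_t[of r 1] by fastforce+
  then obtain a a' where a: "t (- r) 1 * x = a *\<^sub>C 1" and a': "t (- r) 1 * t r 1 = a' *\<^sub>C 1"
    using degree_0_scalar'[OF H] inv_commD(4)[OF H Ht] x(1) Ht by meson
  have "a' \<noteq> 0"
  proof
    assume "a' = 0"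
    then have "t (- r) 1 * t r 1 = 0" using a' by simp
    then show False using t_mult_eq_0 t_nonzero' by blast
  qed
  then have "t (- r) 1 * x = t (- r) 1 * ((a / a') *\<^sub>C t r 1)"
    by (simp add: a a' scaleC_scaleC)
  then show ?thesis using t_cancel by blast
qed

lemma t_scalar: "\<exists>a. t r b = a *\<^sub>C t r 1"
  by (rule homog_scalar[OF inv_comm_t inv_commD(1)[OF inv_comm_t] homog_t])

text \<open>The scalar by which the central element \<open>t\<^sup>0\<close> acts.\<close>

definition c_const :: complex where "c_const = (SOME c. t 0 1 = c *\<^sub>C 1)"

lemma c_const: "t 0 1 = c_const *\<^sub>C 1" "c_const \<noteq> 0"
proof -
  show "t 0 1 = c_const *\<^sub>C 1"
    unfolding c_const_def by (rule someI_ex) (use ex_c in blast)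
  then show "c_const \<noteq> 0" using t_0_nonzero by auto
qed

text \<open>The linear functional \<open>\<phi>\<close> with \<open>t\<^sup>0 b = \<phi>(b) t\<^sup>0\<close>.\<close>

definition phi :: "'b \<Rightarrow> complex" where "phi b = (SOME a. t 0 b = a *\<^sub>C t 0 1)"

lemma phi: "t 0 b = phi b *\<^sub>C t 0 1"
  unfolding phi_def by (rule someI_ex) (rule t_scalar)

lemma phi_linear: "clinear phi"
proof (rule clinearI)
  fix x y a
  have "phi (x + y) *\<^sub>C t 0 1 = (phi x + phi y) *\<^sub>C t 0 1"
    by (simp add: phi[symmetric] scaleC_add_left cvs.linear_add[OF t_linear])
  then show "phi (x + y) = phi x + phi y" by (simp only: t_scale_eq_iff)
  have "phi (a *\<^sub>C x) *\<^sub>C t 0 1 = (a * phi x) *\<^sub>C t 0 1"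
    by (simp add: phi[symmetric] scaleC_scaleC[symmetric] cvs.linear_scale[OF t_linear])
  then show "phi (a *\<^sub>C x) = a *\<^sub>C phi x" by (simp only: t_scale_eq_iff scaleC_complex_def)
qed

lemma phi_one: "phi 1 = 1"
  using phi[of 1] t_scale_eq_iff[of 1 0] by (simp add: scaleC_one)

lemma indep_exists_pair: "\<exists>m n :: int ^ 'n. indep m n"
  using t_nonzero exists_indep[OF card_ge_2] by blast

lemma common_indep:
  assumes "(n :: int ^ 'n) \<noteq> 0" "q \<noteq> 0"
  shows "\<exists>w. indep n w \<and> indep q w"
proof (cases "indep n q")
  case True
  then have "indep n (n + q)" "indep q (n + q)" by (simp_all add: indep_sym)
  then show ?thesis by blast
next
  case False
  obtain w where "indep n w" using exists_indep[OF card_ge_2 assms(1)] by blast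
  then show ?thesis using indep_parallel[OF False assms] by blast
qed

text \<open>Applying \<open>[D(u, q - p) b', _]\<close> to \<open>t\<^sup>p b = a t\<^sup>p\<close>, where \<open>(u, p) \<noteq> 0\<close>.\<close>

lemma scalar_transfer:
  assumes "t p b = a *\<^sub>C t p 1" "indep p q"
  shows "t q (b' * b) = a *\<^sub>C t q b'"
proof -
  have "indep (q - p) p" using indep_sym[OF assms(2)] by simp
  then obtain u where u: "dot u (cvec (q - p)) = 0" "dot u (cvec p) = 1"
    using exists_normal[of "q - p" p] by auto
  have "comm (d u (q - p) b') (t p b) = comm (d u (q - p) b') (a *\<^sub>C t p 1)"
    using assms(1) by simp
  then show ?thesis by (simp add: comm_simps(4) comm_dt[OF u(1)] u(2) scaleC_one)
qed

lemma ex_psi: "\<exists>a. \<forall>r. r \<noteq> 0 \<longrightarrow> t r b = a *\<^sub>C t r 1"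
proof -
  obtain p q :: "int ^ 'n" where pq: "indep p q" using indep_exists_pair by blast
  obtain a where a: "t p b = a *\<^sub>C t p 1" using t_scalar by blast
  have "t r b = a *\<^sub>C t r 1" if r: "r \<noteq> 0" for r
  proof -
    obtain w where w: "indep p w" "indep r w" using common_indep[OF indep_nonzero(1)[OF pq] r] by blast
    have "t w b = a *\<^sub>C t w 1" using scalar_transfer[OF a w(1), of 1] by simp
    from scalar_transfer[OF this indep_sym[OF w(2)], of 1] show ?thesis by simp
  qed
  then show ?thesis by blast
qed

text \<open>The character \<open>\<psi>\<close> with \<open>t\<^sup>r b = \<psi>(b) t\<^sup>r\<close> for all \<open>r \<noteq> 0\<close>.\<close>

definition psi :: "'b \<Rightarrow> complex" where "psi b = (SOME a. \<forall>r. r \<noteq> 0 \<longrightarrow> t r b = a *\<^sub>C t r 1)"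

lemma psi: "r \<noteq> 0 \<Longrightarrow> t r b = psi b *\<^sub>C t r 1"
  using someI_ex[OF ex_psi[of b]] unfolding psi_def by blast

lemma psi_unique: assumes "t r b = a *\<^sub>C t r 1" "r \<noteq> 0" shows "psi b = a"
  using assms psi[OF assms(2), of b] by (simp add: t_nonzero')

lemma psi_linear: "clinear psi"
proof (rule clinearI)
  obtain r :: "int ^ 'n" where r: "r \<noteq> 0" using t_nonzero by blast
  fix x y a
  show "psi (x + y) = psi x + psi y"
    by (rule psi_unique[OF _ r]) (simp add: cvs.linear_add[OF t_linear] psi[OF r, of x] psi[OF r, of y] scaleC_add_left)
  show "psi (a *\<^sub>C x) = a *\<^sub>C psi x"
    by (rule psi_unique[OF _ r]) (simp add: cvs.linear_scale[OF t_linear] psi[OF r, of x] scaleC_scaleC)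
qed

lemma psi_one: "psi 1 = 1"
proof -
  obtain r :: "int ^ 'n" where r: "r \<noteq> 0" using t_nonzero by blast
  show ?thesis by (rule psi_unique[OF _ r]) (simp add: scaleC_one)
qed

lemma psi_mult: "psi (b * b') = psi b * psi b'"
proof -
  obtain p q :: "int ^ 'n" where pq: "indep p q" using indep_exists_pair by blast
  note nz = indep_nonzero[OF pq]
  have "t q (b * b') = psi b' *\<^sub>C t q b" by (rule scalar_transfer[OF psi[OF nz(1)] pq])
  then have "t q (b * b') = (psi b * psi b') *\<^sub>C t q 1"
    by (simp add: psi[OF nz(2), of b] scaleC_scaleC mult.commute)
  then show ?thesis by (rule psi_unique[OF _ nz(2)])
qed

section \<open>Structure constants of the products of monomials\<close>

text \<open>The structure constants in \<open>t\<^sup>m t\<^sup>n = k(m, n) t\<^sup>m\<^sup>+\<^sup>n\<close>.\<close>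

definition k :: "int ^ 'n \<Rightarrow> int ^ 'n \<Rightarrow> complex"
  where "k m n = (SOME a. t m 1 * t n 1 = a *\<^sub>C t (m + n) 1)"

lemma k: "t m 1 * t n 1 = k m n *\<^sub>C t (m + n) 1"
  unfolding k_def
  by (rule someI_ex)
    (intro homog_scalar[OF inv_comm_t] inv_commD(1,4)[OF inv_comm_t] homog_mult homog_t)

lemma k_unique: assumes "t m 1 * t n 1 = a *\<^sub>C t (m + n) 1" shows "k m n = a"
  using assms unfolding k by (simp add: t_nonzero')

lemma k_nonzero: "k m n \<noteq> 0"
proof
  assume "k m n = 0"
  then have "t m 1 * t n 1 = 0" using k[of m n] by simp
  then show False using t_mult_eq_0 t_nonzero' by blast
qed

lemma k_sym: "k m n = k n m"
  by (rule k_unique) (use k[of n m] in \<open>simp add: t_commute[of m] add.commute\<close>)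

lemma k_zero: "k m 0 = c_const"
  by (rule k_unique) (simp add: c_const)

lemma k_assoc: "k m n * k (m + n) p = k n p * k m (n + p)"
proof -
  have "(t m 1 * t n 1) * t p 1 = t m 1 * (t n 1 * t p 1)" by (rule mult.assoc)
  then show ?thesis by (simp add: k scaleC_scaleC add.assoc t_nonzero')
qed

text \<open>The identity obtained by differentiating \<open>t\<^sup>m t\<^sup>n = k(m, n) t\<^sup>m\<^sup>+\<^sup>n\<close> with \<open>D(u, s)\<close>.\<close>

lemma k_derivation:
  assumes u: "dot u (cvec s) = 0"
  shows "dot u (cvec m) * k (m + s) n + dot u (cvec n) * k m (n + s) = dot u (cvec (m + n)) * k m n"
proof -
  have s: "s + m + n = m + n + s" "m + (s + n) = m + n + s" "s + (m + n) = m + n + s"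
    "s + m = m + s" "s + n = n + s"
    by (simp_all add: ac_simps)
  have "comm (d u s 1) (t m 1 * t n 1) = dot u (cvec m) *\<^sub>C (k (m + s) n *\<^sub>C t (m + n + s) 1)
      + dot u (cvec n) *\<^sub>C (k m (n + s) *\<^sub>C t (m + n + s) 1)"
    by (simp only: comm_simps(6) comm_dt[OF u] endo_scaleC_mult mult_1 s(4,5))
      (simp only: k s(1,2) ac_simps)
  moreover have "comm (d u s 1) (t m 1 * t n 1) = k m n *\<^sub>C (dot u (cvec (m + n)) *\<^sub>C t (m + n + s) 1)"
    unfolding k comm_simps(4) comm_dt[OF u] by (simp add: s)
  ultimately have "dot u (cvec m) *\<^sub>C (k (m + s) n *\<^sub>C t (m + n + s) 1)
      + dot u (cvec n) *\<^sub>C (k m (n + s) *\<^sub>C t (m + n + s) 1)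
      = k m n *\<^sub>C (dot u (cvec (m + n)) *\<^sub>C t (m + n + s) 1)" by simp
  then show ?thesis
    by (simp add: scaleC_scaleC flip: scaleC_add_left) (simp add: t_nonzero' mult.commute)
qed

text \<open>Since \<open>[D(u, s), t\<^sup>m] = ((u, m) / k(m, s)) t\<^sup>m t\<^sup>s\<close>, the number \<open>(u, m) / k(m, s)\<close> is a logarithmic
  derivative of \<open>t\<^sup>m\<close>; hence it is additive in \<open>m\<close>.\<close>

lemma k_additive:
  assumes u: "dot u (cvec s) = 0"
  shows "dot u (cvec (m + n)) / k (m + n) s = dot u (cvec m) / k m s + dot u (cvec n) / k n s"
proof -
  have m: "k (m + s) n = k m n * k (m + n) s / k m s"
    using k_assoc[of s m n] k_nonzero by (simp add: field_simps k_sym[of s] add.commute)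
  have n: "k m (n + s) = k m n * k (m + n) s / k n s"
    using k_assoc[of m n s] k_nonzero by (simp add: field_simps)
  have "dot u (cvec m) * (k m n * k (m + n) s / k m s) + dot u (cvec n) * (k m n * k (m + n) s / k n s)
      = dot u (cvec (m + n)) * k m n"
    using k_derivation[OF u, of m n] by (simp only: m n)
  then have "k m n * k (m + n) s * (dot u (cvec m) / k m s + dot u (cvec n) / k n s)
      = k m n * k (m + n) s * (dot u (cvec (m + n)) / k (m + n) s)"
    using k_nonzero[of "m + n" s] by (simp add: algebra_simps)
  then show ?thesis using k_nonzero by (metis mult_cancel_left mult_eq_0_iff)
qed

lemma k_indep_left:
  assumes "indep s m" "indep s m'"
  shows "k m s = k m' s"
proof -
  obtain u :: "int ^ 'n" where u: "dot (cvec u) (cvec s) = 0" "dot (cvec u) (cvec m) \<noteq> 0"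
    "dot (cvec u) (cvec m') \<noteq> 0"
    using exists_int_normal2[OF assms] by blast
  define a a' where aa: "a = (\<Sum>i\<in>UNIV. u $ i * m $ i)" "a' = (\<Sum>i\<in>UNIV. u $ i * m' $ i)"
  have a: "dot (cvec u) (cvec m) = of_int a" "dot (cvec u) (cvec m') = of_int a'"
    by (simp_all add: aa dot_cvec)
  define f where "f n = dot (cvec u) (cvec n) / k n s" for n
  have add: "f (n + n') = f n + f n'" for n n' unfolding f_def by (rule k_additive[OF u(1)])
  \<comment> \<open>a combination of \<open>m\<close> and \<open>m'\<close> orthogonal to \<open>u\<close>\<close>
  have "f (a' *s m + (- a) *s m') = 0"
    by (simp add: f_def cvec_simps cvec_more_simps dot_simps dot_more_simps a)
  then have "of_int a' * f m + of_int (- a) * f m' = 0"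
    by (simp only: add additive_int_scale[of f, OF add])
  then have "of_int a' * (of_int a / k m s) = of_int a * (of_int a' / k m' s)"
    by (simp add: f_def a)
  then show ?thesis using u(2,3) k_nonzero by (simp add: a field_simps)
qed

lemma k_const_indep:
  assumes "indep m n" "indep p q"
  shows "k m n = k p q"
proof -
  obtain w where w: "indep n w" "indep q w"
    using common_indep[OF indep_nonzero(2)[OF assms(1)] indep_nonzero(2)[OF assms(2)]] by blast
  have "k m n = k w n" by (rule k_indep_left[OF indep_sym[OF assms(1)] w(1)])
  also have "\<dots> = k n w" by (rule k_sym)
  also have "\<dots> = k q w" by (rule k_indep_left[OF indep_sym[OF w(1)] indep_sym[OF w(2)]])
  also have "\<dots> = k w q" by (rule k_sym)
  also have "\<dots> = k p q" by (rule k_indep_left[OF w(2) indep_sym[OF assms(2)]])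
  finally show ?thesis .
qed

lemma ex_kappa: "\<exists>\<kappa>. \<forall>m n. m \<noteq> 0 \<longrightarrow> n \<noteq> 0 \<longrightarrow> m + n \<noteq> 0 \<longrightarrow> k m n = \<kappa>"
proof -
  obtain p q :: "int ^ 'n" where pq: "indep p q" using indep_exists_pair by blast
  have "k m n = k p q" if mn: "m \<noteq> 0" "n \<noteq> 0" "m + n \<noteq> 0" for m n
  proof (cases "indep m n")
    case True
    then show ?thesis by (rule k_const_indep[OF _ pq])
  next
    case False
    \<comment> \<open>parallel exponents: shift one of them by an independent vector\<close>
    obtain s where s: "indep m s" using exists_indep[OF card_ge_2 mn(1)] by blast
    then have ns: "indep n s" by (rule indep_parallel[OF False mn(1,2)])
    have "\<not> indep m (m + n)" using False by (metis indep_add_left(4) indep_sym add.commute)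
    then have "indep (m + n) s" by (rule indep_parallel[OF _ mn(1,3) s])
    then obtain u where u: "dot u (cvec s) = 0" "dot u (cvec (m + n)) = 1"
      using exists_normal[OF indep_sym] by blast
    have par: "\<not> indep n m" using False indep_sym by blast
    have 1: "indep (m + s) n"
    proof (rule ccontr)
      assume "\<not> indep (m + s) n"
      then have "\<not> indep n (m + s)" using indep_sym by blast
      moreover have "m + s \<noteq> 0" using s by (metis indep_add_left(3,4) indep_nonzero(2) indep_sym)
      ultimately have "indep (m + s) s" using indep_parallel[OF _ mn(2) _ ns] by blast
      have "indep m (m + s)" using s by simp
      then have "indep n (m + s)" by (rule indep_parallel[OF False mn(1,2)])
      then show False using \<open>\<not> indep n (m + s)\<close> by simp
    qed
    have "indep n (n + s)" using ns by simp
    then have 2: "indep m (n + s)" by (rule indep_parallel[OF par mn(2,1)])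
    have "(dot u (cvec m) + dot u (cvec n)) * k p q = k m n"
      using k_derivation[OF u(1), of m n] k_const_indep[OF 1 pq] k_const_indep[OF 2 pq] u(2)
      by (simp add: algebra_simps)
    then show ?thesis using u(2) by (simp add: cvec_simps dot_simps)
  qed
  then show ?thesis by blast
qed

lemma ex_mu: "\<exists>\<mu>. \<forall>m. m \<noteq> 0 \<longrightarrow> k m (- m) = \<mu>"
proof -
  have step: "k m (- m) = k n (- n)" if mn: "indep m n" for m n
  proof -
    have "indep (- m - n) m" using indep_sym[OF mn]
      by (metis ab_group_add_class.ab_diff_conv_add_uminus add.commute indep_add_left(5) indep_add_left(6) minus_add_distrib uminus_add_conv_diff)
    then obtain u where u: "dot u (cvec (- m - n)) = 0" "dot u (cvec m) = 1"
      using exists_normal by blast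
    have un: "dot u (cvec n) = -1"
      using u by (simp add: cvec_more_simps dot_more_simps eq_neg_iff_add_eq_0 add.commute)
    have "k (- n) n - k m (- m) = 0"
      using k_derivation[OF u(1), of m n] u(2) un by (simp add: cvec_simps dot_simps)
    then show ?thesis using k_sym[of n] by simp
  qed
  obtain p q :: "int ^ 'n" where pq: "indep p q" using indep_exists_pair by blast
  have "k m (- m) = k p (- p)" if m: "m \<noteq> 0" for m
  proof -
    obtain w where "indep m w" "indep p w" using common_indep[OF m indep_nonzero(1)[OF pq]] by blast
    then show ?thesis using step by metis
  qed
  then show ?thesis by blast
qed

lemma ex_kappa_mu:
  "\<exists>\<kappa> \<mu>. \<kappa> \<noteq> 0 \<and> \<mu> \<noteq> 0 \<and> \<kappa>\<^sup>2 = c_const * \<mu> \<and>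
    (\<forall>m n. m \<noteq> 0 \<longrightarrow> n \<noteq> 0 \<longrightarrow> m + n \<noteq> 0 \<longrightarrow> k m n = \<kappa>) \<and> (\<forall>m. m \<noteq> 0 \<longrightarrow> k m (- m) = \<mu>)"
proof -
  obtain \<kappa> where \<kappa>: "\<And>m n. m \<noteq> 0 \<Longrightarrow> n \<noteq> 0 \<Longrightarrow> m + n \<noteq> 0 \<Longrightarrow> k m n = \<kappa>" using ex_kappa by blast
  obtain \<mu> where \<mu>: "\<And>m. m \<noteq> 0 \<Longrightarrow> k m (- m) = \<mu>" using ex_mu by blast
  obtain m n :: "int ^ 'n" where mn: "indep m n" using indep_exists_pair by blast
  note nz = indep_nonzero[OF mn]
  have "indep (m + n) n" using mn by simp
  then have "m + n \<noteq> 0" by (rule indep_nonzero(1))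
  then have "k m n = \<kappa>" "k (m + n) (- n) = \<kappa>" using nz by (intro \<kappa>; simp)+
  moreover have "k n (- n) = \<mu>" using \<mu> nz by blast
  moreover have "k m n * k (m + n) (- n) = k n (- n) * k m 0" using k_assoc[of m n "- n"] by simp
  ultimately have "\<kappa>\<^sup>2 = c_const * \<mu>" by (simp add: k_zero power2_eq_square mult.commute)
  moreover have "\<kappa> \<noteq> 0" "\<mu> \<noteq> 0"
    using \<open>k m n = \<kappa>\<close> \<open>k n (- n) = \<mu>\<close> k_nonzero by blast+
  ultimately show ?thesis using \<kappa> \<mu> by blast
qed

section \<open>Action of the current algebra of vector fields\<close>

lemma t_kernel: "psi b = 0 \<Longrightarrow> r \<noteq> 0 \<Longrightarrow> t r b = 0"
  using psi[of r b] by simp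

lemma d_zero: "d 0 r b = 0"
  using d_scale[of 0 r 0 b] by (simp add: dot_simps)

lemma comm_dt_kernel:
  assumes "psi b = 0" "dot u (cvec r) = 0"
  shows "comm (d u r b) (t s b') = 0"
proof (cases "r + s = 0")
  case True
  then show ?thesis using dot_sum_neg[OF True assms(2)] by (simp add: comm_dt[OF assms(2)])
next
  case False
  have "t (r + s) (b * b') = 0" by (rule t_kernel[OF _ False]) (simp add: psi_mult assms(1))
  then show ?thesis by (simp add: comm_dt[OF assms(2)])
qed

text \<open>Homogeneous operators that commute with all \<open>t\<^sup>s b\<close> are determined on one weight space.\<close>

definition t_centralizer :: "int ^ 'n \<Rightarrow> 'v endo set"
  where "t_centralizer r = {y. homog r y \<and> (\<forall>s b. t s b * y = y * t s b)}"

lemma subspace_t_centralizer: "cvs.subspace (t_centralizer r)"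
  unfolding cvs.subspace_def t_centralizer_def
  by (auto simp: homog_add homog_scale algebra_simps)
    (simp add: homog_def cvs.subspace_0[OF V_subspace])

lemma finite_dim_t_centralizer: "finite_dim (t_centralizer r)"
proof -
  obtain S where S: "finite S" "S \<subseteq> V 0" "V 0 \<subseteq> cvs.span S"
    using finite_dim_basis[OF V_finite_dim[of 0]] by metis
  show ?thesis
  proof (rule finite_dim_endos[OF S(1) subspace_t_centralizer V_finite_dim[of r]])
    fix y v assume "y \<in> t_centralizer r" "v \<in> S"
    then show "app y v \<in> V r" using S(2) unfolding t_centralizer_def homog_def by fastforce
  next
    fix y assume y: "y \<in> t_centralizer r" and 0: "\<And>v. v \<in> S \<Longrightarrow> app y v = 0"
    have V0: "app y v = 0" if "v \<in> V 0" for v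
    proof -
      have "v \<in> cvs.span S" using S(3) that by blast
      then show ?thesis by (rule cvs.linear_eq_0_on_span[OF app_linear, rotated]) (rule 0)
    qed
    show "y = 0"
    proof (rule endo_eq_0I)
      fix q v assume "v \<in> V q"
      then have "app (t (- q) 1) v \<in> V 0" using homog_t[of "- q" 1] by (fastforce simp: homog_def)
      then have "app y (app (t (- q) 1) v) = 0" by (rule V0)
      moreover have "t (- q) 1 * y = y * t (- q) 1" using y by (simp add: t_centralizer_def)
      ultimately have "app (t (- q) 1) (app y v) = 0" by (metis app_endo_simps(6))
      then show "app y v = 0" by (rule t_injective')
    qed
  qed
qed

lemma d_in_centralizer:
  assumes "psi b = 0" "dot u (cvec r) = 0"
  shows "d u r b \<in> t_centralizer r"
  using comm_dt_kernel[OF assms] homog_d[OF assms(2)] unfolding t_centralizer_def comm_eq_0_iff by simp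

text \<open>The commutator of \<open>D(v, s' - s)\<close> with \<open>D(w, s) b\<close> is \<open>D(u, s') b\<close> for a suitable \<open>v\<close>, after rescaling \<open>w\<close>.\<close>

lemma d_vanish_step:
  assumes w: "dot w (cvec s) = 0" "d w s b = 0" and s': "dot w (cvec s') \<noteq> 0" and u: "dot u (cvec s') = 0"
  shows "d u s' b = 0"
proof -
  define a where "a = dot w (cvec s')"
  define w' where "w' = (1 / a) *\<^sub>C w"
  have a: "a \<noteq> 0" using s' by (simp add: a_def)
  have w': "dot w' (cvec s) = 0" "dot w' (cvec s') = 1" "d w' s b = 0"
    using w a d_scale[of w s] by (simp_all add: w'_def dot_simps a_def)
  define v where "v = (- dot u (cvec s)) *\<^sub>C w' - u"
  have v: "dot v (cvec (s' - s)) = 0" "dot v (cvec s) = - dot u (cvec s)" "dot w' (cvec (s' - s)) = 1"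
    using w' u by (simp_all add: v_def dot_simps cvec_more_simps dot_more_simps)
  have "d (dot v (cvec s) *\<^sub>C w' - dot w' (cvec (s' - s)) *\<^sub>C v) (s' - s + s) (1 * b) = comm (d v (s' - s) 1) (d w' s b)"
    by (rule comm_dd[OF v(1) w'(1), symmetric])
  also have "\<dots> = 0" by (simp add: w' comm_simps)
  moreover have "dot v (cvec s) *\<^sub>C w' - dot w' (cvec (s' - s)) *\<^sub>C v = u"
    by (simp only: v(2,3) scaleC_one) (simp add: v_def)
  ultimately show ?thesis by simp
qed

text \<open>The vanishing of \<open>D(w, s) b\<close> for one pair \<open>(w, s)\<close> with \<open>w \<noteq> 0\<close> implies the vanishing of \<open>D(u, s') b\<close> for all
  \<open>s' \<noteq> 0\<close>.\<close>

lemma d_vanish: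
  assumes w: "dot w (cvec s) = 0" "w \<noteq> 0" "d w s b = 0" and s': "s' \<noteq> 0" and u: "dot u (cvec s') = 0"
  shows "d u s' b = 0"
proof -
  obtain i where i: "w $ i \<noteq> 0" using w(2) by (auto simp: vec_eq_iff)
  let ?e = "axis i 1 :: int ^ 'n"
  have "dot w (cvec ?e) \<noteq> 0" using i by (simp add: cvec_simps dot_axis)
  from d_vanish_step[OF w(1,3) this] have e: "d v ?e b = 0" if "dot v (cvec ?e) = 0" for v
    using that by blast
  have "?e \<noteq> 0" by (simp add: axis_eq_0_iff)
  then obtain x where x: "indep ?e x" "indep s' x" using common_indep[OF _ s'] by blast
  obtain v where v: "dot v (cvec ?e) = 0" "dot v (cvec x) = 1" using exists_normal[OF x(1)] by blast
  have xx: "d y x b = 0" if "dot y (cvec x) = 0" for y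
    by (rule d_vanish_step[OF v(1) e[OF v(1)] _ that]) (simp add: v(2))
  obtain y where y: "dot y (cvec x) = 0" "dot y (cvec s') = 1"
    using exists_normal[OF indep_sym[OF x(2)]] by blast
  show ?thesis by (rule d_vanish_step[OF y(1) xx[OF y(1)] _ u]) (simp add: y(2))
qed

lemma comm_cartan_d:
  assumes "dot w (cvec s) = 0"
  shows "comm (d u 0 b) (d w s b') = dot u (cvec s) *\<^sub>C d w s (b * b')"
  using comm_dd[of u 0 w s b b'] assms d_scale[of w s] by (simp add: cvec_simps dot_simps)

lemma comm_d_cartan:
  assumes "dot w (cvec s) = 0"
  shows "comm (d w s b) (d u 0 b') = - dot u (cvec s) *\<^sub>C d w s (b * b')"
  using comm_swap[of "d w s b"] comm_cartan_d[OF assms] by (simp add: mult.commute)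

text \<open>The operators \<open>D(w, s) b\<close> with \<open>\<psi>(b) = 0\<close> commute with all \<open>t\<^sup>r b'\<close>. If some of them with \<open>s \<noteq> 0\<close> is nonzero, then
  multiplication by the kernel of \<open>\<psi>\<close> has a common eigenvector \<open>D(w, s) b\<^sub>0\<close>, whose eigenvalues must be 0. The
  operators \<open>D(v, q) b\<^sub>0\<close> and \<open>t\<^sup>r b\<close> then generate an invariant commutative algebra, in which the degree 0
  operators \<open>D(u, 0) b\<^sub>0\<close> are scalars; so \<open>[D(w, s), D(u, 0) b\<^sub>0] = 0\<close>, contradicting \<open>D(w, s) b\<^sub>0 \<noteq> 0\<close>.\<close>

lemma d_kernel:
  assumes b: "psi b = 0" and s: "s \<noteq> 0" and w: "dot w (cvec s) = 0"
  shows "d w s b = 0"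
proof (rule ccontr)
  assume nz: "d w s b \<noteq> 0"
  then have w0: "w \<noteq> 0" using d_zero by auto
  obtain u where u: "dot u (cvec s) = 1" using exists_dot_one[OF s] by blast
  let ?B = "{b. psi b = 0}"
  let ?Q = "d w s ` ?B"
  have B: "cvs.subspace ?B"
    by (auto simp: cvs.subspace_def cvs.linear_add[OF psi_linear] cvs.linear_scale[OF psi_linear]
        cvs.linear_0[OF psi_linear])
  have Q: "cvs.subspace ?Q" by (rule cvs.linear_subspace_image[OF d_linear B])
  have "?Q \<subseteq> t_centralizer s" using d_in_centralizer w by auto
  then have Qfd: "finite_dim ?Q" by (rule finite_dim_subset[OF finite_dim_t_centralizer])
  have Q0: "?Q \<noteq> {0}" using nz b by auto
  have act: "comm (d u 0 b) (d w s b') = d w s (b * b')" for b b'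
    by (simp add: comm_cartan_d[OF w] u scaleC_one)
  let ?F = "(\<lambda>b. comm (d u 0 b)) ` ?B"
  have "\<exists>y\<in>?Q. y \<noteq> 0 \<and> (\<forall>f\<in>?F. \<exists>a. f y = a *\<^sub>C y)"
  proof (rule common_eigenvector[OF Q Qfd Q0])
    fix f assume "f \<in> ?F"
    then show "clinear f" "f ` ?Q \<subseteq> ?Q" by (auto simp: clinear_comm act psi_mult)
  next
    fix f g y assume "f \<in> ?F" "g \<in> ?F" "y \<in> ?Q"
    then show "f (g y) = g (f y)" by (auto simp: act mult.left_commute)
  qed
  then obtain b0 where b0: "psi b0 = 0" "d w s b0 \<noteq> 0"
    and eig: "\<And>b. psi b = 0 \<Longrightarrow> \<exists>a. d w s (b * b0) = a *\<^sub>C d w s b0"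
    by (auto simp: act)
  have all_nz: "d w' s' b0 \<noteq> 0" if "w' \<noteq> 0" "dot w' (cvec s') = 0" for w' s'
    using d_vanish[OF that(2,1) _ s w] b0(2) by blast
  have kill: "d w' s' (b * b0) = 0" if b: "psi b = 0" and s': "s' \<noteq> 0" "dot w' (cvec s') = 0" for b w' s'
  proof -
    obtain a where a: "d w s (b * b0) = a *\<^sub>C d w s b0" using eig[OF b] by blast
    have "d w s (b * b0 - a *\<^sub>C b0) = 0"
      by (simp add: cvs.linear_diff[OF d_linear] cvs.linear_scale[OF d_linear] a)
    from d_vanish[OF w w0 this]
    have all: "d w' s' (b * b0) = a *\<^sub>C d w' s' b0" if "s' \<noteq> 0" "dot w' (cvec s') = 0" for w' s'
      using that by (simp add: cvs.linear_diff[OF d_linear] cvs.linear_scale[OF d_linear])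
    have "a = 0"
    proof (rule ccontr)
      assume a0: "a \<noteq> 0"
      define e :: "nat \<Rightarrow> complex" where "e j = of_nat (Suc j) * a" for j
      \<comment> \<open>\<open>ad D(u, 0) b\<close> would have infinitely many eigenvalues on a finite-dimensional space\<close>
      define m where "m j = int (Suc j) *s s" for j
      define y where "y j = t (- m j) 1 * d w (m j) b0" for j
      have "inj e" using a0 by (intro injI) (simp add: e_def)
      moreover have "y j \<in> t_centralizer 0 \<and> y j \<noteq> 0 \<and> comm (d u 0 b) (y j) = e j *\<^sub>C y j" for j
      proof -
        let ?s = "m j"
        have ws: "dot w (cvec ?s) = 0" and us: "dot u (cvec ?s) = of_nat (Suc j)"
          by (simp_all only: m_def cvec_more_simps dot_simps w u of_int_of_nat_eq mult_zero_right mult_1_right)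
        obtain i where "s $ i \<noteq> 0" using s by (auto simp: vec_eq_iff)
        then have "?s $ i \<noteq> 0" by (simp add: m_def del: of_nat_Suc)
        then have s0: "?s \<noteq> 0" by (metis zero_index)
        have "homog (- ?s + ?s) (y j)" unfolding y_def by (intro homog_mult homog_t homog_d ws)
        moreover have "t r b' * y j = y j * t r b'" for r b'
        proof -
          have "t r b' * d w ?s b0 = d w ?s b0 * t r b'"
            using d_in_centralizer[OF b0(1) ws] by (simp add: t_centralizer_def)
          then show ?thesis unfolding y_def using t_commute by (metis mult.assoc)
        qed
        ultimately have "y j \<in> t_centralizer 0" by (simp add: t_centralizer_def)
        moreover have "y j \<noteq> 0" using t_mult_eq_0 all_nz[OF w0 ws] unfolding y_def by blast
        moreover have "comm (d u 0 b) (y j) = e j *\<^sub>C y j"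
        proof -
          have "comm (d u 0 b) (t (- ?s) 1) = 0" by (rule comm_dt_kernel[OF b]) (simp add: cvec_simps dot_simps)
          moreover have "comm (d u 0 b) (d w ?s b0) = e j *\<^sub>C d w ?s b0"
            by (simp only: comm_cartan_d[OF ws] all[OF s0 ws] us scaleC_scaleC e_def)
          ultimately show ?thesis by (simp add: y_def comm_simps)
        qed
        ultimately show ?thesis by blast
      qed
      ultimately show False by (rule eigenvalues_bounded[OF clinear_comm finite_dim_t_centralizer])
    qed
    then show ?thesis using all[OF s'] by simp
  qed
  let ?G = "range (case_prod t) \<union> {d v q b0 | v q. dot v (cvec q) = 0}"
  have H: "inv_comm (alg_hull ?G)"
  proof (rule inv_comm_alg_hull)
    show "t r b \<in> ?G" for r b by (rule UnI1) (rule range_eqI[of _ _ "(r, b)"], simp)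
  next
    have dt: "d v q b0 * t r b = t r b * d v q b0" if "dot v (cvec q) = 0" for v q r b
      using comm_dt_kernel[OF b0(1) that] by (simp add: comm_eq_0_iff)
    have dd: "d v q b0 * d v' q' b0 = d v' q' b0 * d v q b0"
      if v: "dot v (cvec q) = 0" "dot v' (cvec q') = 0" for v q v' q'
    proof -
      have "comm (d v q b0) (d v' q' b0) = 0"
      proof (cases "q + q' = 0")
        case True
        then have True': "q' + q = 0" by (simp add: add.commute)
        have "dot v (cvec q') = 0" "dot v' (cvec q) = 0"
          by (rule dot_sum_neg[OF True v(1)], rule dot_sum_neg[OF True' v(2)])
        then show ?thesis by (simp add: comm_dd[OF v] d_zero)
      next
        case False
        then show ?thesis unfolding comm_dd[OF v]
          by (intro kill[OF b0(1)]) (simp_all add: dot_simps cvec_simps v)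
      qed
      then show ?thesis by (simp add: comm_eq_0_iff)
    qed
    fix g h assume "g \<in> ?G" "h \<in> ?G"
    then show "g * h = h * g" using dt dd t_commute by auto
  next
    fix v :: "complex ^ 'n" and q b g assume v: "dot v (cvec q) = 0" and g: "g \<in> ?G"
    from g consider r b' where "g = t r b'" | v' q' where "g = d v' q' b0" "dot v' (cvec q') = 0" by auto
    then show "comm (d v q b) g \<in> alg_hull ?G"
    proof cases
      case 1
      then show ?thesis by (simp only: comm_dt_in_hull[OF v])
    next
      case 2
      let ?v = "dot v (cvec q') *\<^sub>C v' - dot v' (cvec q) *\<^sub>C v"
      have v0: "dot ?v (cvec (q + q')) = 0" by (simp add: dot_simps cvec_simps v 2)
      show ?thesis
      proof (cases "q + q' = 0")
        case True
        then have True': "q' + q = 0" by (simp add: add.commute)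
        have "dot v (cvec q') = 0" "dot v' (cvec q) = 0"
          by (rule dot_sum_neg[OF True v], rule dot_sum_neg[OF True' 2(2)])
        then have "comm (d v q b) g = 0 *\<^sub>C 1" by (simp add: 2 comm_dd[OF v] d_zero)
        then show ?thesis by (simp only:) (intro alg_hull.intros)
      next
        case False
        have "psi (b - psi b *\<^sub>C 1) = 0"
          by (simp add: cvs.linear_diff[OF psi_linear] cvs.linear_scale[OF psi_linear] psi_one)
        from kill[OF this False v0] have "d ?v (q + q') (b * b0) = psi b *\<^sub>C d ?v (q + q') b0"
          by (simp add: left_diff_distrib mult_scaleC_left cvs.linear_diff[OF d_linear] cvs.linear_scale[OF d_linear])
        then have "comm (d v q b) g = psi b *\<^sub>C d ?v (q + q') b0" by (simp add: 2 comm_dd[OF v])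
        moreover have "d ?v (q + q') b0 \<in> ?G" using v0 by blast
        ultimately show ?thesis by (simp only:) (intro alg_hull.scale alg_hull.gen)
      qed
    qed
  qed
  have u0: "dot u (cvec 0) = 0" by (simp add: cvec_simps dot_simps)
  have "d u 0 b0 \<in> alg_hull ?G" using u0 by (intro alg_hull.gen) blast
  from degree_0_scalar'[OF H this homog_d[OF u0]] obtain a where "d u 0 b0 = a *\<^sub>C 1" by blast
  then have "comm (d w s 1) (d u 0 b0) = 0" by (simp add: comm_simps)
  then show False using b0(2) by (simp add: comm_d_cartan[OF w] u)
qed

lemma d_psi:
  assumes "r \<noteq> 0" "dot u (cvec r) = 0"
  shows "d u r b = psi b *\<^sub>C d u r 1"
proof -
  have "psi (b - psi b *\<^sub>C 1) = 0"
    by (simp add: cvs.linear_diff[OF psi_linear] cvs.linear_scale[OF psi_linear] psi_one)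
  from d_kernel[OF this assms] show ?thesis
    by (simp add: cvs.linear_diff[OF d_linear] cvs.linear_scale[OF d_linear])
qed

text \<open>Since \<open>D(v, s) b = 0\<close> for \<open>s \<noteq> 0\<close> and \<open>\<psi>(b) = 0\<close>, the operators \<open>D(u, 0) b\<close> with \<open>\<psi>(b) = 0\<close> are central.\<close>

lemma cartan_kernel_scalar:
  assumes "psi b = 0"
  shows "\<exists>a. d u 0 b = a *\<^sub>C 1"
proof -
  let ?G = "range (case_prod t) \<union> {d u 0 b | u b. psi b = 0}"
  have z: "dot v (cvec 0) = 0" for v :: "complex ^ 'n" by (simp add: cvec_simps dot_simps)
  have cd: "comm (d v s b') (d u 0 b) = 0" if v: "dot v (cvec s) = 0" and b: "psi b = 0" for v s b' u b
  proof (cases "s = 0")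
    case True
    then show ?thesis unfolding comm_d_cartan[OF v] by (simp add: z)
  next
    case False
    have "d v s (b' * b) = 0" by (rule d_kernel[OF _ False v]) (simp add: psi_mult b)
    then show ?thesis by (simp add: comm_d_cartan[OF v])
  qed
  have H: "inv_comm (alg_hull ?G)"
  proof (rule inv_comm_alg_hull)
    show "t r b \<in> ?G" for r b by (rule UnI1) (rule range_eqI[of _ _ "(r, b)"], simp)
  next
    have dt: "d v 0 b * t r b' = t r b' * d v 0 b" if "psi b = 0" for v r b b'
      using comm_dt_kernel[OF that z] by (simp add: comm_eq_0_iff)
    have dd: "d v 0 b * d u 0 b' = d u 0 b' * d v 0 b" if "psi b' = 0" for v u b b'
      using cd[OF z that] by (simp add: comm_eq_0_iff)
    fix g h assume "g \<in> ?G" "h \<in> ?G"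
    then show "g * h = h * g" using dt dd t_commute by auto
  next
    fix v :: "complex ^ 'n" and q b g assume v: "dot v (cvec q) = 0" and g: "g \<in> ?G"
    from g consider r b' where "g = t r b'" | u b' where "g = d u 0 b'" "psi b' = 0" by auto
    then show "comm (d v q b) g \<in> alg_hull ?G"
    proof cases
      case 1
      then show ?thesis by (simp only: comm_dt_in_hull[OF v])
    next
      case 2
      then have "comm (d v q b) g = 0 *\<^sub>C 1" using cd[OF v] by simp
      then show ?thesis by (simp only:) (intro alg_hull.intros)
    qed
  qed
  have "d u 0 b \<in> alg_hull ?G" using assms by (intro alg_hull.gen) blast
  from degree_0_scalar'[OF H this homog_d[OF z]] show ?thesis .
qed

text \<open>The bilinear form giving the scalar by which \<open>D(u, 0) b\<close> acts on \<open>V 0\<close>. It is defined through the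
  decomposition \<open>b = \<psi>(b) 1 + (b - \<psi>(b) 1)\<close>, whose second term acts by a scalar.\<close>

definition cartan_form :: "complex ^ 'n \<Rightarrow> 'b \<Rightarrow> complex"
  where "cartan_form u b =
    psi b * dot u \<Lambda> + (SOME a. d u 0 (b - psi b *\<^sub>C 1) = a *\<^sub>C 1)"

lemma cartan_form: "d u 0 b = psi b *\<^sub>C d u 0 1 + (cartan_form u b - psi b * dot u \<Lambda>) *\<^sub>C 1"
proof -
  have "psi (b - psi b *\<^sub>C 1) = 0"
    by (simp add: cvs.linear_diff[OF psi_linear] cvs.linear_scale[OF psi_linear] psi_one)
  then have "d u 0 (b - psi b *\<^sub>C 1) = (SOME a. d u 0 (b - psi b *\<^sub>C 1) = a *\<^sub>C 1) *\<^sub>C 1"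
    by (intro someI_ex[OF cartan_kernel_scalar])
  then show ?thesis
    by (simp add: cartan_form_def cvs.linear_diff[OF d_linear] cvs.linear_scale[OF d_linear] algebra_simps)
qed

lemma cartan_form_action:
  assumes "v \<in> V r"
  shows "app (d u 0 b) v = (cartan_form u b + dot u (cvec r) * psi b) *\<^sub>C v"
proof -
  have v: "app (d u 0 1) v = dot u (\<Lambda> + cvec r) *\<^sub>C v" using assms by (simp add: V_eq)
  have "app (d u 0 b) v = psi b *\<^sub>C app (d u 0 1) v + (cartan_form u b - psi b * dot u \<Lambda>) *\<^sub>C v"
    by (subst cartan_form) simp
  also have "\<dots> = (psi b * dot u (\<Lambda> + cvec r) + (cartan_form u b - psi b * dot u \<Lambda>)) *\<^sub>C v"
    by (simp add: v scaleC_scaleC scaleC_add_left)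
  also have "psi b * dot u (\<Lambda> + cvec r) + (cartan_form u b - psi b * dot u \<Lambda>) = cartan_form u b + dot u (cvec r) * psi b"
    by (simp add: dot_simps algebra_simps)
  finally show ?thesis .
qed

lemma cartan_form_unique:
  assumes "\<And>v. v \<in> V 0 \<Longrightarrow> app (d u 0 b) v = a *\<^sub>C v"
  shows "cartan_form u b = a"
proof -
  obtain v where v: "v \<in> V 0" "v \<noteq> 0" using V_exists by blast
  have "cartan_form u b *\<^sub>C v = app (d u 0 b) v"
    by (simp add: cartan_form_action[OF v(1)] cvec_simps dot_simps)
  also have "\<dots> = a *\<^sub>C v" by (rule assms[OF v(1)])
  finally have "cartan_form u b *\<^sub>C v = a *\<^sub>C v" .
  then show ?thesis using v(2) by auto
qed

lemma cartan_form_bilinear: "cbilinear cartan_form"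
  unfolding cbilinear_def
proof (intro conjI allI clinearI)
  have act: "app (d u 0 b) v = cartan_form u b *\<^sub>C v" if "v \<in> V 0" for u b v
    using cartan_form_action[OF that, of u b] by (simp add: cvec_simps dot_simps)
  have z: "dot v (cvec 0) = 0" for v :: "complex ^ 'n" by (simp add: cvec_simps dot_simps)
  fix u u' a and b b' :: 'b
  show "cartan_form u (b + b') = cartan_form u b + cartan_form u b'"
    by (rule cartan_form_unique) (simp add: cvs.linear_add[OF d_linear] act scaleC_add_left)
  show "cartan_form u (a *\<^sub>C b) = a *\<^sub>C cartan_form u b"
    by (rule cartan_form_unique) (simp add: cvs.linear_scale[OF d_linear] act scaleC_scaleC)
  show "cartan_form (u + u') b = cartan_form u b + cartan_form u' b"
    by (rule cartan_form_unique) (simp add: d_add[OF z z] act scaleC_add_left)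
  show "cartan_form (a *\<^sub>C u) b = a *\<^sub>C cartan_form u b"
    by (rule cartan_form_unique) (simp add: d_scale[OF z] act scaleC_scaleC)
qed

lemma cartan_form_one: "cartan_form u 1 = dot u \<Lambda>"
  by (rule cartan_form_unique) (simp add: V_eq cvec_simps)

text \<open>The remaining operators are combinations of the identity and of the \<open>t\<^sup>r\<close> and \<open>D(u, r)\<close>.\<close>

lemma irreducible_restricted:
  assumes W: "cvs.subspace W" and t: "\<And>r v. r \<noteq> 0 \<Longrightarrow> v \<in> W \<Longrightarrow> app (t r 1) v \<in> W"
    and d: "\<And>u r v. dot u (cvec r) = 0 \<Longrightarrow> v \<in> W \<Longrightarrow> app (d u r 1) v \<in> W"
  shows "W = {0} \<or> W = UNIV"
proof (rule irreducible[OF W])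
  fix r b v assume v: "v \<in> W"
  show "app (t r b) v \<in> W"
  proof (cases "r = 0")
    case True
    then show ?thesis using v by (simp add: phi[of b] c_const cvs.subspace_scale[OF W])
  next
    case False
    then show ?thesis using t[OF False v] by (simp add: psi[OF False, of b] cvs.subspace_scale[OF W])
  qed
next
  fix u :: "complex ^ 'n" and r b v assume u: "dot u (cvec r) = 0" and v: "v \<in> W"
  show "app (d u r b) v \<in> W"
  proof (cases "r = 0")
    case True
    have "app (d u 0 b) v = psi b *\<^sub>C app (d u 0 1) v + (cartan_form u b - psi b * dot u \<Lambda>) *\<^sub>C v"
      by (subst cartan_form) simp
    then show ?thesis using d[OF u v] v True
      by (simp add: cvs.subspace_scale[OF W] cvs.subspace_add[OF W])
  next
    case False
    then show ?thesis using d[OF u v] by (simp add: d_psi[OF False u, of b] cvs.subspace_scale[OF W])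
  qed
qed

text \<open>The rescaled operators \<open>t\<^sup>r / \<kappa>\<close> for \<open>r \<noteq> 0\<close>, together with the identity for \<open>r = 0\<close>, define the
  action of the associative algebra of Laurent polynomials.\<close>

lemma jet_operators:
  "\<exists>X. X 0 = 1 \<and> (\<forall>m n. X m * X n = X (m + n)) \<and> (\<forall>r. r \<noteq> 0 \<longrightarrow> (\<exists>a. t r 1 = a *\<^sub>C X r)) \<and>
    (\<forall>u s m. dot u (cvec s) = 0 \<longrightarrow> comm (d u s 1) (X m) = dot u (cvec m) *\<^sub>C X (s + m))"
proof -
  obtain \<kappa> \<mu> where \<kappa>: "\<kappa> \<noteq> 0" "\<mu> \<noteq> 0" "\<kappa>\<^sup>2 = c_const * \<mu>"
    and k1: "\<forall>m n. m \<noteq> 0 \<longrightarrow> n \<noteq> 0 \<longrightarrow> m + n \<noteq> 0 \<longrightarrow> k m n = \<kappa>"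
    and k2: "\<forall>m. m \<noteq> 0 \<longrightarrow> k m (- m) = \<mu>"
    using ex_kappa_mu by (elim exE conjE) (rule that)
  define X where "X r = (if r = 0 then 1 else (1 / \<kappa>) *\<^sub>C t r 1)" for r
  have mult: "X m * X n = X (m + n)" for m n
  proof (cases "m = 0 \<or> n = 0")
    case True
    then show ?thesis by (auto simp: X_def)
  next
    case False
    show ?thesis
    proof (cases "m + n = 0")
      case True
      then have n: "n = - m" by (simp add: eq_neg_iff_add_eq_0 add.commute)
      have "t m 1 * t n 1 = (\<mu> * c_const) *\<^sub>C 1" using k[of m n] k2[rule_format, of m] False
        by (simp add: n c_const scaleC_scaleC)
      then show ?thesis using False \<kappa> True c_const(2)
        by (simp add: X_def scaleC_scaleC power2_eq_square mult.commute scaleC_one)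
    next
      case n: False
      then show ?thesis using False \<kappa> k[of m n] k1[rule_format, of m n] by (simp add: X_def scaleC_scaleC)
    qed
  qed
  have scale: "\<exists>a. t r 1 = a *\<^sub>C X r" if "r \<noteq> 0" for r
    using that \<kappa> by (intro exI[of _ \<kappa>]) (simp add: X_def scaleC_scaleC scaleC_one)
  have comm: "comm (d u s 1) (X m) = dot u (cvec m) *\<^sub>C X (s + m)" if u: "dot u (cvec s) = 0" for u s m
  proof (cases "m = 0 \<or> s + m = 0")
    case True
    then have "dot u (cvec m) = 0" using dot_sum_neg[OF _ u, of m] by (auto simp: cvec_simps dot_simps)
    then show ?thesis by (simp add: X_def comm_simps comm_dt[OF u])
  next
    case False
    then show ?thesis by (simp add: X_def comm_simps comm_dt[OF u] scaleC_scaleC mult.commute)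
  qed
  show ?thesis
  proof (intro exI[of _ X] conjI allI impI)
    show "X 0 = 1" by (simp add: X_def)
  qed (rule mult scale comm; assumption?)+
qed

end

section \<open>The special algebra, its extension and their modules\<close>

lemma vec_field_linear_left:
  "vec_field (u + v) r = vec_field u r + vec_field v r" "vec_field (a *\<^sub>C u) r = a *\<^sub>C vec_field u r"
  by (simp_all add: fun_eq_iff vec_field_def scaleC_fun_def scaleC_vec_def scaleC_add_left sum.distrib
      cvs.scale_sum_right scaleC_scaleC)

lemma D_add:
  assumes "dot u (cvec r) = 0" "dot v (cvec r) = 0"
  shows "D (u + v) r = D u r + D v r"
  using assms by transfer (simp add: dot_simps vec_field_linear_left)

lemma D_scale:
  assumes "dot u (cvec r) = 0"
  shows "D (a *\<^sub>C u) r = a *\<^sub>C D u r"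
  using assms by transfer (simp add: dot_simps vec_field_linear_left)

lemma special_span: "cvs.span {D u r | u r. dot u (cvec r) = 0} = UNIV"
proof -
  let ?S = "cvs.span {D u r | u r. dot u (cvec r) = 0}"
  have main: "Abs_special X \<in> ?S \<and> X \<in> special_ops" if "X \<in> special_ops" for X :: "'a laurent \<Rightarrow> 'a laurent"
    using that unfolding special_ops_def
  proof (induction rule: cvs.span_induct_alt)
    case base
    have 0: "Abs_special 0 = (0 :: 'a special)" by (simp add: zero_special_def)
    show ?case unfolding 0 by (intro conjI cvs.span_zero)
  next
    case (step c x y)
    then obtain u r where x: "x = vec_field u r" "dot u (cvec r) = 0" by blast
    have xs: "x \<in> special_ops" unfolding special_ops_def using step.hyps by (intro cvs.span_base)
    have ys: "y \<in> special_ops" using step.IH by (simp add: special_ops_def)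
    have "Abs_special x = D u r" using x by (simp add: D_def)
    then have "Abs_special x \<in> ?S" using x(2) by (intro cvs.span_base) auto
    moreover have "Abs_special (c *\<^sub>C x + y) = c *\<^sub>C Abs_special x + Abs_special y"
      using xs ys
      by (simp add: plus_special.abs_eq scaleC_special.abs_eq eq_onp_def
          cvs.subspace_scale[OF special_ops_subspace])
    ultimately have 1: "Abs_special (c *\<^sub>C x + y) \<in> ?S"
      using step.IH by (auto simp del: plus_fun_apply intro!: cvs.span_add cvs.span_scale)
    have 2: "c *\<^sub>C x + y \<in> special_ops"
      by (intro cvs.subspace_add[OF special_ops_subspace] cvs.subspace_scale[OF special_ops_subspace] xs ys)
    show ?case by (rule conjI[OF 1 2[unfolded special_ops_def]])
  qed
  have "X \<in> ?S" for X :: "'a special"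
    using main[OF special_apply[of X]] by (simp add: special_apply_inverse)
  then show ?thesis by (intro equalityI subsetI UNIV_I)
qed

lemma laurent_span: "cvs.span (range tpow) = UNIV"
  using free_span by (simp add: tpow_def full_SetCompr_eq)

lemma from_special_linear: "clinear from_special"
  by (rule clinearI) (simp_all add: from_special_def plus_special_ext_def scaleC_special_ext_def)

lemma from_laurent_linear: "clinear from_laurent"
  by (rule clinearI) (simp_all add: from_laurent_def plus_special_ext_def scaleC_special_ext_def)

lemma special_apply_0: "special_apply 0 f = 0" "special_apply X 0 = 0"
  using special_apply_simps(3)[of 0 0 f] special_apply_simps(6)[of X 0 0] by simp_all

lemma special_ext_brackets:
  "lie_bracket (from_special X) (from_special Y) = from_special (lie_bracket X Y)"
  "lie_bracket (from_special X) (from_laurent f) = from_laurent (special_apply X f)"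
  "lie_bracket (from_laurent f) (from_laurent g) = 0"
proof -
  have l0: "lie_bracket Z 0 = (0 :: 'a special)" "lie_bracket 0 Z = (0 :: 'a special)" for Z
    using lie_bracket_scaleC_right[of Z 0 0] lie_bracket_scaleC_left[of 0 0 Z] by simp_all
  show "lie_bracket (from_special X) (from_special Y) = from_special (lie_bracket X Y)"
    "lie_bracket (from_special X) (from_laurent f) = from_laurent (special_apply X f)"
    "lie_bracket (from_laurent f) (from_laurent g) = 0"
    by (simp_all add: from_special_def from_laurent_def lie_bracket_special_ext_def special_apply_0
        zero_special_ext_def l0)
qed

lemma special_ext_split: "x = from_special (field_part x) + from_laurent (fun_part x)"
  by (simp add: from_special_def from_laurent_def plus_special_ext_def)

lemma tens_linear: "clinear (\<lambda>x. x \<otimes>\<^sub>C b)" "clinear ((\<otimes>\<^sub>C) x)"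
  using cbilinear_tens unfolding cbilinear_def by blast+

lemma lie_moduleD:
  assumes "lie_module \<rho>"
  shows "clinear (\<rho> x)" "clinear (\<lambda>x. \<rho> x v)"
    "\<rho> (lie_bracket x y) v = \<rho> x (\<rho> y v) - \<rho> y (\<rho> x v)"
  using assms unfolding lie_module_def cbilinear_def by blast+

lemma clinear_compose: "clinear f \<Longrightarrow> clinear g \<Longrightarrow> clinear (\<lambda>x. g (f x))"
  by (rule clinearI) (simp_all add: cvs.linear_add cvs.linear_scale)

lemma enveloping_orbit_UNIV:
  fixes \<rho> :: "'g::complex_lie_algebra \<Rightarrow> 'v::complex_vector \<Rightarrow> 'v"
  assumes \<rho>: "irreducible_module \<rho>" and v: "v \<noteq> 0"
  shows "enveloping_orbit \<rho> v = UNIV"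
proof -
  let ?W = "enveloping_orbit \<rho> v"
  have lin: "clinear (\<rho> x)" for x using \<rho> lie_moduleD(1) unfolding irreducible_module_def by blast
  have "cvs.subspace ?W" unfolding enveloping_orbit_def by (rule cvs.subspace_span)
  moreover have "\<rho> x ` ?W \<subseteq> ?W" for x
  proof -
    have "\<rho> x ` {foldr \<rho> xs v |xs. True} \<subseteq> {foldr \<rho> xs v |xs. True}"
    proof safe
      fix xs
      have "\<rho> x (foldr \<rho> xs v) = foldr \<rho> (x # xs) v" by simp
      then show "\<exists>ys. \<rho> x (foldr \<rho> xs v) = foldr \<rho> ys v \<and> True" by blast
    qed
    then show ?thesis
      unfolding enveloping_orbit_def cvs.linear_span_image[OF lin, symmetric] by (rule cvs.span_mono)
  qed
  ultimately have *: "?W = {0} \<or> ?W = UNIV"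
    using \<rho> unfolding irreducible_module_def irreducible_under_def by simp
  have "foldr \<rho> [] v \<in> ?W" unfolding enveloping_orbit_def by (rule cvs.span_base) blast
  then have "v \<in> ?W" by simp
  then show ?thesis using * v by auto
qed

section \<open>Weights\<close>

text \<open>If the terms of a direct sum with index in the range of an injection \<open>g\<close> span the space, then the space is
  the direct sum of these terms and the other terms are 0.\<close>

lemma internal_direct_sum_reindex:
  assumes ds: "internal_direct_sum I W" and g: "inj g" "range g \<subseteq> I"
    and span: "cvs.span (\<Union>r. W (g r)) = UNIV"
  shows "internal_direct_sum UNIV (\<lambda>r. W (g r))"
    and "\<And>i. i \<in> I \<Longrightarrow> W i \<noteq> {0} \<Longrightarrow> i \<in> range g"
proof -
  have sub: "cvs.subspace (W i)" if "i \<in> I" for i using ds that by (simp add: internal_direct_sum_def)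
  then have subg: "cvs.subspace (W (g r))" for r using g(2) by blast
  \<comment> \<open>\<open>f\<close> is a decomposition of \<open>v\<close>\<close>
  define dec where "dec f v \<longleftrightarrow> (\<forall>r. f r \<in> W (g r)) \<and> finite {r. f r \<noteq> 0} \<and> v = (\<Sum>r\<in>{r. f r \<noteq> 0}. f r)"
    for f v
  have ex: "\<exists>f. dec f v" for v
  proof -
    have "v \<in> cvs.span (\<Union>r. W (g r))" using span by simp
    then show ?thesis
    proof (induction rule: cvs.span_induct_alt)
      case base
      show ?case by (rule exI[of _ "\<lambda>r. 0"]) (simp add: dec_def cvs.subspace_0[OF subg])
    next
      case (step c x y)
      then obtain q f where q: "x \<in> W (g q)" and f: "dec f y" by blast
      let ?f = "\<lambda>r. (if r = q then c *\<^sub>C x else 0) + f r"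
      have fin: "finite (insert q {r. f r \<noteq> 0})" using f by (simp add: dec_def)
      have sub': "{r. ?f r \<noteq> 0} \<subseteq> insert q {r. f r \<noteq> 0}" by auto
      have "(\<Sum>r\<in>{r. ?f r \<noteq> 0}. ?f r) = (\<Sum>r\<in>insert q {r. f r \<noteq> 0}. ?f r)"
        by (rule sum.mono_neutral_left[OF fin sub']) auto
      also have "\<dots> = (\<Sum>r\<in>insert q {r. f r \<noteq> 0}. if r = q then c *\<^sub>C x else 0) + (\<Sum>r\<in>insert q {r. f r \<noteq> 0}. f r)"
        by (rule sum.distrib)
      also have "(\<Sum>r\<in>insert q {r. f r \<noteq> 0}. if r = q then c *\<^sub>C x else 0) = c *\<^sub>C x"
        using fin by (simp add: sum.delta)
      also have "(\<Sum>r\<in>insert q {r. f r \<noteq> 0}. f r) = (\<Sum>r\<in>{r. f r \<noteq> 0}. f r)"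
        by (rule sum.mono_neutral_right[OF fin]) auto
      finally have "c *\<^sub>C x + y = (\<Sum>r\<in>{r. ?f r \<noteq> 0}. ?f r)" using f by (simp add: dec_def)
      moreover have "finite {r. ?f r \<noteq> 0}" using fin sub' by (rule finite_subset[rotated])
      moreover have "?f r \<in> W (g r)" for r
        using f q by (auto simp: dec_def intro!: cvs.subspace_add[OF subg] cvs.subspace_scale[OF subg]
            cvs.subspace_0[OF subg])
      ultimately have "dec ?f (c *\<^sub>C x + y)" unfolding dec_def by blast
      then show ?case by blast
    qed
  qed
  \<comment> \<open>extension by 0 turns a decomposition with indices \<open>r\<close> into one with indices in \<open>I\<close>\<close>
  define ext where "ext f i = (if i \<in> range g then f (inv g i) else 0)" for f :: "_ \<Rightarrow> 'b" and i
  let ?dec = "\<lambda>f v. (\<forall>i\<in>I. f i \<in> W i) \<and> (\<forall>i. i \<notin> I \<longrightarrow> f i = 0) \<and>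
              finite {i. f i \<noteq> 0} \<and> v = (\<Sum>i\<in>{i. f i \<noteq> 0}. f i)"
  have ext_g: "ext f (g r) = f r" for f r using g(1) by (simp add: ext_def)
  have ext_dec: "?dec (ext f) v" if "dec f v" for f v
  proof -
    have supp: "{i. ext f i \<noteq> 0} = g ` {r. f r \<noteq> 0}" using g(1) by (auto simp: ext_def dest!: injD[OF g(1)])
    have "(\<Sum>i\<in>g ` {r. f r \<noteq> 0}. ext f i) = (\<Sum>r\<in>{r. f r \<noteq> 0}. f r)"
      using g(1) by (subst sum.reindex) (auto simp: ext_g inj_on_def inj_def)
    moreover have "ext f i \<in> W i" if "i \<in> I" for i
    proof (cases "i \<in> range g")
      case True
      then obtain r where "i = g r" by blast
      then show ?thesis using \<open>dec f v\<close> by (simp add: ext_g dec_def)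
    qed (simp add: ext_def cvs.subspace_0[OF sub[OF that]])
    moreover have "ext f i = 0" if "i \<notin> I" for i using that g(2) by (auto simp: ext_def)
    ultimately show ?thesis using that unfolding supp by (simp add: dec_def)
  qed
  have uniq: "f = f'" if "?dec f v" "?dec f' v" for f f' v
    using ds that unfolding internal_direct_sum_def by blast
  have uniq': "f = f'" if "dec f v" "dec f' v" for f f' v
  proof
    fix r
    have "ext f = ext f'" by (rule uniq[OF ext_dec[OF that(1)] ext_dec[OF that(2)]])
    then show "f r = f' r" by (metis ext_g)
  qed
  show "internal_direct_sum UNIV (\<lambda>r. W (g r))"
    unfolding internal_direct_sum_def
  proof (intro conjI allI)
    show "\<forall>i\<in>UNIV. cvs.subspace (W (g i))" using subg by blast
    fix v
    obtain f where "dec f v" using ex by blast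
    then have "\<exists>!f. dec f v" using uniq' by blast
    then show "\<exists>!f. (\<forall>i\<in>UNIV. f i \<in> W (g i)) \<and> (\<forall>i. i \<notin> UNIV \<longrightarrow> f i = 0) \<and>
        finite {i. f i \<noteq> 0} \<and> v = (\<Sum>i\<in>{i. f i \<noteq> 0}. f i)"
      by (simp add: dec_def)
  qed
  fix i assume i: "i \<in> I" "W i \<noteq> {0}"
  then obtain x where x: "x \<in> W i" "x \<noteq> 0" using cvs.subspace_0[OF sub[OF i(1)]] by blast
  obtain f where f: "dec f x" using ex by blast
  let ?f = "\<lambda>j. if j = i then x else 0"
  have "{j. ?f j \<noteq> 0} = {i}" using x(2) by auto
  then have "?dec ?f x" using i(1) x(1) sub by (auto simp: cvs.subspace_0)
  from uniq[OF this ext_dec[OF f]] have "ext f i = x" by (metis (full_types))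
  then show "i \<in> range g" using x(2) by (auto simp: ext_def split: if_splits)
qed


lemma cartan_dual_D:
  assumes "\<mu> \<in> cartan_dual"
  shows "\<mu> (D u 0) = dot u (\<chi> i. \<mu> (cartan_d i))"
proof -
  have z: "dot v (cvec 0) = 0" for v :: "complex ^ 'a" by (simp add: cvec_simps dot_simps)
  have mem: "cartan_d i \<in> cartan" for i :: 'a unfolding cartan_def by (intro cvs.span_base) simp
  have 0: "(0 :: 'a special) \<in> cartan" by (simp add: cartan_def cvs.span_zero)
  have add: "\<mu> (x + y) = \<mu> x + \<mu> y" if "x \<in> cartan" "y \<in> cartan" for x y
    using assms that by (simp add: cartan_dual_def)
  have scale: "\<mu> (a *\<^sub>C x) = a * \<mu> x" if "x \<in> cartan" for a x
    using assms that by (simp add: cartan_dual_def)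
  have \<mu>0: "\<mu> 0 = 0" using scale[OF 0, of 0] by simp
  have sum: "D (\<Sum>i\<in>S. u $ i *\<^sub>C axis i 1) 0 \<in> cartan \<and>
      \<mu> (D (\<Sum>i\<in>S. u $ i *\<^sub>C axis i 1) 0) = (\<Sum>i\<in>S. u $ i * \<mu> (cartan_d i))" if "finite S" for S :: "'a set"
    using that
  proof (induction S rule: finite_induct)
    case empty
    have "D (0 :: complex ^ 'a) 0 = 0" using D_scale[OF z, of 0 0] by simp
    then show ?case by (simp add: 0 \<mu>0)
  next
    case (insert i S)
    have eq: "D (\<Sum>i\<in>insert i S. u $ i *\<^sub>C axis i 1) 0
        = u $ i *\<^sub>C cartan_d i + D (\<Sum>i\<in>S. u $ i *\<^sub>C axis i 1) 0"
      using insert.hyps by (simp add: D_add[OF z z] D_scale[OF z] cartan_d_def)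
    have "u $ i *\<^sub>C cartan_d i \<in> cartan" unfolding cartan_def
      by (intro cvs.span_scale cvs.span_base) simp
    then show ?case unfolding eq using insert mem
      by (simp add: add scale) (simp add: cartan_def cvs.span_add)
  qed
  have "(\<Sum>i\<in>UNIV. u $ i *\<^sub>C axis i 1) = u"
    by (simp add: vec_eq_iff scaleC_vec_def axis_def if_distrib cong: if_cong)
  then show ?thesis using sum[of UNIV] by (simp add: dot_def)
qed

lemma cartan_eq: "cartan = range (\<lambda>u. D u 0)"
proof
  have z: "dot v (cvec 0) = 0" for v :: "complex ^ 'a" by (simp add: cvec_simps dot_simps)
  have lin: "clinear (\<lambda>u :: complex ^ 'a. D u 0)" by (rule clinearI) (simp_all add: D_add[OF z z] D_scale[OF z])
  have "cvs.subspace (UNIV :: (complex ^ 'a) set)" by (rule cvs.subspace_UNIV)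
  from cvs.linear_subspace_image[OF lin this]
  show "cartan \<subseteq> range (\<lambda>u :: complex ^ 'a. D u 0)"
    unfolding cartan_def by (intro cvs.span_minimal) (auto simp: cartan_d_def)
  have "D u 0 \<in> cvs.span (range cartan_d)" for u :: "complex ^ 'a"
  proof -
    have "u = (\<Sum>i\<in>UNIV. u $ i *\<^sub>C axis i 1)"
      by (simp add: vec_eq_iff scaleC_vec_def axis_def if_distrib cong: if_cong)
    then have "D u 0 = (\<Sum>i\<in>UNIV. u $ i *\<^sub>C cartan_d i)"
      using cvs.linear_sum[OF lin, of "\<lambda>i. u $ i *\<^sub>C axis i 1" UNIV]
      by (simp add: cartan_d_def cvs.linear_scale[OF lin])
    then show ?thesis by (simp add: cvs.span_sum cvs.span_scale cvs.span_base)
  qed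
  then show "range (\<lambda>u :: complex ^ 'a. D u 0) \<subseteq> cartan" unfolding cartan_def by blast
qed

lemma weight_space_coord:
  assumes "\<mu> \<in> cartan_dual"
  shows "weight_space \<sigma> \<mu> = coord_weight_space \<sigma> (\<chi> i. \<mu> (cartan_d i))"
  by (simp add: weight_space_def coord_weight_space_def cartan_eq cartan_dual_D[OF assms])

lemma cartan_dual_subspace: "cvs.subspace cartan_dual"
  by (auto simp: cvs.subspace_def cartan_dual_def scaleC_fun_def algebra_simps)

lemma shifted_weight:
  fixes k :: "int ^ 'n::finite"
  assumes "\<nu> \<in> cartan_dual"
  shows "\<nu> + (\<Sum>i\<in>UNIV. of_int (k $ i) *\<^sub>C cartan_delta i) \<in> cartan_dual"
    and "(\<chi> j. (\<nu> + (\<Sum>i\<in>UNIV. of_int (k $ i) *\<^sub>C cartan_delta i)) (cartan_d j)) = (\<chi> j. \<nu> (cartan_d j)) + cvec k"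
proof -
  show "\<nu> + (\<Sum>i\<in>UNIV. of_int (k $ i) *\<^sub>C cartan_delta i) \<in> cartan_dual"
    by (intro cvs.subspace_add[OF cartan_dual_subspace] cvs.subspace_sum[OF cartan_dual_subspace]
        cvs.subspace_scale[OF cartan_dual_subspace] assms cartan_delta)
  have "(\<Sum>i\<in>UNIV. of_int (k $ i) *\<^sub>C cartan_delta i) (cartan_d j) = of_int (k $ j)" for j
  proof -
    have "(\<Sum>i\<in>S. of_int (k $ i) *\<^sub>C cartan_delta i) x = (\<Sum>i\<in>S. of_int (k $ i) * cartan_delta i x)"
      for S and x :: "'n special"
      by (induction S rule: infinite_finite_induct) (simp_all add: scaleC_fun_def)
    then show ?thesis by (simp add: cartan_delta(2) if_distrib cong: if_cong)
  qed
  then show "(\<chi> j. (\<nu> + (\<Sum>i\<in>UNIV. of_int (k $ i) *\<^sub>C cartan_delta i)) (cartan_d j)) = (\<chi> j. \<nu> (cartan_d j)) + cvec k"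
    by (simp add: vec_eq_iff cvec_def)
qed

section \<open>Structure of the irreducible modules\<close>

text \<open>An irreducible uniformly bounded module with a weight \<open>\<Lambda>\<close>, on which \<open>t\<^sup>0\<close> and some \<open>t\<^sup>s\<close> with \<open>s \<noteq> 0\<close> act
  nontrivially, provides operators with the properties studied above.\<close>

lemma current_module_of_module:
  fixes \<rho> :: "('n::finite special_ext, 'b::complex_comm_algebra_1) tensor \<Rightarrow> 'v::complex_vector \<Rightarrow> 'v"
    and wt :: "'n special \<Rightarrow> complex"
    and \<Lambda> :: "complex ^ 'n"
  assumes N: "CARD('n) \<ge> 2"
    and irred: "irreducible_module \<rho>"
    and bounded: "uniformly_bounded (restrict_special \<rho>)"
    and t_s: "\<exists>s v. s \<noteq> 0 \<and> t_op \<rho> s 1 v \<noteq> 0"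
    and t_0: "\<exists>v. t_op \<rho> 0 1 v \<noteq> 0"
    and wt: "wt \<in> weights (restrict_special \<rho>)"
    and \<Lambda>: "\<Lambda> = (\<chi> i. wt (cartan_d i))"
  shows "\<exists>M. current_module (\<lambda>r b. Endo (t_op \<rho> r b)) (\<lambda>u r b. Endo (D_op \<rho> u r b))
    (\<lambda>r. coord_weight_space (restrict_special \<rho>) (\<Lambda> + cvec r)) \<Lambda> M"
proof -
  have \<rho>: "lie_module \<rho>" using irred by (simp add: irreducible_module_def)
  note lin = lie_moduleD(1)[OF \<rho>] and lin' = lie_moduleD(2)[OF \<rho>] and br = lie_moduleD(3)[OF \<rho>]
  have app_t: "app (Endo (t_op \<rho> r b)) = t_op \<rho> r b" for r b by (simp add: app_Endo t_op_def lin)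
  have app_D: "app (Endo (D_op \<rho> u r b)) = D_op \<rho> u r b" for u r b by (simp add: app_Endo D_op_def lin)
  have wt': "wt \<in> cartan_dual" "weight_space (restrict_special \<rho>) wt \<noteq> {0}"
    using wt by (simp_all add: weights_def)
  obtain M where M: "\<And>\<mu>. \<mu> \<in> cartan_dual \<Longrightarrow> finite_dim (weight_space (restrict_special \<rho>) \<mu>)"
    "\<And>\<mu>. \<mu> \<in> cartan_dual \<Longrightarrow> cvs.dim (weight_space (restrict_special \<rho>) \<mu>) \<le> M"
    using bounded unfolding uniformly_bounded_def by blast
  have V: "coord_weight_space (restrict_special \<rho>) (\<Lambda> + cvec r)
      = weight_space (restrict_special \<rho>) (wt + (\<Sum>i\<in>UNIV. of_int (r $ i) *\<^sub>C cartan_delta i))" for r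
    by (simp only: weight_space_coord[OF shifted_weight(1)[OF wt'(1)]] shifted_weight(2)[OF wt'(1)] \<Lambda>)
  have "current_module (\<lambda>r b. Endo (t_op \<rho> r b)) (\<lambda>u r b. Endo (D_op \<rho> u r b))
    (\<lambda>r. coord_weight_space (restrict_special \<rho>) (\<Lambda> + cvec r)) \<Lambda> M"
  proof (rule current_module.intro, rule N)
    fix r :: "int ^ 'n" and u :: "complex ^ 'n"
    have *: "clinear (\<lambda>b. \<rho> (x \<otimes>\<^sub>C b) v)" for x :: "'n special_ext" and v
      by (rule clinear_compose[OF tens_linear(2) lin'])
    show "clinear (\<lambda>b. Endo (t_op \<rho> r b))"
      by (rule clinearI; rule endo_eqI; simp add: app_t)
        (simp_all add: t_op_def cvs.linear_add[OF *] cvs.linear_scale[OF *])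
    show "clinear (\<lambda>b. Endo (D_op \<rho> u r b))"
      by (rule clinearI; rule endo_eqI; simp add: app_D)
        (simp_all add: D_op_def cvs.linear_add[OF *] cvs.linear_scale[OF *])
  next
    fix u v :: "complex ^ 'n" and r :: "int ^ 'n" and b :: 'b and a
    have *: "clinear (\<lambda>X. \<rho> (from_special X \<otimes>\<^sub>C b) w)" for w
      by (rule clinear_compose[OF clinear_compose[OF from_special_linear tens_linear(1)] lin'])
    assume u: "dot u (cvec r) = 0"
    show "Endo (D_op \<rho> (a *\<^sub>C u) r b) = a *\<^sub>C Endo (D_op \<rho> u r b)"
      by (rule endo_eqI) (simp add: app_D, simp add: D_op_def D_scale[OF u] cvs.linear_scale[OF *])
    assume v: "dot v (cvec r) = 0"
    show "Endo (D_op \<rho> (u + v) r b) = Endo (D_op \<rho> u r b) + Endo (D_op \<rho> v r b)"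
      by (rule endo_eqI) (simp add: app_D, simp add: D_op_def D_add[OF u v] cvs.linear_add[OF *])
  next
    fix r s :: "int ^ 'n" and b b' :: 'b
    show "Endo (t_op \<rho> r b) * Endo (t_op \<rho> s b') = Endo (t_op \<rho> s b') * Endo (t_op \<rho> r b)"
    proof (rule endo_eqI)
      fix v
      have "\<rho> (lie_bracket (from_laurent (tpow r) \<otimes>\<^sub>C b) (from_laurent (tpow s) \<otimes>\<^sub>C b')) v = 0"
        by (simp add: special_ext_brackets cvs.linear_0[OF tens_linear(1)] cvs.linear_0[OF lin'])
      then show "app (Endo (t_op \<rho> r b) * Endo (t_op \<rho> s b')) v = app (Endo (t_op \<rho> s b') * Endo (t_op \<rho> r b)) v"
        unfolding br by (simp add: app_t) (simp add: t_op_def)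
    qed
  next
    fix u :: "complex ^ 'n" and r s :: "int ^ 'n" and b b' :: 'b
    assume u: "dot u (cvec r) = 0"
    show "comm (Endo (D_op \<rho> u r b)) (Endo (t_op \<rho> s b')) = dot u (cvec s) *\<^sub>C Endo (t_op \<rho> (r + s) (b * b'))"
    proof (rule endo_eqI)
      fix v
      have "\<rho> (lie_bracket (from_special (D u r) \<otimes>\<^sub>C b) (from_laurent (tpow s) \<otimes>\<^sub>C b')) v
          = dot u (cvec s) *\<^sub>C t_op \<rho> (r + s) (b * b') v"
        by (simp add: special_ext_brackets special_apply_D[OF u] cvs.linear_scale[OF from_laurent_linear]
            cvs.linear_scale[OF tens_linear(1)] cvs.linear_scale[OF lin'] t_op_def)
      then show "app (comm (Endo (D_op \<rho> u r b)) (Endo (t_op \<rho> s b'))) v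
          = app (dot u (cvec s) *\<^sub>C Endo (t_op \<rho> (r + s) (b * b'))) v"
        unfolding br by (simp add: comm_def app_t app_D) (simp add: t_op_def D_op_def)
    qed
  next
    fix u v :: "complex ^ 'n" and r s :: "int ^ 'n" and b b' :: 'b
    assume u: "dot u (cvec r) = 0" and v: "dot v (cvec s) = 0"
    show "comm (Endo (D_op \<rho> u r b)) (Endo (D_op \<rho> v s b'))
        = Endo (D_op \<rho> (dot u (cvec s) *\<^sub>C v - dot v (cvec r) *\<^sub>C u) (r + s) (b * b'))"
    proof (rule endo_eqI)
      fix w
      have "\<rho> (lie_bracket (from_special (D u r) \<otimes>\<^sub>C b) (from_special (D v s) \<otimes>\<^sub>C b')) w
          = D_op \<rho> (dot u (cvec s) *\<^sub>C v - dot v (cvec r) *\<^sub>C u) (r + s) (b * b') w"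
        by (simp add: special_ext_brackets D_bracket[OF u v] D_op_def)
      then show "app (comm (Endo (D_op \<rho> u r b)) (Endo (D_op \<rho> v s b'))) w
          = app (Endo (D_op \<rho> (dot u (cvec s) *\<^sub>C v - dot v (cvec r) *\<^sub>C u) (r + s) (b * b'))) w"
        unfolding br by (simp add: comm_def app_D) (simp add: D_op_def)
    qed
  next
    fix W
    assume W: "cvs.subspace W"
      and t: "\<And>r b v. v \<in> W \<Longrightarrow> app (Endo (t_op \<rho> r b)) v \<in> W"
      and d: "\<And>u r b v. dot u (cvec r) = 0 \<Longrightarrow> v \<in> W \<Longrightarrow> app (Endo (D_op \<rho> u r b)) v \<in> W"
    have "\<rho> z v \<in> W" if v: "v \<in> W" for z v
    proof (induction z rule: tensor_induct)
      case (tens x b)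
      have l: "clinear (\<lambda>x. \<rho> (x \<otimes>\<^sub>C b) v)" by (rule clinear_compose[OF tens_linear(1) lin'])
      have ls: "clinear (\<lambda>X. \<rho> (from_special X \<otimes>\<^sub>C b) v)" by (rule clinear_compose[OF from_special_linear l])
      have ll: "clinear (\<lambda>f. \<rho> (from_laurent f \<otimes>\<^sub>C b) v)" by (rule clinear_compose[OF from_laurent_linear l])
      have 1: "\<rho> (from_special X \<otimes>\<^sub>C b) v \<in> W" for X
      proof -
        have "X \<in> cvs.span {D u r | u r. dot u (cvec r) = 0}" by (simp only: special_span UNIV_I)
        then show ?thesis
        proof (induction rule: cvs.span_induct_alt)
          case base
          show ?case by (simp add: cvs.linear_0[OF ls] cvs.subspace_0[OF W])
        next
          case (step c x y)
          then obtain u r where "x = D u r" "dot u (cvec r) = 0" by blast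
          then have "\<rho> (from_special x \<otimes>\<^sub>C b) v \<in> W" using d[of u r v b, unfolded app_D] v by (simp add: D_op_def)
          then show ?case using step.IH
            by (simp add: cvs.linear_add[OF ls] cvs.linear_scale[OF ls] cvs.subspace_add[OF W] cvs.subspace_scale[OF W])
        qed
      qed
      have 2: "\<rho> (from_laurent f \<otimes>\<^sub>C b) v \<in> W" for f
      proof -
        have "f \<in> cvs.span (range tpow)" by (simp only: laurent_span UNIV_I)
        then show ?thesis
        proof (induction rule: cvs.span_induct_alt)
          case base
          show ?case by (simp add: cvs.linear_0[OF ll] cvs.subspace_0[OF W])
        next
          case (step c x y)
          then obtain r where "x = tpow r" by blast
          then have "\<rho> (from_laurent x \<otimes>\<^sub>C b) v \<in> W" using t[of v r b, unfolded app_t] v by (simp add: t_op_def)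
          then show ?case using step.IH
            by (simp add: cvs.linear_add[OF ll] cvs.linear_scale[OF ll] cvs.subspace_add[OF W] cvs.subspace_scale[OF W])
        qed
      qed
      have "\<rho> (x \<otimes>\<^sub>C b) v = \<rho> (from_special (field_part x) \<otimes>\<^sub>C b) v + \<rho> (from_laurent (fun_part x) \<otimes>\<^sub>C b) v"
        using special_ext_split[of x] cvs.linear_add[OF l] by metis
      then show ?case using 1 2 by (simp add: cvs.subspace_add[OF W])
    next
      case (add y z)
      then show ?case by (simp add: cvs.linear_add[OF lin'] cvs.subspace_add[OF W])
    next
      case (scale a z)
      then show ?case by (simp add: cvs.linear_scale[OF lin'] cvs.subspace_scale[OF W])
    qed
    then have "\<forall>F\<in>range \<rho>. F ` W \<subseteq> W" by blast
    then show "W = {0} \<or> W = UNIV"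
      using irred W unfolding irreducible_module_def irreducible_under_def by simp
  next
    fix r :: "int ^ 'n"
    show "coord_weight_space (restrict_special \<rho>) (\<Lambda> + cvec r)
      = {v. \<forall>u. app (Endo (D_op \<rho> u 0 1)) v = dot u (\<Lambda> + cvec r) *\<^sub>C v}"
      by (simp add: coord_weight_space_def app_D) (simp add: restrict_special_def D_op_def)
    show "finite_dim (coord_weight_space (restrict_special \<rho>) (\<Lambda> + cvec r))"
      "cvs.dim (coord_weight_space (restrict_special \<rho>) (\<Lambda> + cvec r)) \<le> M"
      unfolding V by (intro M shifted_weight wt'(1))+
  next
    show "coord_weight_space (restrict_special \<rho>) (\<Lambda> + cvec 0) \<noteq> {0}"
      using wt' by (simp add: cvec_simps \<Lambda> weight_space_coord)
  next
    show "\<exists>s. s \<noteq> 0 \<and> Endo (t_op \<rho> s 1) \<noteq> 0" using t_s app_t by (metis app_endo_simps(1))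
  next
    show "Endo (t_op \<rho> 0 1) \<noteq> 0" using t_0 app_t by (metis app_endo_simps(1))
  qed
  then show ?thesis by blast
qed

theorem theorem3p17:
  fixes \<rho> :: "('n::finite special_ext, 'b::complex_comm_algebra_1) tensor \<Rightarrow> 'v::complex_vector \<Rightarrow> 'v"
    and wt :: "'n special \<Rightarrow> complex"
    and \<Lambda> :: "complex ^ 'n"
  assumes N: "CARD('n) \<ge> 2"
    and B: "\<exists>S::'b set. finite S \<and> algebra_generated S = UNIV"
    and irred: "irreducible_module \<rho>"
    and weight: "has_weight_decomposition (restrict_special \<rho>)"
    and bounded: "uniformly_bounded (restrict_special \<rho>)"
    and t_s: "\<exists>s v. s \<noteq> 0 \<and> t_op \<rho> s 1 v \<noteq> 0"
    and t_0: "\<exists>v. t_op \<rho> 0 1 v \<noteq> 0"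
    and wt: "wt \<in> weights (restrict_special \<rho>)"
    and \<Lambda>: "\<Lambda> = (\<chi> i. wt (cartan_d i))"
  shows "\<exists>c::complex. c \<noteq> 0 \<and> (\<forall>v. t_op \<rho> 0 1 v = c *\<^sub>C v) \<and>
    \<comment> \<open>(1)\<close>
    internal_direct_sum UNIV (\<lambda>r. coord_weight_space (restrict_special \<rho>) (\<Lambda> + cvec r)) \<and>
    (\<forall>r. inj (t_op \<rho> r 1)) \<and>
    weights (restrict_special \<rho>) = {wt + (\<Sum>i\<in>UNIV. of_int (k $ i) *\<^sub>C cartan_delta i) | k :: int ^ 'n. True} \<and>
    (\<exists>(\<psi> :: 'b \<Rightarrow> complex) (\<phi> :: 'b \<Rightarrow> complex) (f :: complex ^ 'n \<Rightarrow> 'b \<Rightarrow> complex).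
      \<comment> \<open>(2)\<close>
      algebra_hom \<psi> \<and> \<psi> 1 = 1 \<and>
      clinear \<phi> \<and> \<phi> 1 = 1 \<and>
      cbilinear f \<and> (\<forall>u. f u 1 = dot u \<Lambda>) \<and>
      (\<forall>r b v. r \<noteq> 0 \<longrightarrow> t_op \<rho> r b v = \<psi> b *\<^sub>C t_op \<rho> r 1 v) \<and>
      (\<forall>b v. t_op \<rho> 0 b v = \<phi> b *\<^sub>C t_op \<rho> 0 1 v) \<and>
      (\<forall>u r b v. r \<noteq> 0 \<and> dot u (cvec r) = 0 \<longrightarrow> D_op \<rho> u r b v = \<psi> b *\<^sub>C D_op \<rho> u r 1 v) \<and>
      (\<forall>u r b. \<forall>v \<in> coord_weight_space (restrict_special \<rho>) (\<Lambda> + cvec r).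
         D_op \<rho> u 0 b v = (f u b + dot u (cvec r) * \<psi> b) *\<^sub>C v) \<and>
      \<comment> \<open>(3)\<close>
      (\<exists>\<kappa> \<mu> :: complex. \<kappa> \<noteq> 0 \<and> \<mu> \<noteq> 0 \<and> \<kappa>\<^sup>2 = c * \<mu> \<and>
        (\<forall>m n b b' v.
          (m \<noteq> 0 \<and> n \<noteq> 0 \<and> m + n \<noteq> 0 \<longrightarrow>
             t_op \<rho> m b (t_op \<rho> n b' v) = \<kappa> *\<^sub>C t_op \<rho> (m + n) (b * b') v \<and>
             \<kappa> *\<^sub>C t_op \<rho> (m + n) (b * b') v = (\<psi> (b * b') * \<kappa>) *\<^sub>C t_op \<rho> (m + n) 1 v) \<and>
          (m \<noteq> 0 \<and> n \<noteq> 0 \<and> m + n = 0 \<longrightarrow>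
             t_op \<rho> m b (t_op \<rho> n b' v) = (\<psi> (b * b') * \<mu>) *\<^sub>C t_op \<rho> 0 1 v) \<and>
          (m \<noteq> 0 \<and> n = 0 \<longrightarrow>
             t_op \<rho> m b (t_op \<rho> n b' v) = (\<psi> b * \<phi> b' * c) *\<^sub>C t_op \<rho> m 1 v) \<and>
          (m = 0 \<and> n = 0 \<longrightarrow>
             t_op \<rho> m b (t_op \<rho> n b' v) = (\<phi> b * \<phi> b' * c) *\<^sub>C t_op \<rho> 0 1 v)))) \<and>
    \<comment> \<open>(4)\<close>
    (\<forall>v. v \<noteq> 0 \<longrightarrow>
       enveloping_orbit \<rho> v = UNIV \<and> enveloping_orbit (restrict_ext \<rho>) v = UNIV) \<and>
    irreducible_module (restrict_ext \<rho>) \<and>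
    has_weight_decomposition (restrict_special \<rho>) \<and>
    finite_dim_weight_spaces (restrict_special \<rho>) \<and>
    (\<exists>\<alpha>. irreducible_jet_module (restrict_special \<rho>) \<alpha>)"
proof -
  let ?t = "\<lambda>r b. Endo (t_op \<rho> r b)" and ?d = "\<lambda>u r b. Endo (D_op \<rho> u r b)"
    and ?V = "\<lambda>r. coord_weight_space (restrict_special \<rho>) (\<Lambda> + cvec r)"
  let ?\<sigma> = "restrict_special \<rho>"
  obtain M where "current_module ?t ?d ?V \<Lambda> M"
    using current_module_of_module[OF N irred bounded t_s t_0 wt \<Lambda>] by blast
  then interpret cm: current_module ?t ?d ?V \<Lambda> M .
  have \<rho>: "lie_module \<rho>" using irred by (simp add: irreducible_module_def)
  note lin = lie_moduleD(1)[OF \<rho>] and lin' = lie_moduleD(2)[OF \<rho>] and br = lie_moduleD(3)[OF \<rho>]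
  have app_t: "app (?t r b) = t_op \<rho> r b" for r b by (simp add: app_Endo t_op_def lin)
  have app_D: "app (?d u r b) = D_op \<rho> u r b" for u r b by (simp add: app_Endo D_op_def lin)
  have t_scale: "t_op \<rho> r b (a *\<^sub>C v) = a *\<^sub>C t_op \<rho> r b v" for r b a v
    by (simp add: t_op_def cvs.linear_scale[OF lin])
  have wt': "wt \<in> cartan_dual" "weight_space ?\<sigma> wt \<noteq> {0}" using wt by (simp_all add: weights_def)
  have nontriv: "\<exists>v::'v. v \<noteq> 0" using cm.V_exists by blast
  let ?c = "cm.c_const"
  have c: "t_op \<rho> 0 1 v = ?c *\<^sub>C v" for v
    using arg_cong[OF cm.c_const(1), of "\<lambda>x. app x v"] by (simp add: app_t)
  \<comment> \<open>the weight with coordinates \<open>\<Lambda> + r\<close>\<close>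
  define g where "g r = wt + (\<Sum>i\<in>UNIV. of_int (r $ i) *\<^sub>C cartan_delta i)" for r :: "int ^ 'n"
  have g: "g r \<in> cartan_dual" "(\<chi> j. g r (cartan_d j)) = \<Lambda> + cvec r" for r
    unfolding g_def using shifted_weight[OF wt'(1)] by (simp_all add: \<Lambda>)
  have V_g: "?V r = weight_space ?\<sigma> (g r)" for r
    by (simp only: weight_space_coord[OF g(1)] g(2))
  have "inj g"
  proof (rule injI)
    fix r s assume "g r = g s"
    then have "\<Lambda> + cvec r = \<Lambda> + cvec s" using g(2) by metis
    then show "r = s" by (simp add: cvec_def vec_eq_iff)
  qed
  have ds: "internal_direct_sum cartan_dual (weight_space ?\<sigma>)"
    using weight by (simp add: has_weight_decomposition_def)
  have span: "cvs.span (\<Union>r. weight_space ?\<sigma> (g r)) = UNIV" using cm.V_span by (simp only: V_g)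
  have "range g \<subseteq> cartan_dual" using g(1) by blast
  note reindex = internal_direct_sum_reindex[OF ds, OF \<open>inj g\<close>, OF this, OF span]
  have sum: "internal_direct_sum UNIV ?V" using reindex(1) by (simp only: V_g)
  have inj: "inj (t_op \<rho> r 1)" for r
  proof (rule injI)
    fix x y assume "t_op \<rho> r 1 x = t_op \<rho> r 1 y"
    then have "app (?t r 1) (x - y) = 0" by (simp add: app_simps) (simp add: app_t)
    then show "x = y" using cm.t_injective' by fastforce
  qed
  have weights: "weights ?\<sigma> = {g k | k. True}"
  proof safe
    fix \<mu> assume "\<mu> \<in> weights ?\<sigma>"
    then have "\<mu> \<in> range g" using reindex(2) by (simp add: weights_def)
    then show "\<exists>k. \<mu> = g k \<and> True" by blast
  next
    fix k
    obtain v where v: "v \<in> ?V 0" "v \<noteq> 0" using cm.V_exists by blast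
    have "app (?t k 1) v \<in> ?V (0 + k)" using cm.homog_t[of k 1] v(1) unfolding cm.homog_def by blast
    then have "app (?t k 1) v \<in> weight_space ?\<sigma> (g k)" by (simp add: V_g)
    moreover have "app (?t k 1) v \<noteq> 0" using cm.t_injective' v(2) by blast
    ultimately show "g k \<in> weights ?\<sigma>" using g(1) by (auto simp: weights_def)
  qed
  have fd: "finite_dim_weight_spaces ?\<sigma>"
    using bounded unfolding uniformly_bounded_def finite_dim_weight_spaces_def by blast
  have psi: "t_op \<rho> r b v = cm.psi b *\<^sub>C t_op \<rho> r 1 v" if "r \<noteq> 0" for r b v
    using arg_cong[OF cm.psi[OF that, of b], of "\<lambda>x. app x v"] by (simp add: app_t)
  have phi: "t_op \<rho> 0 b v = cm.phi b *\<^sub>C t_op \<rho> 0 1 v" for b v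
    using arg_cong[OF cm.phi[of b], of "\<lambda>x. app x v"] by (simp add: app_t)
  have Dpsi: "D_op \<rho> u r b v = cm.psi b *\<^sub>C D_op \<rho> u r 1 v" if "r \<noteq> 0" "dot u (cvec r) = 0" for u r b v
    using arg_cong[OF cm.d_psi[OF that, of b], of "\<lambda>x. app x v"] by (simp add: app_D)
  have D0: "D_op \<rho> u 0 b v = (cm.cartan_form u b + dot u (cvec r) * cm.psi b) *\<^sub>C v" if "v \<in> ?V r" for u r b v
    using cm.cartan_form_action[OF that] by (simp add: app_D)
  have tt: "t_op \<rho> m 1 (t_op \<rho> n 1 v) = cm.k m n *\<^sub>C t_op \<rho> (m + n) 1 v" for m n v
    using arg_cong[OF cm.k[of m n], of "\<lambda>x. app x v"] by (simp add: app_t)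
  have hom: "algebra_hom cm.psi"
    unfolding algebra_hom_def using cm.psi_linear cm.psi_mult by blast
  obtain \<kappa> \<mu> where \<kappa>: "\<kappa> \<noteq> 0" "\<mu> \<noteq> 0" "\<kappa>\<^sup>2 = ?c * \<mu>"
    and k1: "\<forall>m n. m \<noteq> 0 \<longrightarrow> n \<noteq> 0 \<longrightarrow> m + n \<noteq> 0 \<longrightarrow> cm.k m n = \<kappa>"
    and k2: "\<forall>m. m \<noteq> 0 \<longrightarrow> cm.k m (- m) = \<mu>"
    using cm.ex_kappa_mu by (elim exE conjE) (rule that)
  have q1: "t_op \<rho> m b (t_op \<rho> n b' v) = (cm.psi (b * b') * cm.k m n) *\<^sub>C t_op \<rho> (m + n) 1 v"
    if "m \<noteq> 0" "n \<noteq> 0" for m n b b' v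
    by (simp add: psi[OF that(1), of b] psi[OF that(2), of b'] t_scale tt scaleC_scaleC cm.psi_mult mult_ac)
  have quasi: "(m \<noteq> 0 \<and> n \<noteq> 0 \<and> m + n \<noteq> 0 \<longrightarrow>
             t_op \<rho> m b (t_op \<rho> n b' v) = \<kappa> *\<^sub>C t_op \<rho> (m + n) (b * b') v \<and>
             \<kappa> *\<^sub>C t_op \<rho> (m + n) (b * b') v = (cm.psi (b * b') * \<kappa>) *\<^sub>C t_op \<rho> (m + n) 1 v) \<and>
          (m \<noteq> 0 \<and> n \<noteq> 0 \<and> m + n = 0 \<longrightarrow>
             t_op \<rho> m b (t_op \<rho> n b' v) = (cm.psi (b * b') * \<mu>) *\<^sub>C t_op \<rho> 0 1 v) \<and>
          (m \<noteq> 0 \<and> n = 0 \<longrightarrow>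
             t_op \<rho> m b (t_op \<rho> n b' v) = (cm.psi b * cm.phi b' * ?c) *\<^sub>C t_op \<rho> m 1 v) \<and>
          (m = 0 \<and> n = 0 \<longrightarrow>
             t_op \<rho> m b (t_op \<rho> n b' v) = (cm.phi b * cm.phi b' * ?c) *\<^sub>C t_op \<rho> 0 1 v)" for m n b b' v
  proof (intro conjI impI)
    assume mn: "m \<noteq> 0 \<and> n \<noteq> 0 \<and> m + n \<noteq> 0"
    then show *: "\<kappa> *\<^sub>C t_op \<rho> (m + n) (b * b') v = (cm.psi (b * b') * \<kappa>) *\<^sub>C t_op \<rho> (m + n) 1 v"
      by (subst psi[of "m + n" "b * b'"]) (simp_all add: scaleC_scaleC mult_ac)
    show "t_op \<rho> m b (t_op \<rho> n b' v) = \<kappa> *\<^sub>C t_op \<rho> (m + n) (b * b') v"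
      unfolding * using mn q1[of m n b b' v] k1[rule_format, of m n] by simp
  next
    assume mn: "m \<noteq> 0 \<and> n \<noteq> 0 \<and> m + n = 0"
    then have "n = - m" by (simp add: eq_neg_iff_add_eq_0 add.commute)
    then show "t_op \<rho> m b (t_op \<rho> n b' v) = (cm.psi (b * b') * \<mu>) *\<^sub>C t_op \<rho> 0 1 v"
      using mn q1[of m n b b' v] k2[rule_format, of m] by simp
  next
    assume mn: "m \<noteq> 0 \<and> n = 0"
    then show "t_op \<rho> m b (t_op \<rho> n b' v) = (cm.psi b * cm.phi b' * ?c) *\<^sub>C t_op \<rho> m 1 v"
      by (simp add: phi[of b'] c t_scale psi[of m b] scaleC_scaleC mult_ac)
  next
    assume mn: "m = 0 \<and> n = 0"
    then show "t_op \<rho> m b (t_op \<rho> n b' v) = (cm.phi b * cm.phi b' * ?c) *\<^sub>C t_op \<rho> 0 1 v"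
      by (simp add: phi[of b] phi[of b'] c scaleC_scaleC mult_ac)
  qed
  have lr: "clinear (\<lambda>x. restrict_ext \<rho> x v)" "clinear (restrict_ext \<rho> x)" for v x
    unfolding restrict_ext_def by (rule clinear_compose[OF tens_linear(1) lin'], rule lin)
  have ls: "clinear (\<lambda>x. ?\<sigma> x v)" "clinear (?\<sigma> x)" for v x
    unfolding restrict_special_def
    by (rule clinear_compose[OF clinear_compose[OF from_special_linear tens_linear(1)] lin'], rule lin)
  have lie_ext: "lie_module (restrict_ext \<rho>)"
    unfolding lie_module_def cbilinear_def
  proof (intro conjI allI lr)
    fix x y v
    show "restrict_ext \<rho> (lie_bracket x y) v = restrict_ext \<rho> x (restrict_ext \<rho> y v) - restrict_ext \<rho> y (restrict_ext \<rho> x v)"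
      using br[of "x \<otimes>\<^sub>C 1" "y \<otimes>\<^sub>C 1" v] by (simp add: restrict_ext_def)
  qed
  have lie_special: "lie_module ?\<sigma>"
    unfolding lie_module_def cbilinear_def
  proof (intro conjI allI ls)
    fix X Y v
    show "?\<sigma> (lie_bracket X Y) v = ?\<sigma> X (?\<sigma> Y v) - ?\<sigma> Y (?\<sigma> X v)"
      using br[of "from_special X \<otimes>\<^sub>C 1" "from_special Y \<otimes>\<^sub>C 1" v]
      by (simp add: restrict_special_def special_ext_brackets)
  qed
  have irr_ext: "irreducible_module (restrict_ext \<rho>)"
    unfolding irreducible_module_def irreducible_under_def
  proof (intro conjI allI impI lie_ext nontriv)
    fix W assume W: "cvs.subspace W \<and> (\<forall>F\<in>range (restrict_ext \<rho>). F ` W \<subseteq> W)"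
    then have stable: "restrict_ext \<rho> x v \<in> W" if "v \<in> W" for x v using that by blast
    show "W = {0} \<or> W = UNIV"
    proof (rule cm.irreducible_restricted)
      show "cvs.subspace W" using W by blast
      show "app (?t r 1) v \<in> W" if "v \<in> W" for r v
        using stable[OF that, of "from_laurent (tpow r)"] unfolding app_t by (simp add: restrict_ext_def t_op_def)
      show "app (?d u r 1) v \<in> W" if "v \<in> W" for u r v
        using stable[OF that, of "from_special (D u r)"] unfolding app_D by (simp add: restrict_ext_def D_op_def)
    qed
  qed
  \<comment> \<open>\<open>t\<^sup>r\<close> acts by \<open>X r\<close> in the associative action\<close>
  obtain X where X0: "X 0 = 1" and XX: "\<forall>m n. X m * X n = X (m + n)"
    and tX: "\<forall>r. r \<noteq> 0 \<longrightarrow> (\<exists>a. ?t r 1 = a *\<^sub>C X r)"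
    and dX: "\<forall>u s m. dot u (cvec s) = 0 \<longrightarrow> comm (?d u s 1) (X m) = dot u (cvec m) *\<^sub>C X (s + m)"
    using cm.jet_operators by (elim exE conjE) (rule that)
  define \<alpha> where "\<alpha> f v = lin_ext (\<lambda>r. app (X r) v) f" for f v
  have \<alpha>1: "clinear (\<lambda>f. \<alpha> f v)" for v unfolding \<alpha>_def by (rule lin_ext_linear)
  have \<alpha>2: "clinear (\<alpha> f)" for f
    by (rule clinearI) (simp_all add: \<alpha>_def lin_ext_def app_simps scaleC_add_right sum.distrib
        cvs.scale_sum_right scaleC_scaleC mult.commute)
  have \<alpha>t: "\<alpha> (tpow r) v = app (X r) v" for r v by (simp add: \<alpha>_def tpow_def scaleC_one)
  have tpow_ind: "P f" if "\<And>r. P (tpow r)" "P 0" "\<And>a f g. P f \<Longrightarrow> P g \<Longrightarrow> P (a *\<^sub>C f + g)"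
    for P and f :: "'n laurent"
  proof -
    have "f \<in> cvs.span (range tpow)" by (simp only: laurent_span UNIV_I)
    then show ?thesis by (induction rule: cvs.span_induct_alt) (use that in auto)
  qed
  note \<alpha>s = cvs.linear_add[OF \<alpha>1] cvs.linear_scale[OF \<alpha>1] cvs.linear_0[OF \<alpha>1]
    cvs.linear_add[OF \<alpha>2] cvs.linear_scale[OF \<alpha>2] cvs.linear_0[OF \<alpha>2]
  have \<alpha>_mult: "\<alpha> (f * h) v = \<alpha> f (\<alpha> h v)" for f h v
  proof (induction f rule: tpow_ind)
    case (1 r)
    show ?case
    proof (induction h rule: tpow_ind)
      case (1 s)
      have "tpow r * tpow s = tpow (r + s)" by (simp add: tpow_def mult_single)
      then show ?case by (simp add: \<alpha>t XX flip: app_endo_simps(6))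
    next
      case (3 a f h)
      then show ?case by (simp add: \<alpha>s distrib_left mult_scaleC_right)
    qed (simp add: \<alpha>s)
  next
    case (3 a f h)
    then show ?case by (simp add: \<alpha>s distrib_right mult_scaleC_left)
  qed (simp add: \<alpha>s)
  have \<alpha>_one: "\<alpha> 1 v = v" for v
  proof -
    have "tpow 0 = (1 :: 'n laurent)" by (simp add: tpow_def)
    then show ?thesis using \<alpha>t[of 0 v] by (simp add: X0)
  qed
  note \<sigma>s = cvs.linear_add[OF ls(1)] cvs.linear_scale[OF ls(1)] cvs.linear_0[OF ls(1)]
    cvs.linear_add[OF ls(2)] cvs.linear_scale[OF ls(2)] cvs.linear_0[OF ls(2)]
  have compat: "?\<sigma> x (\<alpha> f v) = \<alpha> (special_apply x f) v + \<alpha> f (?\<sigma> x v)" for x f v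
  proof -
    have "x \<in> cvs.span {D u r | u r. dot u (cvec r) = 0}" by (simp only: special_span UNIV_I)
    then show ?thesis
    proof (induction rule: cvs.span_induct_alt)
      case base
      show ?case by (simp add: \<alpha>s \<sigma>s special_apply_0)
    next
      case (step a x y)
      then obtain u s where x: "x = D u s" and u: "dot u (cvec s) = 0" by blast
      have "?\<sigma> x (\<alpha> f v) = \<alpha> (special_apply x f) v + \<alpha> f (?\<sigma> x v)"
      proof (induction f rule: tpow_ind)
        case (1 m)
        have "?\<sigma> x = app (?d u s 1)" by (simp add: app_D) (simp add: x restrict_special_def D_op_def fun_eq_iff)
        then have "?\<sigma> x (app (X m) v) = app (comm (?d u s 1) (X m)) v + app (X m) (?\<sigma> x v)"
          by (simp add: comm_def)
        then show ?case by (simp add: \<alpha>t dX[rule_format, OF u] x special_apply_D[OF u] \<alpha>s)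
      next
        case (3 b f h)
        then show ?case by (simp add: \<alpha>s \<sigma>s special_apply_simps scaleC_add_right)
      qed (simp add: \<alpha>s \<sigma>s special_apply_0)
      then show ?case using step.IH
        by (simp add: \<alpha>s \<sigma>s special_apply_simps scaleC_add_right)
    qed
  qed
  have "irreducible_jet_module ?\<sigma> \<alpha>"
    unfolding irreducible_jet_module_def jet_module_def irreducible_under_def cbilinear_def
  proof (intro conjI allI impI lie_special weight fd \<alpha>1 \<alpha>2 \<alpha>_one \<alpha>_mult compat nontriv)
    fix W assume W: "cvs.subspace W \<and> (\<forall>F\<in>range ?\<sigma> \<union> range \<alpha>. F ` W \<subseteq> W)"
    then have stable: "?\<sigma> x v \<in> W" "\<alpha> f v \<in> W" if "v \<in> W" for x f v using that by blast+
    show "W = {0} \<or> W = UNIV"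
    proof (rule cm.irreducible_restricted)
      show "cvs.subspace W" using W by blast
      show "app (?t r 1) v \<in> W" if r: "r \<noteq> 0" and v: "v \<in> W" for r v
      proof -
        obtain a where "?t r 1 = a *\<^sub>C X r" using tX[rule_format, OF r] by blast
        then have "app (?t r 1) v = a *\<^sub>C \<alpha> (tpow r) v" by (simp add: \<alpha>t)
        then show ?thesis using stable(2)[OF v, of "tpow r"] W by (simp add: cvs.subspace_scale)
      qed
      show "app (?d u r 1) v \<in> W" if "v \<in> W" for u r v
        using stable(1)[OF that, of "D u r"] unfolding app_D by (simp add: restrict_special_def D_op_def)
    qed
  qed
  then have jet: "\<exists>\<alpha>. irreducible_jet_module ?\<sigma> \<alpha>" by blast
  show ?thesis
  proof (intro exI[of _ ?c] conjI)
    show "?c \<noteq> 0" by (rule cm.c_const(2))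
    show "\<forall>v. t_op \<rho> 0 1 v = ?c *\<^sub>C v" using c by blast
    show "weights ?\<sigma> = {wt + (\<Sum>i\<in>UNIV. of_int (k $ i) *\<^sub>C cartan_delta i) | k :: int ^ 'n. True}"
      using weights by (simp only: g_def)
    show "\<forall>r. inj (t_op \<rho> r 1)" using inj by blast
    show "\<forall>v. v \<noteq> 0 \<longrightarrow> enveloping_orbit \<rho> v = UNIV \<and> enveloping_orbit (restrict_ext \<rho>) v = UNIV"
      using enveloping_orbit_UNIV[OF irred] enveloping_orbit_UNIV[OF irr_ext] by blast
    show "\<exists>\<psi> \<phi> f. algebra_hom \<psi> \<and> \<psi> 1 = 1 \<and> clinear \<phi> \<and> \<phi> 1 = 1 \<and>
      cbilinear f \<and> (\<forall>u. f u 1 = dot u \<Lambda>) \<and>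
      (\<forall>r b v. r \<noteq> 0 \<longrightarrow> t_op \<rho> r b v = \<psi> b *\<^sub>C t_op \<rho> r 1 v) \<and>
      (\<forall>b v. t_op \<rho> 0 b v = \<phi> b *\<^sub>C t_op \<rho> 0 1 v) \<and>
      (\<forall>u r b v. r \<noteq> 0 \<and> dot u (cvec r) = 0 \<longrightarrow> D_op \<rho> u r b v = \<psi> b *\<^sub>C D_op \<rho> u r 1 v) \<and>
      (\<forall>u r b. \<forall>v \<in> ?V r. D_op \<rho> u 0 b v = (f u b + dot u (cvec r) * \<psi> b) *\<^sub>C v) \<and>
      (\<exists>\<kappa> \<mu> :: complex. \<kappa> \<noteq> 0 \<and> \<mu> \<noteq> 0 \<and> \<kappa>\<^sup>2 = ?c * \<mu> \<and>
        (\<forall>m n b b' v.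
          (m \<noteq> 0 \<and> n \<noteq> 0 \<and> m + n \<noteq> 0 \<longrightarrow>
             t_op \<rho> m b (t_op \<rho> n b' v) = \<kappa> *\<^sub>C t_op \<rho> (m + n) (b * b') v \<and>
             \<kappa> *\<^sub>C t_op \<rho> (m + n) (b * b') v = (\<psi> (b * b') * \<kappa>) *\<^sub>C t_op \<rho> (m + n) 1 v) \<and>
          (m \<noteq> 0 \<and> n \<noteq> 0 \<and> m + n = 0 \<longrightarrow>
             t_op \<rho> m b (t_op \<rho> n b' v) = (\<psi> (b * b') * \<mu>) *\<^sub>C t_op \<rho> 0 1 v) \<and>
          (m \<noteq> 0 \<and> n = 0 \<longrightarrow>
             t_op \<rho> m b (t_op \<rho> n b' v) = (\<psi> b * \<phi> b' * ?c) *\<^sub>C t_op \<rho> m 1 v) \<and>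
          (m = 0 \<and> n = 0 \<longrightarrow>
             t_op \<rho> m b (t_op \<rho> n b' v) = (\<phi> b * \<phi> b' * ?c) *\<^sub>C t_op \<rho> 0 1 v)))"
    proof (rule exI[of _ cm.psi], rule exI[of _ cm.phi], rule exI[of _ cm.cartan_form], intro conjI)
      show "\<forall>u r b. \<forall>v \<in> ?V r. D_op \<rho> u 0 b v = (cm.cartan_form u b + dot u (cvec r) * cm.psi b) *\<^sub>C v"
        using D0 by blast
      show "\<forall>u r b v. r \<noteq> 0 \<and> dot u (cvec r) = 0 \<longrightarrow> D_op \<rho> u r b v = cm.psi b *\<^sub>C D_op \<rho> u r 1 v"
        using Dpsi by blast
      show "\<forall>b v. t_op \<rho> 0 b v = cm.phi b *\<^sub>C t_op \<rho> 0 1 v" using phi by blast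
      show "\<forall>r b v. r \<noteq> 0 \<longrightarrow> t_op \<rho> r b v = cm.psi b *\<^sub>C t_op \<rho> r 1 v" using psi by blast
      show "\<forall>u. cm.cartan_form u 1 = dot u \<Lambda>" using cm.cartan_form_one by blast
    qed ((rule hom cm.psi_one cm.phi_linear cm.phi_one cm.cartan_form_bilinear)+,
        rule exI[of _ \<kappa>], rule exI[of _ \<mu>], rule conjI[OF \<kappa>(1)], rule conjI[OF \<kappa>(2)],
        rule conjI[OF \<kappa>(3)], (rule allI)+, rule quasi)
  qed (rule sum irr_ext weight fd jet)+
qed

end
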